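(* Let $k$, $\chi$, $U(\chi)$, $\tau$, $\mathbf c\in k^n$, $B_i\in U(\chi)$, $\mathrm{Heis}(\chi)^\vee$, $B_i^\vee\in\mathrm{Heis}(\chi)^\vee$ be as in the context. For any homogeneous noncommutative polynomial $p(x_1,\dots,x_n)$ of degree $\lambda\in\mathbb N^n$ one has $$\pi_{0,0}\circ P_{-\lambda}\big(p(B_1,\dots,B_n)\big)=\pi_{0,0}^\vee\big(p(B_1^\vee,\dots,B_n^\vee)\big).$$
   Context: Let $k$ be a field, $\mathbb N=\{0,1,2,\dots\}$, $I=\{1,\dots,n\}$, $\{\alpha_i\}_{i\in I}$ the standard basis of $\mathbb Z^n$. Let $\chi:\mathbb Z^n\times\mathbb Z^n\to k^\times$ be a bicharacter with $q_{ij}:=\chi(\alpha_i,\alpha_j)=q_{ji}$ for all $i,j$. $H=k[K_i^{\pm1}\mid i\in I]$ is the group algebra of $\mathbb Z^n$ and $K_\lambda=K_1^{\lambda_1}\cdots K_n^{\lambda_n}$. $\widetilde U(\chi)$ is the Hopf algebra with generators $E_i,F_i,K_i^{\pm1}$, relations $K_iK_i^{-1}=1=K_i^{-1}K_i$, $K_iK_j=K_jK_i$, $K_iE_j=q_{ij}E_jK_i$, $K_iF_j=q_{ij}^{-1}F_jK_i$, $E_iF_j-F_jE_i=\delta_{ij}(K_i-K_i^{-1})$ and coproduct $\Delta(E_i)=E_i\otimes1+K_i\otimes E_i$, $\Delta(F_i)=F_i\otimes K_i^{-1}+1\otimes F_i$, $\Delta(K_i)=K_i\otimes K_i$. The subalgebras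 generated by the $E_i$, resp. the $F_i$, are the tensor algebras $T(V^+(\chi))$, $T(V^-(\chi))$ on $V^+(\chi)=\mathrm{span}\{E_i\}$, $V^-(\chi)=\mathrm{span}\{F_i\}$. $V^+(\chi)$ is a Yetter–Drinfeld module over $H$ with $K_i\cdot E_j=q_{ij}E_j$, $\delta(E_i)=K_i\otimes E_i$, so $T(V^+(\chi))$ is a $\mathbb Z^n$-graded braided Hopf algebra ($\deg E_i=\alpha_i$). $\omega$ is the algebra automorphism of $\widetilde U(\chi)$ with $\omega(E_i)=F_i$, $\omega(F_i)=E_i$, $\omega(K_i)=K_i^{-1}$. Fix a $\mathbb Z^n$-graded biideal $\mathcal I\subseteq\bigoplus_{m\ge2}T(V^+(\chi))_m$. Put $U(\chi)=\widetilde U(\chi)/(\mathcal I,\omega(\mathcal I))$, $U^+=T(V^+(\chi))/\mathcal I$ (a pre-Nichols algebra of diagonal type), $U^-=T(V^-(\chi))/\omega(\mathcal I)$. Multiplication $U^+\otimes H\otimes U^-\to U(\chi)$ is a linear isomorphism; $U^\pm$ are graded with $\deg E_i=\alpha_i$, $\deg F_i=-\alpha_i$. Let $\tau:I\to I$ be a bijection with $\tau^2=\mathrm{id}$, $q_{\tau(i)\tau(j)}=q_{ij}$, and assume $\tau(\mathcal I)=\mathcal I$ for the automorphism $E_i\mapsto E_{\tau(i)}$; extend $\tau$ to $\mathbb Z^n$ by $\tau(\alpha_i)=\alpha_{\tau(i)}$ and put $\mathbb Z^n_\theta=\{\lambda\in\mathbb Z^n\mid\tau(\lambda)=-\lambda\}$.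 For $\mathbf c=(c_1,\dots,c_n)\in k^n$ put $B_i=F_i+c_iE_{\tau(i)}K_i^{-1}\in U(\chi)$. Projections: let $G^-\subset U(\chi)$ be the subalgebra generated by the $F_iK_i$; $U(\chi)=\bigoplus_{\lambda\in\mathbb Z^n}U^+K_\lambda G^-$ and $P_\lambda:U(\chi)\to U^+K_\lambda G^-$ is the corresponding projection. Also $U(\chi)=\bigoplus_{\alpha,\beta\in\mathbb N^n}U^+_\alpha HU^-_{-\beta}$ and $\pi_{0,0}:U(\chi)\to H$ is the projection onto the summand $\alpha=\beta=0$. Negative Heisenberg double: $\widetilde E_i=E_iK_i^{-1}$, $G^+$ is the subalgebra of $U(\chi)$ generated by the $\widetilde E_i$, and $U(\chi)^{\mathrm{poly}}$ is the subalgebra of $U(\chi)$ generated by $F_i,\widetilde E_i,K_i^{-1},K_iK_{\tau(i)}^{-1}$, $i\in I$. It is $\mathbb N$-filtered by the degree function $\deg(\widetilde E_i)=\deg(F_i)=\deg(K_i^{-1})=1$, $\deg(K_iK_{\tau(i)}^{-1})=0$ on generators, and $\mathrm{Heis}(\chi)^\vee$ is the associated graded algebra. Keep the same letters for the classes of $\widetilde E_i,F_i$ and $K_\lambda$ ($\lambda\in-\mathbb N^n+\mathbb Z^n_\theta$) in $\mathrm{Heis}(\chi)^\vee$. Then $G^+$, $k[K_\lambda\mid\lambda\in-\mathbb N^n+\mathbb Z^n_\theta]$, $U^-$ are subalgebras of $\mathrm{Heis}(\chi)^\vee$ and multiplication from their tensor product (in this order) to $\mathrm{Heis}(\chi)^\vee$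 is a linear isomorphism. With $G^+_+,U^-_+$ the augmentation ideals, $\pi^\vee_{0,0}:\mathrm{Heis}(\chi)^\vee\to k[K_\lambda\mid\lambda\in-\mathbb N^n+\mathbb Z^n_\theta]$ is the projection with kernel $G^+_+\mathrm{Heis}(\chi)^\vee+\mathrm{Heis}(\chi)^\vee U^-_+$. Put $B_i^\vee=F_i+c_i\widetilde E_{\tau(i)}(K_{\tau(i)}K_i^{-1})\in\mathrm{Heis}(\chi)^\vee$. Both sides of the claimed identity are compared via the identification of $K_\mu$ in $U(\chi)$ with $K_\mu$ in $\mathrm{Heis}(\chi)^\vee$. Noncommutative polynomials are elements of $k\langle x_1,\dots,x_n\rangle$, homogeneous with respect to $\deg x_i=\alpha_i$. *)

theory Defs
  imports
    "HOL-Library.Poly_Mapping"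
    "HOL-Algebra.QuotRing"
    "HOL-Algebra.Generated_Rings"
    "HOL-Algebra.Algebraic_Closure_Type"
    "HOL-Analysis.Finite_Cartesian_Product"
begin

section \<open>Free algebras\<close>

text \<open>Words form a monoid under concatenation, written additively so that
  \<open>'g list \<Rightarrow>\<^sub>0 'k\<close> is the free associative algebra on the letters \<open>'g\<close> (equivalently, the
  tensor algebra on the vector space with basis \<open>'g\<close>).\<close>

instantiation list :: (type) monoid_add
begin
definition zero_list_def: "(0 :: 'a list) = []"
definition plus_list_def: "(xs :: 'a list) + ys = xs @ ys"
instance by standard (simp_all add: zero_list_def plus_list_def)
end

type_synonym ('g, 'k) free_alg = "'g list \<Rightarrow>\<^sub>0 'k"

definition letter :: "'g \<Rightarrow> ('g, 'k::field) free_alg" where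
  "letter g = Poly_Mapping.single [g] 1"

definition const :: "'k \<Rightarrow> ('g, 'k::field) free_alg" where
  "const c = Poly_Mapping.single [] c"

section \<open>Algebras over a field\<close>

text \<open>An associative unital \<open>k\<close>-algebra is given by a ring \<open>R\<close> together with its structure map
  \<open>s :: 'k \<Rightarrow> 'a\<close>; scalar multiplication is \<open>s c \<otimes>\<^bsub>R\<^esub> x\<close>.\<close>

definition word_prod :: "('a, 'm) ring_scheme \<Rightarrow> ('g \<Rightarrow> 'a) \<Rightarrow> 'g list \<Rightarrow> 'a" where
  "word_prod R x w = foldr (\<lambda>g y. x g \<otimes>\<^bsub>R\<^esub> y) w \<one>\<^bsub>R\<^esub>"

definition nc_eval ::
  "('a, 'm) ring_scheme \<Rightarrow> ('k \<Rightarrow> 'a) \<Rightarrow> ('g \<Rightarrow> 'a) \<Rightarrow> ('g, 'k::field) free_alg \<Rightarrow> 'a" where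
  "nc_eval R s x p =
     (\<Oplus>\<^bsub>R\<^esub>w\<in>Poly_Mapping.keys p. s (Poly_Mapping.lookup p w) \<otimes>\<^bsub>R\<^esub> word_prod R x w)"

definition lin_span :: "('a, 'm) ring_scheme \<Rightarrow> ('k \<Rightarrow> 'a) \<Rightarrow> 'a set \<Rightarrow> 'a set" where
  "lin_span R s S = generate (add_monoid R) {s c \<otimes>\<^bsub>R\<^esub> x | c x. x \<in> S}"

definition subalg :: "('a, 'm) ring_scheme \<Rightarrow> ('k \<Rightarrow> 'a) \<Rightarrow> 'a set \<Rightarrow> 'a set" where
  "subalg R s S = generate_ring R (range s \<union> S)"

text \<open>The projection of \<open>R = (\<Oplus>t\<in>T. V t)\<close> onto the summand \<open>V t0\<close>; it is only meaningful if the
  sum is direct.\<close>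

definition summand_proj ::
  "('a, 'm) ring_scheme \<Rightarrow> 't set \<Rightarrow> ('t \<Rightarrow> 'a set) \<Rightarrow> 't \<Rightarrow> 'a \<Rightarrow> 'a" where
  "summand_proj R T V t0 u =
     (THE v. \<exists>f. (\<forall>t\<in>T. f t \<in> V t) \<and> finite {t\<in>T. f t \<noteq> \<zero>\<^bsub>R\<^esub>} \<and>
                 u = (\<Oplus>\<^bsub>R\<^esub>t\<in>{t\<in>T. f t \<noteq> \<zero>\<^bsub>R\<^esub>}. f t) \<and> v = f t0)"

section \<open>Associated graded algebra\<close>

text \<open>For a filtration \<open>Fil 0 \<subseteq> Fil 1 \<subseteq> \<dots>\<close> of an algebra contained in \<open>R\<close>, an element of the
  associated graded algebra is a finitely supported family of cosets
  \<open>f m \<in> Fil m / Fil (m - 1)\<close>, where \<open>Fil (-1) = 0\<close>. As in \<^const>\<open>rcoset_mult\<close>, products are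
  formed from all choices of representatives.\<close>

definition fil_pred :: "('a, 'm) ring_scheme \<Rightarrow> (nat \<Rightarrow> 'a set) \<Rightarrow> nat \<Rightarrow> 'a set" where
  "fil_pred R Fil m = (case m of 0 \<Rightarrow> {\<zero>\<^bsub>R\<^esub>} | Suc l \<Rightarrow> Fil l)"

definition gr_class ::
  "('a, 'm) ring_scheme \<Rightarrow> (nat \<Rightarrow> 'a set) \<Rightarrow> nat \<Rightarrow> 'a \<Rightarrow> nat \<Rightarrow> 'a set" where
  "gr_class R Fil d u =
     (\<lambda>m. if m = d then fil_pred R Fil m +>\<^bsub>R\<^esub> u else fil_pred R Fil m)"

definition assoc_graded ::
  "('a, 'm) ring_scheme \<Rightarrow> (nat \<Rightarrow> 'a set) \<Rightarrow> (nat \<Rightarrow> 'a set) ring" where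
  "assoc_graded R Fil =
    \<lparr>carrier = {f. (\<forall>m. \<exists>u\<in>Fil m. f m = fil_pred R Fil m +>\<^bsub>R\<^esub> u) \<and>
                   finite {m. f m \<noteq> fil_pred R Fil m}},
     monoid.mult = (\<lambda>f g m. \<Union>x\<in>Pi UNIV f. \<Union>y\<in>Pi UNIV g.
               fil_pred R Fil m +>\<^bsub>R\<^esub> (\<Oplus>\<^bsub>R\<^esub>j\<in>{..m}. x j \<otimes>\<^bsub>R\<^esub> y (m - j))),
     one = gr_class R Fil 0 \<one>\<^bsub>R\<^esub>,
     ring.zero = fil_pred R Fil,
     add = (\<lambda>f g m. f m <+>\<^bsub>R\<^esub> g m)\<rparr>"

section \<open>Bicharacters and the lattice\<close>

type_synonym 'n lat = "int ^ 'n"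

definition alpha :: "'n::finite \<Rightarrow> 'n lat" where
  "alpha i = axis i 1"

definition nonneg :: "'n::finite lat set" where
  "nonneg = {v. \<forall>i. 0 \<le> v $ i}"

definition bicharacter :: "('n::finite lat \<Rightarrow> 'n lat \<Rightarrow> 'k::field) \<Rightarrow> bool" where
  "bicharacter chi \<longleftrightarrow>
     (\<forall>a b. chi a b \<noteq> 0) \<and>
     (\<forall>a b d. chi (a + b) d = chi a d * chi b d) \<and>
     (\<forall>a b d. chi a (b + d) = chi a b * chi a d)"

definition q :: "('n::finite lat \<Rightarrow> 'n lat \<Rightarrow> 'k::field) \<Rightarrow> 'n \<Rightarrow> 'n \<Rightarrow> 'k" where
  "q chi i j = chi (alpha i) (alpha j)"

definition weight :: "'n::finite list \<Rightarrow> 'n lat" where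
  "weight w = sum_list (map alpha w)"

definition homogeneous :: "'n::finite lat \<Rightarrow> ('n, 'k::field) free_alg \<Rightarrow> bool" where
  "homogeneous lam p \<longleftrightarrow> (\<forall>w\<in>Poly_Mapping.keys p. weight w = lam)"

definition hom_component ::
  "'n::finite lat \<Rightarrow> ('n, 'k::field) free_alg \<Rightarrow> ('n, 'k) free_alg" where
  "hom_component a p =
     (\<Sum>w\<in>{w\<in>Poly_Mapping.keys p. weight w = a}. Poly_Mapping.single w (Poly_Mapping.lookup p w))"

text \<open>The involution of \<open>\<int>\<^sup>n\<close> determined by \<open>\<alpha>\<^sub>i \<mapsto> \<alpha>\<^sub>\<tau>\<^sub>(\<^sub>i\<^sub>)\<close>.\<close>

definition tau_lattice :: "('n::finite \<Rightarrow> 'n) \<Rightarrow> 'n lat \<Rightarrow> 'n lat" where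
  "tau_lattice tau lam = (\<Sum>i\<in>UNIV. (lam $ i) *s alpha (tau i))"

definition lattice_theta :: "('n::finite \<Rightarrow> 'n) \<Rightarrow> 'n lat set" where
  "lattice_theta tau = {lam. tau_lattice tau lam = - lam}"

definition lattice_poly :: "('n::finite \<Rightarrow> 'n) \<Rightarrow> 'n lat set" where
  "lattice_poly tau = {- b + z | b z. b \<in> nonneg \<and> z \<in> lattice_theta tau}"

section \<open>Biideals of the braided tensor algebra\<close>

text \<open>\<open>T(V\<^sup>+)\<close> is \<open>('n, 'k) free_alg\<close> with letter \<open>i\<close> standing for \<open>E\<^sub>i\<close>. Its tensor square is
  spanned by pairs of words and carries the product twisted by the Yetter-Drinfeld braiding
  \<open>x \<otimes> y \<mapsto> \<chi>(deg x, deg y) y \<otimes> x\<close>; the coproduct is the algebra homomorphism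
  with \<open>E\<^sub>i \<mapsto> E\<^sub>i \<otimes> 1 + 1 \<otimes> E\<^sub>i\<close>.\<close>

definition tensor ::
  "('n, 'k::field) free_alg \<Rightarrow> ('n, 'k) free_alg \<Rightarrow> ('n list \<times> 'n list) \<Rightarrow>\<^sub>0 'k" where
  "tensor x y = (\<Sum>u\<in>Poly_Mapping.keys x. \<Sum>v\<in>Poly_Mapping.keys y.
     Poly_Mapping.single (u, v) (Poly_Mapping.lookup x u * Poly_Mapping.lookup y v))"

definition tensor_scalar :: "'k \<Rightarrow> ('n list \<times> 'n list) \<Rightarrow>\<^sub>0 'k::field" where
  "tensor_scalar c = Poly_Mapping.single ([], []) c"

definition braided_square ::
  "('n::finite lat \<Rightarrow> 'n lat \<Rightarrow> 'k::field) \<Rightarrow> (('n list \<times> 'n list) \<Rightarrow>\<^sub>0 'k) ring" where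
  "braided_square chi =
    \<lparr>carrier = UNIV,
     monoid.mult = (\<lambda>s t. \<Sum>(u, v)\<in>Poly_Mapping.keys s. \<Sum>(u', v')\<in>Poly_Mapping.keys t.
       Poly_Mapping.single (u @ u', v @ v')
         (Poly_Mapping.lookup s (u, v) * Poly_Mapping.lookup t (u', v')
            * chi (weight v) (weight u'))),
     one = tensor_scalar 1,
     ring.zero = 0,
     add = (+)\<rparr>"

definition coproduct ::
  "('n::finite lat \<Rightarrow> 'n lat \<Rightarrow> 'k::field) \<Rightarrow> ('n, 'k) free_alg
     \<Rightarrow> ('n list \<times> 'n list) \<Rightarrow>\<^sub>0 'k" where
  "coproduct chi =
     nc_eval (braided_square chi) tensor_scalar (\<lambda>i. tensor (letter i) 1 + tensor 1 (letter i))"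

definition counit :: "('n, 'k::field) free_alg \<Rightarrow> 'k" where
  "counit p = Poly_Mapping.lookup p []"

definition graded_biideal ::
  "('n::finite lat \<Rightarrow> 'n lat \<Rightarrow> 'k::field) \<Rightarrow> ('n, 'k) free_alg set \<Rightarrow> bool" where
  "graded_biideal chi J \<longleftrightarrow>
     ideal J ring_of_type_algebra \<and>
     (\<forall>p\<in>J. \<forall>a. hom_component a p \<in> J) \<and>
     (\<forall>p\<in>J. counit p = 0) \<and>
     (\<forall>p\<in>J. coproduct chi p \<in>
        lin_span (braided_square chi) tensor_scalar {tensor x y | x y. x \<in> J \<or> y \<in> J})"

text \<open>The subspace \<open>\<Oplus>\<^sub>m\<^sub>\<ge>\<^sub>2 T(V\<^sup>+)\<^sub>m\<close>.\<close>

definition degree_ge_two :: "('n, 'k::field) free_alg set" where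
  "degree_ge_two = {p. \<forall>w\<in>Poly_Mapping.keys p. 2 \<le> length w}"

section \<open>The algebra \<open>U(\<chi>)\<close>\<close>

datatype 'n gen = gE 'n | gF 'n | gK 'n | gKi 'n  \<comment> \<open>\<open>gKi i\<close> is the letter for \<open>K\<^sub>i\<^sup>-\<^sup>1\<close>\<close>

definition relations ::
  "('n::finite lat \<Rightarrow> 'n lat \<Rightarrow> 'k::field) \<Rightarrow> ('n gen, 'k) free_alg set" where
  "relations chi =
     {letter (gK i) * letter (gKi i) - 1 | i. True} \<union>
     {letter (gKi i) * letter (gK i) - 1 | i. True} \<union>
     {letter (gK i) * letter (gK j) - letter (gK j) * letter (gK i) | i j. True} \<union>
     {letter (gK i) * letter (gE j) - const (q chi i j) * letter (gE j) * letter (gK i) | i j. True} \<union>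
     {letter (gK i) * letter (gF j) - const (inverse (q chi i j)) * letter (gF j) * letter (gK i)
        | i j. True} \<union>
     {letter (gE i) * letter (gF j) - letter (gF j) * letter (gE i)
        - (if i = j then letter (gK i) - letter (gKi i) else 0) | i j. True}"

definition plus_embed :: "('n, 'k::field) free_alg \<Rightarrow> ('n gen, 'k) free_alg" where
  "plus_embed = nc_eval ring_of_type_algebra const (\<lambda>i. letter (gE i))"

fun omega_gen :: "'n gen \<Rightarrow> 'n gen" where
  "omega_gen (gE i) = gF i"
| "omega_gen (gF i) = gE i"
| "omega_gen (gK i) = gKi i"
| "omega_gen (gKi i) = gK i"

definition omega :: "('n gen, 'k::field) free_alg \<Rightarrow> ('n gen, 'k) free_alg" where
  "omega = nc_eval ring_of_type_algebra const (\<lambda>g. letter (omega_gen g))"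

definition U_ideal ::
  "('n::finite lat \<Rightarrow> 'n lat \<Rightarrow> 'k::field) \<Rightarrow> ('n, 'k) free_alg set
     \<Rightarrow> ('n gen, 'k) free_alg set" where
  "U_ideal chi J = genideal ring_of_type_algebra
     (relations chi \<union> plus_embed ` J \<union> omega ` plus_embed ` J)"

definition U ::
  "('n::finite lat \<Rightarrow> 'n lat \<Rightarrow> 'k::field) \<Rightarrow> ('n, 'k) free_alg set
     \<Rightarrow> ('n gen, 'k) free_alg set ring" where
  "U chi J = ring_of_type_algebra Quot U_ideal chi J"

definition U_class ::
  "('n::finite lat \<Rightarrow> 'n lat \<Rightarrow> 'k::field) \<Rightarrow> ('n, 'k) free_alg set
     \<Rightarrow> ('n gen, 'k) free_alg \<Rightarrow> ('n gen, 'k) free_alg set" where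
  "U_class chi J x = U_ideal chi J +>\<^bsub>ring_of_type_algebra\<^esub> x"

definition U_scalar where "U_scalar chi J c = U_class chi J (const c)"
definition U_E where "U_E chi J i = U_class chi J (letter (gE i))"
definition U_F where "U_F chi J i = U_class chi J (letter (gF i))"

text \<open>\<open>K\<^sub>\<lambda> = K\<^sub>1\<^bsup>\<lambda>\<^sub>1\<^esup> \<cdots> K\<^sub>n\<^bsup>\<lambda>\<^sub>n\<^esup>\<close>, the factors being taken in the order of the index set.\<close>

definition U_K ::
  "('n::{finite,linorder} lat \<Rightarrow> 'n lat \<Rightarrow> 'k::field) \<Rightarrow> ('n, 'k) free_alg set
     \<Rightarrow> 'n lat \<Rightarrow> ('n gen, 'k) free_alg set" where
  "U_K chi J lam = U_class chi J
     (prod_list (map (\<lambda>i. if 0 \<le> lam $ i then letter (gK i) ^ nat (lam $ i)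
                          else letter (gKi i) ^ nat (- (lam $ i)))
                     (sorted_list_of_set UNIV)))"

text \<open>The group algebra \<open>H\<close> of \<open>\<int>\<^sup>n\<close> is \<open>'n lat \<Rightarrow>\<^sub>0 'k\<close>; this is its
  canonical map to \<open>U(\<chi>)\<close>.\<close>

definition U_torus ::
  "('n::{finite,linorder} lat \<Rightarrow> 'n lat \<Rightarrow> 'k::field) \<Rightarrow> ('n, 'k) free_alg set
     \<Rightarrow> ('n lat \<Rightarrow>\<^sub>0 'k) \<Rightarrow> ('n gen, 'k) free_alg set" where
  "U_torus chi J h = (\<Oplus>\<^bsub>U chi J\<^esub>mu\<in>Poly_Mapping.keys h.
     U_scalar chi J (Poly_Mapping.lookup h mu) \<otimes>\<^bsub>U chi J\<^esub> U_K chi J mu)"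

definition U_plus where
  "U_plus chi J = subalg (U chi J) (U_scalar chi J) (range (U_E chi J))"

definition G_minus where
  "G_minus chi J = subalg (U chi J) (U_scalar chi J)
     {U_F chi J i \<otimes>\<^bsub>U chi J\<^esub> U_K chi J (alpha i) | i. True}"

text \<open>The graded pieces \<open>U\<^sup>+\<^sub>a\<close> and \<open>U\<^sup>-\<^sub>-\<^sub>a\<close>.\<close>

definition U_plus_part where
  "U_plus_part chi J a = lin_span (U chi J) (U_scalar chi J)
     {word_prod (U chi J) (U_E chi J) w | w. weight w = a}"

definition U_minus_part where
  "U_minus_part chi J a = lin_span (U chi J) (U_scalar chi J)
     {word_prod (U chi J) (U_F chi J) w | w. weight w = a}"

definition P ::
  "('n::{finite,linorder} lat \<Rightarrow> 'n lat \<Rightarrow> 'k::field) \<Rightarrow> ('n, 'k) free_alg set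
     \<Rightarrow> 'n lat \<Rightarrow> ('n gen, 'k) free_alg set \<Rightarrow> ('n gen, 'k) free_alg set" where
  "P chi J lam = summand_proj (U chi J) UNIV
     (\<lambda>mu. lin_span (U chi J) (U_scalar chi J)
        {x \<otimes>\<^bsub>U chi J\<^esub> U_K chi J mu \<otimes>\<^bsub>U chi J\<^esub> y | x y. x \<in> U_plus chi J \<and> y \<in> G_minus chi J})
     lam"

text \<open>The summand for \<open>(0, 0)\<close> is the image of \<open>H\<close> in \<open>U(\<chi>)\<close>, so that the projection onto
  it is read as a map to \<open>H\<close>.\<close>

definition pi00 ::
  "('n::{finite,linorder} lat \<Rightarrow> 'n lat \<Rightarrow> 'k::field) \<Rightarrow> ('n, 'k) free_alg set
     \<Rightarrow> ('n gen, 'k) free_alg set \<Rightarrow> ('n lat \<Rightarrow>\<^sub>0 'k)" where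
  "pi00 chi J u = (THE h. U_torus chi J h =
     summand_proj (U chi J) (nonneg \<times> nonneg)
       (\<lambda>(a, b). lin_span (U chi J) (U_scalar chi J)
          {x \<otimes>\<^bsub>U chi J\<^esub> U_torus chi J h' \<otimes>\<^bsub>U chi J\<^esub> y | x h' y.
             x \<in> U_plus_part chi J a \<and> y \<in> U_minus_part chi J b})
       (0, 0) u)"

definition B where
  "B chi J tau c i = U_F chi J i \<oplus>\<^bsub>U chi J\<^esub>
     U_scalar chi J (c i) \<otimes>\<^bsub>U chi J\<^esub> U_E chi J (tau i) \<otimes>\<^bsub>U chi J\<^esub> U_K chi J (- alpha i)"

section \<open>The negative Heisenberg double\<close>

text \<open>Generators \<open>F\<^sub>i\<close>, \<open>E\<^sub>i K\<^sub>i\<^sup>-\<^sup>1\<close>, \<open>K\<^sub>i\<^sup>-\<^sup>1\<close>, \<open>K\<^sub>i K\<^sub>\<tau>\<^sub>(\<^sub>i\<^sub>)\<^sup>-\<^sup>1\<close>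
  of \<open>U(\<chi>)\<^sup>p\<^sup>o\<^sup>l\<^sup>y\<close> and their degrees.\<close>

datatype 'n poly_gen = pF 'n | pE 'n | pKi 'n | pKK 'n

fun poly_gen_value where
  "poly_gen_value chi J tau (pF i) = U_F chi J i"
| "poly_gen_value chi J tau (pE i) = U_E chi J i \<otimes>\<^bsub>U chi J\<^esub> U_K chi J (- alpha i)"
| "poly_gen_value chi J tau (pKi i) = U_K chi J (- alpha i)"
| "poly_gen_value chi J tau (pKK i) = U_K chi J (alpha i - alpha (tau i))"

fun poly_gen_degree :: "'n poly_gen \<Rightarrow> nat" where
  "poly_gen_degree (pF i) = 1"
| "poly_gen_degree (pE i) = 1"
| "poly_gen_degree (pKi i) = 1"
| "poly_gen_degree (pKK i) = 0"

text \<open>The filtration; its union is \<open>U(\<chi>)\<^sup>p\<^sup>o\<^sup>l\<^sup>y\<close>.\<close>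

definition poly_fil ::
  "('n::{finite,linorder} lat \<Rightarrow> 'n lat \<Rightarrow> 'k::field) \<Rightarrow> ('n, 'k) free_alg set
     \<Rightarrow> ('n \<Rightarrow> 'n) \<Rightarrow> nat \<Rightarrow> ('n gen, 'k) free_alg set set" where
  "poly_fil chi J tau m = lin_span (U chi J) (U_scalar chi J)
     {word_prod (U chi J) (poly_gen_value chi J tau) w | w.
        sum_list (map poly_gen_degree w) \<le> m}"

definition Heis ::
  "('n::{finite,linorder} lat \<Rightarrow> 'n lat \<Rightarrow> 'k::field) \<Rightarrow> ('n, 'k) free_alg set
     \<Rightarrow> ('n \<Rightarrow> 'n) \<Rightarrow> (nat \<Rightarrow> ('n gen, 'k) free_alg set set) ring" where
  "Heis chi J tau = assoc_graded (U chi J) (poly_fil chi J tau)"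

definition H_class where
  "H_class chi J tau d u = gr_class (U chi J) (poly_fil chi J tau) d u"

definition H_scalar where
  "H_scalar chi J tau c = H_class chi J tau 0 (U_scalar chi J c)"

definition H_F where
  "H_F chi J tau i = H_class chi J tau 1 (poly_gen_value chi J tau (pF i))"

definition H_E where
  "H_E chi J tau i = H_class chi J tau 1 (poly_gen_value chi J tau (pE i))"

text \<open>For \<open>\<lambda> = - \<beta> + \<zeta>\<close> with \<open>\<beta> \<in> \<nat>\<^sup>n\<close> and \<open>\<tau>(\<zeta>) = - \<zeta>\<close> the entries of \<open>\<zeta>\<close> sum to zero,
  so that \<open>K\<^sub>\<lambda>\<close> has degree \<open>\<Sum>\<^sub>i \<beta>\<^sub>i = - \<Sum>\<^sub>i \<lambda>\<^sub>i\<close> in the filtration.\<close>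

definition H_K where
  "H_K chi J tau lam = H_class chi J tau (nat (- (\<Sum>i\<in>UNIV. lam $ i))) (U_K chi J lam)"

definition H_torus ::
  "('n::{finite,linorder} lat \<Rightarrow> 'n lat \<Rightarrow> 'k::field) \<Rightarrow> ('n, 'k) free_alg set
     \<Rightarrow> ('n \<Rightarrow> 'n) \<Rightarrow> ('n lat \<Rightarrow>\<^sub>0 'k) \<Rightarrow> nat \<Rightarrow> ('n gen, 'k) free_alg set set" where
  "H_torus chi J tau h = (\<Oplus>\<^bsub>Heis chi J tau\<^esub>mu\<in>Poly_Mapping.keys h.
     H_scalar chi J tau (Poly_Mapping.lookup h mu) \<otimes>\<^bsub>Heis chi J tau\<^esub> H_K chi J tau mu)"

text \<open>The augmentation kills the generators, so the augmentation ideals are spanned by the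
  nonempty words.\<close>

definition G_plus_aug where
  "G_plus_aug chi J tau = lin_span (Heis chi J tau) (H_scalar chi J tau)
     {word_prod (Heis chi J tau) (H_E chi J tau) w | w. w \<noteq> []}"

definition U_minus_aug where
  "U_minus_aug chi J tau = lin_span (Heis chi J tau) (H_scalar chi J tau)
     {word_prod (Heis chi J tau) (H_F chi J tau) w | w. w \<noteq> []}"

definition Heis_kernel where
  "Heis_kernel chi J tau =
     lin_span (Heis chi J tau) (H_scalar chi J tau)
       {g \<otimes>\<^bsub>Heis chi J tau\<^esub> x | g x. g \<in> G_plus_aug chi J tau \<and> x \<in> carrier (Heis chi J tau)}
     <+>\<^bsub>Heis chi J tau\<^esub>
     lin_span (Heis chi J tau) (H_scalar chi J tau)
       {x \<otimes>\<^bsub>Heis chi J tau\<^esub> y | x y. x \<in> carrier (Heis chi J tau) \<and> y \<in> U_minus_aug chi J tau}"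

text \<open>Elements of \<open>k[K\<^sub>\<lambda> | \<lambda> \<in> - \<nat>\<^sup>n + \<int>\<^sup>n\<^sub>\<theta>]\<close> are the elements of \<open>H\<close> supported on
  \<^const>\<open>lattice_poly\<close>; this identifies the \<open>K\<^sub>\<mu>\<close> of \<open>U(\<chi>)\<close> with the \<open>K\<^sub>\<mu>\<close> of the Heisenberg
  double.\<close>

definition pi00_vee ::
  "('n::{finite,linorder} lat \<Rightarrow> 'n lat \<Rightarrow> 'k::field) \<Rightarrow> ('n, 'k) free_alg set
     \<Rightarrow> ('n \<Rightarrow> 'n) \<Rightarrow> (nat \<Rightarrow> ('n gen, 'k) free_alg set set) \<Rightarrow> ('n lat \<Rightarrow>\<^sub>0 'k)" where
  "pi00_vee chi J tau x = (THE h. Poly_Mapping.keys h \<subseteq> lattice_poly tau \<and>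
     x \<ominus>\<^bsub>Heis chi J tau\<^esub> H_torus chi J tau h \<in> Heis_kernel chi J tau)"

definition B_vee where
  "B_vee chi J tau c i = H_F chi J tau i \<oplus>\<^bsub>Heis chi J tau\<^esub>
     H_scalar chi J tau (c i) \<otimes>\<^bsub>Heis chi J tau\<^esub>
       (H_E chi J tau (tau i) \<otimes>\<^bsub>Heis chi J tau\<^esub> H_K chi J tau (alpha (tau i) - alpha i))"

end

theory Submission
  imports Defs
begin

text \<open>Let \<open>U(\<chi>)\<close> act by left multiplication on the vector space with basis the symbols
  \<open>(u, \<mu>, v)\<close>, read as \<open>E\<^sub>u K\<^sub>\<mu> F\<^sub>v\<close>, modulo the subspace spanned by the symbols with an element of
  the biideal in the first or third place. That subspace is stable because the coproduct condition
  makes the biideal stable under the two families of skew derivations that describe the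
  commutators of \<open>F\<^sub>i\<close> with words in the \<open>E\<^sub>j\<close>, and it is graded because the biideal is. Applying
  an element to \<open>([], 0, [])\<close> therefore computes all components with respect to the triangular
  decomposition. The summand \<open>U\<^sup>+ K\<^sub>\<lambda> G\<^sup>-\<close> is spanned by the \<open>E\<^sub>u K\<^sub>\<mu> F\<^sub>v\<close> with label \<open>\<mu> - wt v = \<lambda>\<close>,
  so the left-hand side is the coefficient of \<open>K\<^sub>-\<^sub>\<lambda>\<close> in \<open>p(B)\<close>.

  The filtration degree of \<open>E\<^sub>u K\<^sub>\<mu> F\<^sub>v\<close> is minus the coordinate sum of its label. Hence the
  torus coefficients of top degree are well defined on the associated graded algebra, they vanish on
  the kernel of the projection of the Heisenberg double, and they determine that projection. All labels
  of terms of \<open>p(B)\<close> lie in \<open>- \<lambda> + 2 \<nat>\<^sup>n\<close>, so the only torus term of top degree is again the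
  multiple of \<open>K\<^sub>-\<^sub>\<lambda>\<close>.\<close>

section \<open>Linear algebra of finitely supported functions\<close>

text \<open>Both projections are definite descriptions, so a value is known only after existence and
  uniqueness of the decomposition behind it are established; and since \<open>J\<close> is
  arbitrary, \<open>U\<close> comes without an explicit basis. Complements of relations are
  therefore never chosen. Calculations take place in the free algebra and in the free space on the
  symbols, with \<open>II\<close> and \<open>NN\<close> carried along as subspaces;
  \<open>nf\<close> and \<open>Psi\<close> are inverse to each other modulo these, which replaces
  the triangular decomposition. Because \<open>NN\<close> is graded, labels can be read off modulo
  it; because it has no component on the symbols \<open>([], m, [])\<close>, so can torus
  coefficients. The degree condition on \<open>J\<close> enters twice: constant terms vanish, and
  coefficients of single letters vanish, which is why the components of the coproduct with one
  factor of degree one map \<open>J\<close> to itself. On the graded side, uniqueness comes from the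
  torus coefficients, and existence from reordering words in the generators without raising their
  degree. The latter rests on the contraction of \<open>F_i\<close> with \<open>E_i K_i^-1\<close>,
  namely \<open>1 - K_i^-2\<close>, having no terms of degree above 2.\<close>

definition pscale :: "'k::field \<Rightarrow> ('a \<Rightarrow>\<^sub>0 'k) \<Rightarrow> ('a \<Rightarrow>\<^sub>0 'k)" where
  "pscale c p = Poly_Mapping.map ((*) c) p"

lemma lookup_pscale [simp]: "Poly_Mapping.lookup (pscale c p) a = c * Poly_Mapping.lookup p a"
  by (simp add: pscale_def Poly_Mapping.map.rep_eq when_def)

global_interpretation pm: vector_space "pscale :: 'k::field \<Rightarrow> ('a \<Rightarrow>\<^sub>0 'k) \<Rightarrow> _"
  by unfold_locales (auto intro!: poly_mapping_eqI simp: lookup_add algebra_simps)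

global_interpretation pm2: vector_space_pair
  "pscale :: 'k::field \<Rightarrow> ('a \<Rightarrow>\<^sub>0 'k) \<Rightarrow> _" "pscale :: 'k::field \<Rightarrow> ('b \<Rightarrow>\<^sub>0 'k) \<Rightarrow> _" ..

abbreviation plinear :: "(('a \<Rightarrow>\<^sub>0 'k::field) \<Rightarrow> ('b \<Rightarrow>\<^sub>0 'k)) \<Rightarrow> bool" where
  "plinear \<equiv> Vector_Spaces.linear pscale pscale"

lemma plinearI:
  assumes "\<And>x y. f (x + y) = f x + f y" "\<And>c x. f (pscale c x) = pscale c (f x)"
  shows "plinear f"
  using assms by unfold_locales (auto simp: pm.vector_space_axioms)

lemmas plinear_add = pm2.linear_add
  and plinear_scale = pm2.linear_scale
  and plinear_0 = pm2.linear_0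
  and plinear_neg = pm2.linear_neg
  and plinear_diff = pm2.linear_diff
  and plinear_sum = pm2.linear_sum

lemma pscale_single [simp]: "pscale c (Poly_Mapping.single a d) = Poly_Mapping.single a (c * d)"
  by (rule poly_mapping_eqI) (simp add: lookup_single when_def)

definition plin :: "('a \<Rightarrow> ('b \<Rightarrow>\<^sub>0 'k::field)) \<Rightarrow> ('a \<Rightarrow>\<^sub>0 'k) \<Rightarrow> ('b \<Rightarrow>\<^sub>0 'k)" where
  "plin f p = (\<Sum>a\<in>Poly_Mapping.keys p. pscale (Poly_Mapping.lookup p a) (f a))"

lemma plin_superset:
  assumes "finite S" "Poly_Mapping.keys p \<subseteq> S"
  shows "plin f p = (\<Sum>a\<in>S. pscale (Poly_Mapping.lookup p a) (f a))"
  unfolding plin_def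
  by (rule sum.mono_neutral_left) (use assms in \<open>auto simp: in_keys_iff\<close>)

lemma plinear_plin [simp, intro]:
  fixes f :: "'a \<Rightarrow> ('b \<Rightarrow>\<^sub>0 'k::field)"
  shows "plinear (plin f)"
proof (rule plinearI)
  fix x y :: "'a \<Rightarrow>\<^sub>0 'k" and c
  let ?S = "Poly_Mapping.keys x \<union> Poly_Mapping.keys y"
  have "Poly_Mapping.keys (x + y) \<subseteq> ?S" by (rule Poly_Mapping.keys_add)
  then show "plin f (x + y) = plin f x + plin f y"
    by (simp add: plin_superset[of ?S] lookup_add pm.scale_left_distrib sum.distrib)
  have "Poly_Mapping.keys (pscale c x) \<subseteq> Poly_Mapping.keys x" by (auto simp: in_keys_iff)
  then show "plin f (pscale c x) = pscale c (plin f x)"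
    by (simp add: plin_superset[of "Poly_Mapping.keys x"] pm.scale_sum_right)
qed

lemmas plin_add = plinear_add[OF plinear_plin]

lemma plin_0 [simp]: "plin f 0 = 0"
  by (simp add: plin_def)

lemma plin_single [simp]: "plin f (Poly_Mapping.single a c) = pscale c (f a)"
  by (cases "c = 0") (simp_all add: plin_def)

lemma plin_id: "plin (\<lambda>a. Poly_Mapping.single a 1) p = p"
proof (rule poly_mapping_eqI)
  fix a
  have "Poly_Mapping.lookup (plin (\<lambda>a. Poly_Mapping.single a 1) p) a
      = (\<Sum>b\<in>Poly_Mapping.keys p. if b = a then Poly_Mapping.lookup p b else 0)"
    unfolding plin_def lookup_sum
    by (rule sum.cong) (auto simp: lookup_single when_def)
  then show "Poly_Mapping.lookup (plin (\<lambda>a. Poly_Mapping.single a 1) p) a = Poly_Mapping.lookup p a"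
    by (simp add: sum.delta in_keys_iff)
qed

lemma plinear_eq_plin:
  assumes "plinear f"
  shows "f p = plin (\<lambda>a. f (Poly_Mapping.single a 1)) p"
proof -
  have "f p = f (plin (\<lambda>a. Poly_Mapping.single a 1) p)" by (simp add: plin_id)
  also have "\<dots> = plin (\<lambda>a. f (Poly_Mapping.single a 1)) p"
    unfolding plin_def by (simp only: plinear_sum[OF assms] plinear_scale[OF assms])
  finally show ?thesis .
qed

text \<open>The standard reduction below: an identity between linear maps is checked on basis
  vectors, and inductions then run over single words instead of polynomials.\<close>

lemma plinear_ext:
  assumes "plinear f" "plinear g"
    and "\<And>a. f (Poly_Mapping.single a 1) = g (Poly_Mapping.single a 1)"
  shows "f p = g p"
  using assms(3) plinear_eq_plin[OF assms(1), of p] plinear_eq_plin[OF assms(2), of p] by simp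

lemma plinear_id: "plinear (\<lambda>x. x)"
  and plinear_zero: "plinear (\<lambda>x. 0)"
  and plinear_scaleI: "plinear f \<Longrightarrow> plinear (\<lambda>x. pscale c (f x))"
  and plinear_addI: "plinear f \<Longrightarrow> plinear g \<Longrightarrow> plinear (\<lambda>x. f x + g x)"
  and plinear_diffI: "plinear f \<Longrightarrow> plinear g \<Longrightarrow> plinear (\<lambda>x. f x - g x)"
  and plinear_comp: "plinear h \<Longrightarrow> plinear f' \<Longrightarrow> plinear (\<lambda>x. h (f' x))"
  by (auto intro!: plinearI simp: plinear_add plinear_scale algebra_simps pm.scale_right_distrib
      pm.scale_right_diff_distrib mult.commute)

lemma plinear_plin_comp: "plinear f \<Longrightarrow> f (plin g p) = plin (\<lambda>a. f (g a)) p"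
  unfolding plin_def by (simp only: plinear_sum plinear_scale)

lemma plin_pscale_fun: "plin (\<lambda>a. pscale c (f a)) p = pscale c (plin f p)"
  by (simp add: plin_def pm.scale_sum_right mult.commute)

lemma plin_delta: "plin (\<lambda>a. if a = x then z else 0) p = pscale (Poly_Mapping.lookup p x) z"
proof -
  have "plin (\<lambda>a. if a = x then z else 0) p
      = (\<Sum>a\<in>Poly_Mapping.keys p. if a = x then pscale (Poly_Mapping.lookup p x) z else 0)"
    unfolding plin_def by (rule sum.cong) auto
  then show ?thesis by (simp add: sum.delta in_keys_iff)
qed

lemma plin_single_fun: "plin (\<lambda>a. Poly_Mapping.single a c) p = pscale c p"
  using plin_pscale_fun[of c "\<lambda>a. Poly_Mapping.single a 1" p] by (simp add: plin_id)

lemma plinear_ifI: "plinear f \<Longrightarrow> plinear (\<lambda>x. if c then f x else 0)"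
  by (cases c) (simp_all add: plinear_zero)

lemma plin_if: "plin (\<lambda>v. if c then f v else 0) p = (if c then plin f p else 0)"
  by (simp add: plin_def)

lemma plin_in_subspace:
  assumes "pm.subspace S" "\<And>a. a \<in> Poly_Mapping.keys p \<Longrightarrow> f a \<in> S"
  shows "plin f p \<in> S"
  unfolding plin_def by (intro pm.subspace_sum[OF assms(1)] pm.subspace_scale[OF assms(1)] assms(2))

lemma plinear_in_subspace:
  assumes "plinear f" "pm.subspace S" "\<And>a. f (Poly_Mapping.single a 1) \<in> S"
  shows "f p \<in> S"
  by (subst plinear_eq_plin[OF assms(1)]) (rule plin_in_subspace[OF assms(2,3)])

lemma plin_in_span:
  assumes "\<And>a. a \<in> Poly_Mapping.keys p \<Longrightarrow> f a \<in> pm.span S"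
  shows "plin f p \<in> pm.span S"
  unfolding plin_def by (intro pm.span_sum pm.span_scale assms)

lemma plinear_image_span:
  assumes "plinear f" "x \<in> pm.span S" "\<And>s. s \<in> S \<Longrightarrow> f s \<in> pm.span T"
  shows "f x \<in> pm.span T"
  using assms(2)
proof (induction rule: pm.span_induct_alt)
  case base
  then show ?case by (simp add: plinear_0[OF assms(1)] pm.span_zero)
next
  case (step c x y)
  then show ?case
    by (simp add: plinear_add[OF assms(1)] plinear_scale[OF assms(1)] pm.span_add pm.span_scale assms(3))
qed

definition restr :: "('a \<Rightarrow> bool) \<Rightarrow> ('a \<Rightarrow>\<^sub>0 'k::field) \<Rightarrow> ('a \<Rightarrow>\<^sub>0 'k)" where
  "restr S = plin (\<lambda>a. if S a then Poly_Mapping.single a 1 else 0)"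

lemma plinear_restr [simp, intro]: "plinear (restr S)"
  by (simp add: restr_def)

lemma restr_single [simp]:
  "restr S (Poly_Mapping.single a c) = (if S a then Poly_Mapping.single a c else 0)"
  by (simp add: restr_def)

lemma lookup_restr [simp]:
  "Poly_Mapping.lookup (restr S p) a = (if S a then Poly_Mapping.lookup p a else 0)"
proof -
  have "Poly_Mapping.lookup (restr S p) a
      = (\<Sum>b\<in>Poly_Mapping.keys p. if b = a then (if S a then Poly_Mapping.lookup p a else 0) else 0)"
    unfolding restr_def plin_def lookup_sum
    by (rule sum.cong) (auto simp: lookup_single when_def)
  then show ?thesis
    by (auto simp: sum.delta in_keys_iff)
qed

lemma keys_restr: "Poly_Mapping.keys (restr S p) = {a \<in> Poly_Mapping.keys p. S a}"
  by (auto simp: in_keys_iff split: if_splits)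

lemma restr_id:
  assumes "\<And>a. a \<in> Poly_Mapping.keys p \<Longrightarrow> S a"
  shows "restr S p = p"
  by (rule poly_mapping_eqI) (use assms in \<open>auto simp: in_keys_iff\<close>)

lemma restr_eq_0:
  assumes "\<And>a. a \<in> Poly_Mapping.keys p \<Longrightarrow> \<not> S a"
  shows "restr S p = 0"
  by (rule poly_mapping_eqI) (use assms in \<open>auto simp: in_keys_iff\<close>)

lemma subspace_supported: "pm.subspace {p :: 'a \<Rightarrow>\<^sub>0 'k::field. \<forall>a\<in>Poly_Mapping.keys p. S a}"
proof (rule pm.subspaceI)
  fix x y :: "'a \<Rightarrow>\<^sub>0 'k" and c :: 'k
  assume "x \<in> {p. \<forall>a\<in>Poly_Mapping.keys p. S a}" "y \<in> {p. \<forall>a\<in>Poly_Mapping.keys p. S a}"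
  then show "x + y \<in> {p. \<forall>a\<in>Poly_Mapping.keys p. S a}"
    using Poly_Mapping.keys_add[of x y] by auto
next
  fix x :: "'a \<Rightarrow>\<^sub>0 'k" and c :: 'k
  assume "x \<in> {p. \<forall>a\<in>Poly_Mapping.keys p. S a}"
  then show "pscale c x \<in> {p. \<forall>a\<in>Poly_Mapping.keys p. S a}"
    by (auto simp: in_keys_iff)
qed auto

section \<open>Free algebras\<close>

lemma one_free_alg: "(1 :: ('g, 'k::field) free_alg) = Poly_Mapping.single [] 1"
  by (metis single_one zero_list_def)

lemma mult_single_word [simp]:
  "Poly_Mapping.single (u :: 'g list) (c::'k::field) * Poly_Mapping.single v d = Poly_Mapping.single (u @ v) (c * d)"
  by (simp add: mult_single plus_list_def)

lemma const_mult: "const c * x = pscale c x"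
  using mult_map_scale_conv_mult[of c x] by (simp add: const_def pscale_def zero_list_def)

lemma pscale_eq_const: "pscale c 1 = const c"
  by (simp add: one_free_alg const_def)

lemma pscale_mult_left: "pscale c (x :: ('g, 'k::field) free_alg) * y = pscale c (x * y)"
  by (simp add: const_mult[symmetric] mult.assoc)

lemma plinear_mult_left: "plinear (\<lambda>x :: ('g, 'k::field) free_alg. x * y)"
  by (rule plinearI) (simp_all add: algebra_simps pscale_mult_left)

lemma mult_const: "(x :: ('g, 'k::field) free_alg) * const c = pscale c x"
proof -
  have "plinear (\<lambda>x. pscale c x :: ('g, 'k) free_alg)"
    by (intro plinear_scaleI plinear_id)
  then show ?thesis
    by (rule plinear_ext[OF plinear_mult_left, of "\<lambda>x. pscale c x"]) (simp add: const_def)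
qed

lemma pscale_mult_right: "x * pscale c (y :: ('g, 'k::field) free_alg) = pscale c (x * y)"
  by (metis const_mult mult.assoc mult_const)

lemma plinear_mult_right: "plinear (\<lambda>x :: ('g, 'k::field) free_alg. y * x)"
  by (rule plinearI) (simp_all add: algebra_simps pscale_mult_right)

definition alg_eval :: "('g \<Rightarrow> ('h, 'k::field) free_alg) \<Rightarrow> ('g, 'k) free_alg \<Rightarrow> ('h, 'k) free_alg" where
  "alg_eval f = plin (\<lambda>w. prod_list (map f w))"

lemma plinear_eval [simp, intro]: "plinear (alg_eval f)"
  by (simp add: alg_eval_def)

lemma alg_eval_mult: "alg_eval f (x * y) = alg_eval f x * alg_eval f y"
proof -
  have "plinear (\<lambda>x. alg_eval f (x * y))" for y
    by (rule plinear_comp[OF plinear_eval plinear_mult_left])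
  moreover have "plinear (\<lambda>x. alg_eval f x * alg_eval f y)" for y
    by (rule plinear_comp[OF plinear_mult_left plinear_eval])
  moreover have "alg_eval f (Poly_Mapping.single u 1 * y) = alg_eval f (Poly_Mapping.single u 1) * alg_eval f y" for u
  proof (rule plinear_ext[where p = y])
    show "plinear (\<lambda>y. alg_eval f (Poly_Mapping.single u 1 * y))"
      by (rule plinear_comp[OF plinear_eval plinear_mult_right])
    show "plinear (\<lambda>y. alg_eval f (Poly_Mapping.single u 1) * alg_eval f y)"
      by (rule plinear_comp[OF plinear_mult_right plinear_eval])
  qed (simp add: alg_eval_def)
  ultimately show ?thesis by (rule plinear_ext[where p = x])
qed

lemma alg_eval_letter [simp]: "alg_eval f (letter g) = f g"
  by (simp add: alg_eval_def letter_def)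

lemma alg_eval_word: "alg_eval f (Poly_Mapping.single w 1) = prod_list (map f w)"
  by (simp add: alg_eval_def)

lemma prod_list_letter: "prod_list (map letter w) = Poly_Mapping.single w 1"
  by (induction w) (simp_all add: one_free_alg letter_def)

lemma prod_list_map_letter: "prod_list (map (\<lambda>i. letter (f i)) w) = Poly_Mapping.single (map f w) 1"
  using prod_list_letter[of "map f w"] by (simp add: o_def)

text \<open>\<open>foldr\<close> lets the last letter of a word operate first, so operators indexed
  by letters turn the space into a left module over the free algebra.\<close>

definition act :: "('g \<Rightarrow> ('b \<Rightarrow>\<^sub>0 'k) \<Rightarrow> ('b \<Rightarrow>\<^sub>0 'k)) \<Rightarrow> ('g, 'k::field) free_alg \<Rightarrow> ('b \<Rightarrow>\<^sub>0 'k) \<Rightarrow> ('b \<Rightarrow>\<^sub>0 'k)" where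
  "act f x m = plin (\<lambda>w. foldr f w m) x"

lemma act_letter [simp]: "act f (letter g) m = f g m"
  by (simp add: act_def letter_def)

lemma act_one [simp]: "act f 1 m = m"
  by (simp add: act_def one_free_alg)

lemma act_const: "act f (const c) m = pscale c m"
  by (simp add: act_def const_def)

lemma plinear_act_left: "plinear (\<lambda>x. act f x m)"
  by (simp add: act_def)

lemma plinear_act_right:
  assumes "\<And>g. plinear (f g)"
  shows "plinear (act f x)"
proof -
  have lin: "plinear (foldr f w)" for w
    by (induction w) (auto simp: id_def intro: plinear_id plinear_comp[OF assms])
  show ?thesis
    unfolding act_def plin_def
    by (rule plinearI) (simp_all add: plinear_add[OF lin] plinear_scale[OF lin] pm.scale_right_distrib
        sum.distrib pm.scale_sum_right mult.commute)
qed

lemma act_mult: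
  assumes "\<And>g. plinear (f g)"
  shows "act f (x * y) m = act f x (act f y m)"
proof -
  have "plinear (\<lambda>x. act f (x * y) m)" for y
    by (rule plinear_comp[OF plinear_act_left plinear_mult_left])
  moreover have "plinear (\<lambda>x. act f x (act f y m))" for y
    by (rule plinear_act_left)
  moreover have "act f (Poly_Mapping.single u 1 * y) m = act f (Poly_Mapping.single u 1) (act f y m)" for u
  proof (rule plinear_ext[where p = y])
    show "plinear (\<lambda>y. act f (Poly_Mapping.single u 1 * y) m)"
      by (rule plinear_comp[OF plinear_act_left plinear_mult_right])
    show "plinear (\<lambda>y. act f (Poly_Mapping.single u 1) (act f y m))"
      by (rule plinear_comp[OF plinear_act_right plinear_act_left]) (rule assms)
  qed (simp add: act_def)
  ultimately show ?thesis by (rule plinear_ext[where p = x])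
qed

section \<open>Translation between type-class rings and ring records\<close>

lemma carrier_type_ring [simp]: "carrier ring_of_type_algebra = UNIV"
  and mult_type_ring [simp]: "x \<otimes>\<^bsub>ring_of_type_algebra\<^esub> y = x * y"
  and add_type_ring [simp]: "x \<oplus>\<^bsub>ring_of_type_algebra\<^esub> y = x + y"
  and one_type_ring [simp]: "\<one>\<^bsub>ring_of_type_algebra\<^esub> = 1"
  and zero_type_ring [simp]: "\<zero>\<^bsub>ring_of_type_algebra\<^esub> = 0"
  by (simp_all add: ring_of_type_algebra_def)

lemma finsum_eq_sum:
  fixes R :: "('a::ab_group_add, 'm) ring_scheme"
  assumes "carrier R = UNIV" "\<And>x y. x \<oplus>\<^bsub>R\<^esub> y = x + y" "\<zero>\<^bsub>R\<^esub> = 0" "finite S"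
  shows "finsum R f S = sum f S"
proof -
  interpret abelian_monoid R
    by (rule abelian_monoidI) (auto simp: assms ac_simps)
  from \<open>finite S\<close> show ?thesis
    by induction (simp_all add: assms)
qed

lemma word_prod_type_ring: "word_prod ring_of_type_algebra x w = prod_list (map x w)"
  by (induction w) (simp_all add: word_prod_def)

lemma nc_eval_type_ring: "nc_eval ring_of_type_algebra const f p = alg_eval f p"
  by (simp add: nc_eval_def finsum_eq_sum word_prod_type_ring alg_eval_def plin_def const_mult)

lemma ring_type_ring: "ring (ring_of_type_algebra :: 'a::ring_1 ring)"
proof (rule ringI)
  show "abelian_group (ring_of_type_algebra :: 'a ring)"
    by (rule abelian_groupI) (auto simp: ac_simps intro: exI[of _ "- x" for x] add.left_inverse)
  show "monoid (ring_of_type_algebra :: 'a ring)"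
    by (rule monoidI) (auto simp: ac_simps)
qed (auto simp: algebra_simps)

lemma a_inv_type_ring [simp]: "\<ominus>\<^bsub>ring_of_type_algebra\<^esub> y = - (y::'a::ring_1)"
proof -
  interpret ring "ring_of_type_algebra :: 'a ring" by (rule ring_type_ring)
  show ?thesis
    using r_neg[of y] by (simp add: eq_neg_iff_add_eq_0 add.commute)
qed

section \<open>The quotient algebra\<close>

locale u_algebra =
  fixes chi :: "'n::{finite,linorder} lat \<Rightarrow> 'n lat \<Rightarrow> 'k::field"
    and J :: "('n, 'k) free_alg set"
begin

abbreviation UU where "UU \<equiv> U chi J"
abbreviation II where "II \<equiv> U_ideal chi J"
abbreviation cl where "cl \<equiv> U_class chi J"
abbreviation sc where "sc \<equiv> U_scalar chi J"

lemma ideal_II: "ideal II ring_of_type_algebra"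
  unfolding U_ideal_def by (rule ring.genideal_ideal[OF ring_type_ring]) simp

interpretation II: ideal II "ring_of_type_algebra :: ('n gen, 'k) free_alg ring"
  by (rule ideal_II)

lemma II_lmult: "x \<in> II \<Longrightarrow> y * x \<in> II" and II_rmult: "x \<in> II \<Longrightarrow> x * y \<in> II"
  using II.I_l_closed[of x y] II.I_r_closed[of x y] by auto

lemma II_subgroup: "additive_subgroup II ring_of_type_algebra"
  by (rule ideal.axioms(1)[OF ideal_II])

lemma II_zero: "0 \<in> II" and II_add: "x \<in> II \<Longrightarrow> y \<in> II \<Longrightarrow> x + y \<in> II"
  using additive_subgroup.zero_closed[OF II_subgroup] additive_subgroup.a_closed[OF II_subgroup, of x y] by auto

lemma II_neg: "x \<in> II \<Longrightarrow> - x \<in> II"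
  using additive_subgroup.a_inv_closed[OF II_subgroup, of x] by auto

lemma II_diff: "x \<in> II \<Longrightarrow> y \<in> II \<Longrightarrow> x - y \<in> II"
  using II_add[of x "- y"] II_neg by simp

lemma II_subspace: "pm.subspace II"
  by (rule pm.subspaceI) (auto simp: II_zero II_add const_mult[symmetric] intro: II_lmult)

lemma II_scale: "x \<in> II \<Longrightarrow> pscale c x \<in> II"
  by (rule pm.subspace_scale[OF II_subspace])

lemma II_gen: "x \<in> relations chi \<union> plus_embed ` J \<union> omega ` plus_embed ` J \<Longrightarrow> x \<in> II"
  unfolding U_ideal_def by (rule set_mp[OF ring.genideal_self[OF ring_type_ring]]) simp_all

text \<open>Universal property of the quotient in the form that bounds \<open>II\<close> from above;
  it is applied to the set of elements that act as zero modulo \<open>NN\<close>.\<close>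

lemma II_minimal:
  assumes "pm.subspace S" "\<And>x y. x \<in> S \<Longrightarrow> y * x \<in> S" "\<And>x y. x \<in> S \<Longrightarrow> x * y \<in> S"
    and "relations chi \<union> plus_embed ` J \<union> omega ` plus_embed ` J \<subseteq> S"
  shows "II \<subseteq> S"
  unfolding U_ideal_def
proof (rule ring.genideal_minimal[OF ring_type_ring])
  show "ideal S ring_of_type_algebra"
  proof (rule idealI[OF ring_type_ring])
    have neg: "- x \<in> S" if "x \<in> S" for x
      using pm.subspace_neg[OF assms(1) that] .
    show "subgroup S (add_monoid ring_of_type_algebra)"
    proof (rule subgroup.intro)
      fix x assume "x \<in> S"
      then show "inv\<^bsub>add_monoid ring_of_type_algebra\<^esub> x \<in> S"
        using neg[of x] a_inv_type_ring[of x] by (simp add: a_inv_def)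
    qed (auto intro: pm.subspace_add[OF assms(1)] pm.subspace_0[OF assms(1)])
  qed (auto intro: assms(2,3))
qed (rule assms(4))

lemma cl_eq_set: "cl x = {y. y - x \<in> II}"
proof -
  have "cl x = {h + x | h. h \<in> II}"
    by (auto simp: U_class_def a_r_coset_def')
  moreover have "y \<in> {h + x | h. h \<in> II} \<longleftrightarrow> y - x \<in> II" for y
    by (auto intro: exI[of _ "y - x"])
  ultimately show ?thesis by auto
qed

lemma cl_eq_iff: "cl x = cl y \<longleftrightarrow> x - y \<in> II"
proof
  assume "cl x = cl y"
  moreover have "x \<in> cl x" by (simp add: cl_eq_set II_zero)
  ultimately show "x - y \<in> II" by (simp add: cl_eq_set)
next
  assume a: "x - y \<in> II"
  have "z - x \<in> II \<longleftrightarrow> z - y \<in> II" for z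
    using II_add[OF _ a, of "z - x"] II_diff[OF _ a, of "z - y"] by (auto simp: algebra_simps)
  then show "cl x = cl y" by (simp add: cl_eq_set)
qed

lemma carrier_UU: "carrier UU = range cl"
  by (auto simp: U_def FactRing_def A_RCOSETS_def' U_class_def)

lemma cl_closed [simp]: "cl x \<in> carrier UU"
  by (simp add: carrier_UU)

lemma mult_cl [simp]: "cl x \<otimes>\<^bsub>UU\<^esub> cl y = cl (x * y)"
  using II.rcoset_mult_add[of x y] by (simp add: U_def FactRing_def U_class_def)

lemma add_cl [simp]: "cl x \<oplus>\<^bsub>UU\<^esub> cl y = cl (x + y)"
  using II.a_rcos_sum[of x y] by (simp add: U_def FactRing_def U_class_def)

lemma one_cl: "\<one>\<^bsub>UU\<^esub> = cl 1"
  by (simp add: U_def FactRing_def U_class_def)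

lemma zero_cl: "\<zero>\<^bsub>UU\<^esub> = cl 0"
  by (simp add: cl_eq_set) (simp add: U_def FactRing_def)

lemma ring_UU: "ring UU"
  unfolding U_def by (rule II.quotient_is_ring)

sublocale UR: ring UU
  by (rule ring_UU)

lemma a_inv_cl [simp]: "\<ominus>\<^bsub>UU\<^esub> cl x = cl (- x)"
  by (rule UR.minus_equality) (auto simp: zero_cl)

lemma cl_eq_zero_iff: "cl x = \<zero>\<^bsub>UU\<^esub> \<longleftrightarrow> x \<in> II"
  by (simp add: zero_cl cl_eq_iff)

lemma sc_cl: "sc c = cl (const c)"
  by (simp add: U_scalar_def)

lemma sc_mult [simp]: "sc c \<otimes>\<^bsub>UU\<^esub> cl x = cl (pscale c x)"
  by (simp add: sc_cl const_mult)

lemma finsum_cl: "finite S \<Longrightarrow> finsum UU (\<lambda>a. cl (f a)) S = cl (sum f S)"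
  by (induction S rule: finite_induct) (auto simp: zero_cl)

lemma word_prod_cl: "word_prod UU (\<lambda>i. cl (f i)) w = cl (prod_list (map f w))"
  by (induction w) (simp_all add: word_prod_def one_cl)

lemma nc_eval_cl: "nc_eval UU sc (\<lambda>i. cl (f i)) p = cl (alg_eval f p)"
  by (simp add: nc_eval_def word_prod_cl finsum_cl alg_eval_def plin_def)

lemma lin_span_cl: "lin_span UU sc (cl ` S) = cl ` pm.span S"
proof
  have gens: "{sc c \<otimes>\<^bsub>UU\<^esub> x |c x. x \<in> cl ` S} = {cl (pscale c x) | c x. x \<in> S}"
    by (auto simp: image_iff) (metis sc_mult)+
  show "lin_span UU sc (cl ` S) \<subseteq> cl ` pm.span S"
  proof
    fix u assume "u \<in> lin_span UU sc (cl ` S)"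
    then have "u \<in> generate (add_monoid UU) {cl (pscale c x) | c x. x \<in> S}"
      by (simp add: lin_span_def gens)
    then show "u \<in> cl ` pm.span S"
    proof (induction rule: generate.induct)
      case one
      then show ?case using pm.span_zero[of S] by (auto simp: zero_cl)
    next
      case (incl h)
      then show ?case by (auto intro: pm.span_scale pm.span_base)
    next
      case (inv h)
      then obtain c x where h: "h = cl (pscale c x)" "x \<in> S" by auto
      then have "inv\<^bsub>add_monoid UU\<^esub> h = cl (- pscale c x)"
        using a_inv_cl[of "pscale c x"] by (simp add: a_inv_def)
      then show ?case using h(2) by (auto intro: pm.span_neg pm.span_scale pm.span_base)
    next
      case (eng h1 h2)
      then show ?case by (auto intro: pm.span_add)
    qed
  qed
  show "cl ` pm.span S \<subseteq> lin_span UU sc (cl ` S)"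
  proof (safe)
    fix x assume "x \<in> pm.span S"
    then show "cl x \<in> lin_span UU sc (cl ` S)"
    proof (induction rule: pm.span_induct_alt)
      case base
      then show ?case
        unfolding lin_span_def using generate.one[of "add_monoid UU"] by (simp add: zero_cl)
    next
      case (step c x y)
      have "cl (pscale c x) \<in> generate (add_monoid UU) {sc c \<otimes>\<^bsub>UU\<^esub> x |c x. x \<in> cl ` S}"
        by (rule generate.incl) (use step(1) in \<open>auto simp: gens\<close>)
      from generate.eng[OF this, of "cl y"] show ?case
        using step(2) by (simp add: lin_span_def)
    qed
  qed
qed

text \<open>Spans in the quotient are compared through representatives once the ideal is added to
  the generators, so inclusions between summands become statements about the free algebra.\<close>

lemma cl_in_cl_span_iff: "cl x \<in> cl ` pm.span S \<longleftrightarrow> x \<in> pm.span (II \<union> S)"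
proof
  assume "cl x \<in> cl ` pm.span S"
  then obtain y where "y \<in> pm.span S" "x - y \<in> II" by (auto simp: cl_eq_iff)
  then have "(x - y) + y \<in> pm.span (II \<union> S)"
    by (intro pm.span_add) (auto intro: pm.span_base set_mp[OF pm.span_mono[of S "II \<union> S"]])
  then show "x \<in> pm.span (II \<union> S)" by simp
next
  assume "x \<in> pm.span (II \<union> S)"
  then obtain a b where "x = a + b" "a \<in> pm.span II" "b \<in> pm.span S"
    by (auto simp: pm.span_Un)
  then show "cl x \<in> cl ` pm.span S"
    using pm.span_eq_iff[THEN iffD2, OF II_subspace] by (intro image_eqI[of _ _ b]) (simp_all add: cl_eq_iff)
qed

text \<open>Evaluates the definite description. Directness is asked of representatives only: a
  finite sum of elements of the \<open>L t\<close> that falls into \<open>II\<close> has all its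
  terms in \<open>II\<close>. Then any one decomposition modulo \<open>II\<close> determines the
  value.\<close>

lemma summand_proj_cl:
  assumes L: "\<And>t. t \<in> T \<Longrightarrow> pm.subspace (L t)"
    and V: "\<And>t. t \<in> T \<Longrightarrow> V t = cl ` L t"
    and direct: "\<And>F z. finite F \<Longrightarrow> F \<subseteq> T \<Longrightarrow> (\<And>t. t \<in> F \<Longrightarrow> z t \<in> L t) \<Longrightarrow> sum z F \<in> II \<Longrightarrow>
       (\<And>t. t \<in> F \<Longrightarrow> z t \<in> II)"
    and F: "finite F" "F \<subseteq> T" "\<And>t. t \<in> F \<Longrightarrow> y t \<in> L t" "x - sum y F \<in> II"
    and t0: "t0 \<in> T"
  shows "summand_proj UU T V t0 (cl x) = cl (if t0 \<in> F then y t0 else 0)"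
  unfolding summand_proj_def
proof (rule the_equality)
  define y' where "y' t = (if t \<in> F then y t else 0)" for t
  \<comment> \<open>\<open>summand_proj\<close> sums over indices with nonzero class only, so the
    terms of \<open>y\<close> that already lie in the ideal are dropped; their total is again in the
    ideal.\<close>
  define F' where "F' = {t \<in> T. cl (y' t) \<noteq> \<zero>\<^bsub>UU\<^esub>}"
  have F': "F' \<subseteq> F" by (auto simp: F'_def y'_def zero_cl)
  then have finF': "finite F'" using F(1) finite_subset by auto
  have y'L: "y' t \<in> L t" if "t \<in> T" for t
    using F(3) pm.subspace_0[OF L[OF that]] by (auto simp: y'_def)
  have "sum y F = sum y' F" by (simp add: y'_def)
  also have "\<dots> = sum y' F' + sum y' (F - F')"
    using F' F(1) by (simp add: sum.subset_diff add.commute)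
  finally have *: "sum y F = sum y' F' + sum y' (F - F')" .
  have "y' t \<in> II" if "t \<in> F - F'" for t
    using that F(2) by (auto simp: F'_def cl_eq_zero_iff)
  then have "sum y' (F - F') \<in> II" by (intro pm.subspace_sum[OF II_subspace]) auto
  with F(4) have "x - sum y' F' \<in> II"
    unfolding * using II_add[of "x - (sum y' F' + sum y' (F - F'))" "sum y' (F - F')"]
    by (simp add: algebra_simps)
  then have "cl x = (\<Oplus>\<^bsub>UU\<^esub>t\<in>F'. cl (y' t))"
    using finF' by (simp add: finsum_cl cl_eq_iff)
  then show "\<exists>f. (\<forall>t\<in>T. f t \<in> V t) \<and> finite {t \<in> T. f t \<noteq> \<zero>\<^bsub>UU\<^esub>} \<and>
      cl x = (\<Oplus>\<^bsub>UU\<^esub>t\<in>{t \<in> T. f t \<noteq> \<zero>\<^bsub>UU\<^esub>}. f t) \<and> cl (if t0 \<in> F then y t0 else 0) = f t0"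
    using y'L finF' by (intro exI[of _ "\<lambda>t. cl (y' t)"]) (auto simp: V F'_def y'_def)
  fix v
  assume "\<exists>f. (\<forall>t\<in>T. f t \<in> V t) \<and> finite {t \<in> T. f t \<noteq> \<zero>\<^bsub>UU\<^esub>} \<and>
      cl x = (\<Oplus>\<^bsub>UU\<^esub>t\<in>{t \<in> T. f t \<noteq> \<zero>\<^bsub>UU\<^esub>}. f t) \<and> v = f t0"
  then obtain f where f: "\<And>t. t \<in> T \<Longrightarrow> f t \<in> V t" "finite {t \<in> T. f t \<noteq> \<zero>\<^bsub>UU\<^esub>}"
      "cl x = (\<Oplus>\<^bsub>UU\<^esub>t\<in>{t \<in> T. f t \<noteq> \<zero>\<^bsub>UU\<^esub>}. f t)" "v = f t0" by auto
  have "\<forall>t\<in>T. \<exists>z. z \<in> L t \<and> f t = cl z" using f(1) V by blast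
  then obtain z where z: "\<And>t. t \<in> T \<Longrightarrow> z t \<in> L t" "\<And>t. t \<in> T \<Longrightarrow> f t = cl (z t)" by metis
  define G where "G = {t \<in> T. f t \<noteq> \<zero>\<^bsub>UU\<^esub>}"
  have G: "finite G" "G \<subseteq> T" using f(2) by (auto simp: G_def)
  define z' where "z' t = (if t \<in> G then z t else 0)" for t
  have z'L: "z' t \<in> L t" if "t \<in> T" for t
    using z(1) pm.subspace_0[OF L[OF that]] that by (auto simp: z'_def)
  have fz': "f t = cl (z' t)" if "t \<in> T" for t
    using that z(2) by (auto simp: z'_def G_def zero_cl)
  have "cl x = (\<Oplus>\<^bsub>UU\<^esub>t\<in>G. cl (z' t))"
    unfolding f(3) G_def[symmetric]
    by (rule UR.finsum_cong') (use G fz' in auto)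
  then have "x - sum z' G \<in> II" using G by (simp add: finsum_cl cl_eq_iff)
  \<comment> \<open>Both decompositions are padded by zeros to one index set before subtracting;
    \<open>t0\<close> is inserted because it may occur in neither of them.\<close>
  moreover have "sum z' G = sum z' (insert t0 (F \<union> G))"
    by (rule sum.mono_neutral_left) (use F(1) G(1) in \<open>auto simp: z'_def\<close>)
  moreover have "sum y F = sum y' (insert t0 (F \<union> G))"
  proof -
    have "sum y F = sum y' F" by (simp add: y'_def)
    also have "\<dots> = sum y' (insert t0 (F \<union> G))"
      by (rule sum.mono_neutral_left) (use F(1) G(1) in \<open>auto simp: y'_def\<close>)
    finally show ?thesis .
  qed
  ultimately have "sum (\<lambda>t. z' t - y' t) (insert t0 (F \<union> G)) \<in> II"
    using II_diff[OF F(4), of "x - sum z' G"] by (simp add: sum_subtractf del: sum.insert)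
  then have "z' t0 - y' t0 \<in> II"
    by (rule direct[rotated 3])
       (use F(1,2) G t0 z'L y'L in \<open>auto intro!: pm.subspace_diff L\<close>)
  then show "v = cl (if t0 \<in> F then y t0 else 0)"
    using f(4) fz'[OF t0] by (simp add: cl_eq_iff y'_def)
qed

end

section \<open>Skew derivations\<close>

lemma weight_Nil [simp]: "weight [] = 0" and weight_Cons [simp]: "weight (i # w) = alpha i + weight w"
  by (simp_all add: weight_def)

text \<open>For \<open>g = chi a\<close> this is the scalar picked up when \<open>K_a\<close> is
  moved through a word in the \<open>E_j\<close>; for the indicator function of a set of weights it
  is a projection onto homogeneous components. Both uses occur below.\<close>

definition diag :: "('n::finite lat \<Rightarrow> 'k::field) \<Rightarrow> ('n, 'k) free_alg \<Rightarrow> ('n, 'k) free_alg" where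
  "diag g = plin (\<lambda>w. Poly_Mapping.single w (g (weight w)))"

lemma plinear_diag [simp, intro]: "plinear (diag g)"
  by (simp add: diag_def)

lemma diag_single [simp]: "diag g (Poly_Mapping.single w c) = Poly_Mapping.single w (c * g (weight w))"
  by (simp add: diag_def)

text \<open>Only finitely many homogeneous components occur and each is scaled by a constant; a
  graded subspace is therefore stable under \<open>diag g\<close> for every
  \<open>g\<close>.\<close>

lemma diag_eq_sum:
  "diag g p = (\<Sum>a\<in>weight ` Poly_Mapping.keys p. pscale (g a) (hom_component a p))"
proof -
  have "(\<Sum>a\<in>weight ` Poly_Mapping.keys p. pscale (g a) (hom_component a p))
      = (\<Sum>a\<in>weight ` Poly_Mapping.keys p. \<Sum>w\<in>{w \<in> Poly_Mapping.keys p. weight w = a}.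
           Poly_Mapping.single w (Poly_Mapping.lookup p w * g (weight w)))"
    unfolding hom_component_def pm.scale_sum_right
    by (intro sum.cong refl) (simp add: mult.commute)
  also have "\<dots> = (\<Sum>w\<in>Poly_Mapping.keys p. Poly_Mapping.single w (Poly_Mapping.lookup p w * g (weight w)))"
    by (rule sum.image_gen[symmetric]) simp
  finally show ?thesis
    by (simp add: diag_def plin_def)
qed

text \<open>Sum over the occurrences of \<open>i\<close> in the word, each deleted in turn and
  weighted by \<open>f\<close> of the letters behind it. With a character of the weight as
  \<open>f\<close> this is a skew derivation of the tensor algebra.\<close>

primrec skew_word :: "('n::finite list \<Rightarrow> 'k::field) \<Rightarrow> 'n \<Rightarrow> 'n list \<Rightarrow> ('n, 'k) free_alg" where
  "skew_word f i [] = 0"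
| "skew_word f i (j # w) =
     letter j * skew_word f i w + (if i = j then Poly_Mapping.single w (f w) else 0)"

lemma braided_mult:
  "s \<otimes>\<^bsub>braided_square chi\<^esub> t = plin (\<lambda>(u, v). plin (\<lambda>(u', v').
     Poly_Mapping.single (u @ u', v @ v') (chi (weight v) (weight u'))) t) s"
  by (simp add: braided_square_def plin_def pm.scale_sum_right case_prod_beta mult.assoc)

lemma braided_square_simps [simp]:
  "carrier (braided_square chi) = UNIV"
  "s \<oplus>\<^bsub>braided_square chi\<^esub> t = s + t"
  "\<zero>\<^bsub>braided_square chi\<^esub> = 0"
  "\<one>\<^bsub>braided_square chi\<^esub> = Poly_Mapping.single ([], []) 1"
  by (simp_all add: braided_square_def tensor_scalar_def)

lemma tensor_eq_plin: "tensor x y = plin (\<lambda>u. plin (\<lambda>v. Poly_Mapping.single (u, v) 1) y) x"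
  by (simp add: tensor_def plin_def pm.scale_sum_right)

lemma lin_span_subset_subspace:
  fixes R :: "('a \<Rightarrow>\<^sub>0 'k::field, 'm) ring_scheme"
  assumes R: "carrier R = UNIV" "\<And>x y. x \<oplus>\<^bsub>R\<^esub> y = x + y" "\<zero>\<^bsub>R\<^esub> = 0"
    and s: "\<And>c x. s c \<otimes>\<^bsub>R\<^esub> x = pscale c x"
  shows "lin_span R s S \<subseteq> pm.span S"
proof
  fix u assume "u \<in> lin_span R s S"
  then have "u \<in> generate (add_monoid R) {pscale c x | c x. x \<in> S}"
    by (simp add: lin_span_def s)
  then show "u \<in> pm.span S"
  proof (induction rule: generate.induct)
    case (inv h)
    have "inv\<^bsub>add_monoid R\<^esub> h = - h"
      unfolding m_inv_def
      by (rule the_equality) (auto simp: R eq_neg_iff_add_eq_0 add.commute)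
    then show ?case using inv by (auto intro: pm.span_neg pm.span_scale pm.span_base)
  qed (auto simp: R intro: pm.span_zero pm.span_scale pm.span_base pm.span_add)
qed

locale pre_nichols = u_algebra chi J
  for chi :: "'n::{finite,linorder} lat \<Rightarrow> 'n lat \<Rightarrow> 'k::field" and J +
  assumes bichar: "bicharacter chi"
    and q_sym: "q chi i j = q chi j i"
    and biideal: "graded_biideal chi J"
    and deg2: "J \<subseteq> degree_ge_two"
begin

lemma chi_add_left: "chi (a + b) d = chi a d * chi b d"
  and chi_add_right: "chi d (a + b) = chi d a * chi d b"
  and chi_nonzero [simp]: "chi a b \<noteq> 0"
  using bichar by (auto simp: bicharacter_def)

lemma chi_zero_left [simp]: "chi 0 b = 1" and chi_zero_right [simp]: "chi b 0 = 1"
  using chi_add_left[of 0 0 b] chi_add_right[of b 0 0] chi_nonzero[of 0 b] chi_nonzero[of b 0] by auto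

lemma chi_neg_left: "chi (- a) b = inverse (chi a b)"
  and chi_neg_right: "chi b (- a) = inverse (chi b a)"
  using chi_add_left[of "- a" a b] chi_add_right[of b "- a" a] by (auto simp: field_simps)

lemma chi_diff_right: "chi d (a - b) = chi d a / chi d b"
  using chi_add_right[of d a "- b"] by (simp add: chi_neg_right field_simps)

lemma chi_alpha_sym: "chi (alpha i) (alpha j) = chi (alpha j) (alpha i)"
  using q_sym[of i j] by (simp add: q_def)

lemma ideal_J: "ideal J ring_of_type_algebra"
  using biideal by (simp add: graded_biideal_def)

lemma J_lmult: "x \<in> J \<Longrightarrow> y * x \<in> J" and J_rmult: "x \<in> J \<Longrightarrow> x * y \<in> J"
  using ideal.I_l_closed[OF ideal_J, of x y] ideal.I_r_closed[OF ideal_J, of x y] by auto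

lemma J_subspace: "pm.subspace J"
  using additive_subgroup.zero_closed[OF ideal.axioms(1)[OF ideal_J]]
    additive_subgroup.a_closed[OF ideal.axioms(1)[OF ideal_J]]
  by (intro pm.subspaceI) (auto simp: const_mult[symmetric] intro: J_lmult)

lemma J_span: "pm.span J = J"
  by (rule pm.span_eq_iff[THEN iffD2, OF J_subspace])

text \<open>The two lengths have separate uses: absence of the empty word keeps \<open>J\<close>
  away from the torus coordinates, absence of single letters makes the components of the coproduct
  with one factor of degree one respect \<open>J\<close>.\<close>

lemma lookup_J_short:
  assumes "x \<in> J" "length w < 2"
  shows "Poly_Mapping.lookup x w = 0"
  using assms deg2 by (force simp: degree_ge_two_def in_keys_iff)

lemma diag_J: "x \<in> J \<Longrightarrow> diag g x \<in> J"
  unfolding diag_eq_sum using biideal J_subspace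
  by (intro pm.subspace_sum pm.subspace_scale) (auto simp: graded_biideal_def)

text \<open>The twisted derivations \<open>\<partial>\<^sup>+\<^sub>i\<close> and \<open>\<partial>\<^sup>-\<^sub>i\<close> governing the commutator of \<open>F\<^sub>i\<close> with the
  subalgebra generated by the \<open>E\<^sub>j\<close>; they are the components of the coproduct with one tensor
  factor equal to \<open>E\<^sub>i\<close>.\<close>

definition dplus_word where "dplus_word i = skew_word (\<lambda>w. chi (alpha i) (weight w)) i"
definition dminus_word where "dminus_word i = skew_word (\<lambda>w. inverse (chi (alpha i) (weight w))) i"
definition dplus where "dplus i = plin (dplus_word i)"
definition dminus where "dminus i = plin (dminus_word i)"

lemma plinear_dplus [simp, intro]: "plinear (dplus i)"
  and plinear_dminus [simp, intro]: "plinear (dminus i)"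
  by (simp_all add: dplus_def dminus_def)

section \<open>Components of the braided coproduct with one factor of degree at most one\<close>

definition cop_word where
  "cop_word = word_prod (braided_square chi) (\<lambda>i. tensor (letter i) 1 + tensor 1 (letter i))"

lemma tensor_scalar_mult: "tensor_scalar c \<otimes>\<^bsub>braided_square chi\<^esub> s = pscale c s"
  by (simp add: tensor_scalar_def braided_mult case_prod_beta' plin_id)

lemma coproduct_eq: "coproduct chi p = plin cop_word p"
  by (simp add: coproduct_def nc_eval_def finsum_eq_sum plin_def cop_word_def tensor_scalar_mult)

lemma cop_word_Nil: "cop_word [] = Poly_Mapping.single ([], []) 1"
  by (simp add: cop_word_def word_prod_def)

text \<open>The scalar in the second term is the braiding of the new letter past the left tensor
  factor.\<close>

lemma cop_word_Cons:
  "cop_word (j # w) = plin (\<lambda>(u, v). Poly_Mapping.single (j # u, v) 1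
     + Poly_Mapping.single (u, j # v) (chi (alpha j) (weight u))) (cop_word w)"
proof -
  have "cop_word (j # w) = (tensor (letter j) 1 + tensor 1 (letter j))
      \<otimes>\<^bsub>braided_square chi\<^esub> cop_word w"
    by (simp add: cop_word_def word_prod_def)
  also have "\<dots> = plin (\<lambda>(u, v). Poly_Mapping.single (j # u, v) 1) (cop_word w)
      + plin (\<lambda>(u, v). Poly_Mapping.single (u, j # v) (chi (alpha j) (weight u))) (cop_word w)"
    by (simp add: braided_mult tensor_eq_plin letter_def one_free_alg plin_add)
  also have "\<dots> = plin (\<lambda>(u, v). Poly_Mapping.single (j # u, v) 1
     + Poly_Mapping.single (u, j # v) (chi (alpha j) (weight u))) (cop_word w)"
    by (simp add: plin_def sum.distrib[symmetric] case_prod_beta pm.scale_right_distrib)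
  finally show ?thesis .
qed

definition pr_right :: "'n list \<Rightarrow> ('n list \<times> 'n list \<Rightarrow>\<^sub>0 'k) \<Rightarrow> ('n, 'k) free_alg" where
  "pr_right x = plin (\<lambda>(u, v). if v = x then Poly_Mapping.single u 1 else 0)"
definition pr_left :: "'n list \<Rightarrow> ('n list \<times> 'n list \<Rightarrow>\<^sub>0 'k) \<Rightarrow> ('n, 'k) free_alg" where
  "pr_left x = plin (\<lambda>(u, v). if u = x then Poly_Mapping.single v 1 else 0)"

lemma plinear_pr [simp, intro]: "plinear (pr_right x)" "plinear (pr_left x)"
  by (simp_all add: pr_right_def pr_left_def)

lemma pr_right_single [simp]:
    "pr_right x (Poly_Mapping.single (u, v) c) = (if v = x then Poly_Mapping.single u c else 0)"
  and pr_left_single [simp]: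
    "pr_left x (Poly_Mapping.single (u, v) c) = (if u = x then Poly_Mapping.single v c else 0)"
  by (simp_all add: pr_right_def pr_left_def)

lemma pr_right_Nil_cop: "pr_right [] (cop_word w) = Poly_Mapping.single w 1"
proof (induction w)
  case (Cons j w)
  have "pr_right [] (cop_word (j # w)) = letter j * pr_right [] (cop_word w)"
    unfolding cop_word_Cons
    by (rule plinear_ext[where p = "cop_word w"])
       (auto intro!: plinear_comp[OF plinear_mult_right] plinear_comp[OF plinear_pr(1)] plinear_plin plinear_id plinear_ifI
         simp: letter_def plinear_0[OF plinear_diag] plinear_add[OF plinear_pr(1)] split: prod.splits)
  then show ?case by (simp add: Cons letter_def)
qed (simp add: cop_word_Nil)

lemma pr_left_Nil_cop: "pr_left [] (cop_word w) = Poly_Mapping.single w 1"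
proof (induction w)
  case (Cons j w)
  have "pr_left [] (cop_word (j # w)) = letter j * pr_left [] (cop_word w)"
    unfolding cop_word_Cons
    by (rule plinear_ext[where p = "cop_word w"])
       (auto intro!: plinear_comp[OF plinear_mult_right] plinear_comp[OF plinear_pr(2)] plinear_plin plinear_id plinear_ifI
         simp: letter_def plinear_add[OF plinear_pr(2)] split: prod.splits)
  then show ?case by (simp add: Cons letter_def)
qed (simp add: cop_word_Nil)

lemma pr_right_cop: "pr_right [i] (cop_word w) = dplus_word i w"
proof (induction w)
  case (Cons j w)
  have "pr_right [i] (cop_word (j # w)) = letter j * pr_right [i] (cop_word w)
      + (if i = j then diag (chi (alpha i)) (pr_right [] (cop_word w)) else 0)"
    unfolding cop_word_Cons
    by (rule plinear_ext[where p = "cop_word w"])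
       (auto intro!: plinear_comp[OF plinear_mult_right] plinear_comp[OF plinear_pr(1)] plinear_plin plinear_id plinear_ifI
         plinear_comp[OF plinear_diag] plinear_addI plinear_zero
         simp: letter_def plinear_0[OF plinear_diag] plinear_add[OF plinear_pr(1)] split: prod.splits)
  then show ?case by (simp add: Cons pr_right_Nil_cop dplus_word_def)
qed (simp add: cop_word_Nil dplus_word_def)

text \<open>Each letter in front of the chosen \<open>i\<close> is braided past it, giving
  \<open>chi\<close> of the prefix with \<open>alpha i\<close>. By symmetry of the
  \<open>q chi i j\<close> this is the value on all remaining letters divided by the value on the
  suffix, and the suffix part is the weight in \<open>dminus_word\<close>.\<close>

lemma pr_left_cop:
  "pr_left [i] (cop_word w) = pscale (chi (alpha i) (weight w - alpha i)) (dminus_word i w)"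
proof (induction w)
  case (Cons j w)
  have "pr_left [i] (cop_word (j # w)) = pscale (chi (alpha j) (alpha i)) (letter j * pr_left [i] (cop_word w))
      + (if i = j then pr_left [] (cop_word w) else 0)"
    unfolding cop_word_Cons
    by (rule plinear_ext[where p = "cop_word w"])
       (auto intro!: plinear_comp[OF plinear_mult_right] plinear_comp[OF plinear_pr(2)] plinear_plin plinear_id plinear_ifI
         plinear_scaleI plinear_addI plinear_zero
         simp: letter_def plinear_add[OF plinear_pr(2)] split: prod.splits)
  then show ?case
    by (simp add: Cons pr_left_Nil_cop dminus_word_def pscale_mult_right pm.scale_right_distrib
        chi_add_right chi_diff_right chi_alpha_sym[of j i] field_simps)
qed (simp add: cop_word_Nil dminus_word_def)

lemma pr_tensor:
  "pr_right x (tensor a b) = pscale (Poly_Mapping.lookup b x) a"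
  "pr_left x (tensor a b) = pscale (Poly_Mapping.lookup a x) b"
  by (simp_all add: tensor_eq_plin plinear_plin_comp[OF plinear_pr(1)] plinear_plin_comp[OF plinear_pr(2)]
      plin_delta plin_id plin_single_fun plin_if)

lemma coproduct_J:
  assumes "x \<in> J"
  shows "coproduct chi x \<in> pm.span {tensor a b | a b. a \<in> J \<or> b \<in> J}"
proof -
  have "coproduct chi x \<in> lin_span (braided_square chi) tensor_scalar {tensor a b | a b. a \<in> J \<or> b \<in> J}"
    using biideal assms by (simp add: graded_biideal_def)
  then show ?thesis
    using lin_span_subset_subspace[of "braided_square chi" tensor_scalar] tensor_scalar_mult by auto
qed

text \<open>Contracting \<open>tensor a b\<close> gives a multiple of \<open>a\<close>. If
  \<open>a\<close> is in \<open>J\<close> this suffices; otherwise \<open>b\<close> is, and the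
  scalar is the coefficient of a single letter in \<open>b\<close>, hence zero.\<close>

lemma pr_right_coproduct_J: "x \<in> J \<Longrightarrow> pr_right [i] (coproduct chi x) \<in> J"
  by (rule plinear_image_span[OF plinear_pr(1) coproduct_J, where T = J, unfolded J_span])
     (auto simp: pr_tensor lookup_J_short pm.subspace_0[OF J_subspace]
       intro: pm.subspace_scale[OF J_subspace])

lemma pr_left_coproduct_J: "x \<in> J \<Longrightarrow> pr_left [i] (coproduct chi x) \<in> J"
  by (rule plinear_image_span[OF plinear_pr(2) coproduct_J, where T = J, unfolded J_span])
     (auto simp: pr_tensor lookup_J_short pm.subspace_0[OF J_subspace]
       intro: pm.subspace_scale[OF J_subspace])

lemma dplus_J: "x \<in> J \<Longrightarrow> dplus i x \<in> J"
  using pr_right_coproduct_J[of x i]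
  by (simp add: coproduct_eq plinear_plin_comp[OF plinear_pr(1)] pr_right_cop dplus_def)

lemma dminus_J:
  assumes "x \<in> J"
  shows "dminus i x \<in> J"
proof -
  \<comment> \<open>\<open>pr_left_cop\<close> carries a factor that depends on the weight of the
    whole word; rescaling the homogeneous components of \<open>x\<close> beforehand cancels it
    without leaving \<open>J\<close>.\<close>
  let ?y = "diag (\<lambda>a. inverse (chi (alpha i) (a - alpha i))) x"
  have "pr_left [i] (coproduct chi ?y) = dminus i x"
    by (simp add: coproduct_eq plinear_plin_comp[OF plinear_pr(2)] pr_left_cop dminus_def diag_def
        plinear_plin_comp[OF plinear_plin] plinear_scale[OF plinear_pr(2)])
  then show ?thesis
    using pr_left_coproduct_J[OF diag_J[OF assms], of i] by metis
qed

section \<open>The Verma-type representation\<close>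

text \<open>The basis vector \<open>(u, \<mu>, v)\<close> stands for \<open>E\<^sub>u K\<^sub>\<mu> F\<^sub>v\<close>; the operators below are
  left multiplications in the algebra without the relations from \<open>J\<close>.\<close>

type_synonym ('m, 'l) pbw = "('m list \<times> (int ^ 'm) \<times> 'm list) \<Rightarrow>\<^sub>0 'l"

definition opE :: "'n \<Rightarrow> ('n, 'k) pbw \<Rightarrow> ('n, 'k) pbw" where
  "opE i = plin (\<lambda>(u, m, v). Poly_Mapping.single (i # u, m, v) 1)"
definition opK :: "'n \<Rightarrow> ('n, 'k) pbw \<Rightarrow> ('n, 'k) pbw" where
  "opK i = plin (\<lambda>(u, m, v). Poly_Mapping.single (u, m + alpha i, v) (chi (alpha i) (weight u)))"
definition opKi :: "'n \<Rightarrow> ('n, 'k) pbw \<Rightarrow> ('n, 'k) pbw" where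
  "opKi i = plin (\<lambda>(u, m, v). Poly_Mapping.single (u, m - alpha i, v) (inverse (chi (alpha i) (weight u))))"

text \<open>\<open>F_i\<close> is moved to the right through the \<open>E\<close>-word by
  \<open>F_i E_j = E_j F_i - delta_ij (K_i - K_i^-1)\<close>; the scalar in the base case comes from
  \<open>F_i K_m = chi(m, alpha_i) K_m F_i\<close>.\<close>

fun basisF :: "'n \<Rightarrow> 'n list \<Rightarrow> 'n lat \<Rightarrow> 'n list \<Rightarrow> ('n, 'k) pbw" where
  "basisF i [] m v = Poly_Mapping.single ([], m, i # v) (chi m (alpha i))"
| "basisF i (j # u) m v = opE j (basisF i u m v)
     - (if i = j then opK i (Poly_Mapping.single (u, m, v) 1) - opKi i (Poly_Mapping.single (u, m, v) 1) else 0)"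

definition opF :: "'n \<Rightarrow> ('n, 'k) pbw \<Rightarrow> ('n, 'k) pbw" where
  "opF i = plin (\<lambda>(u, m, v). basisF i u m v)"

fun op :: "'n gen \<Rightarrow> ('n, 'k) pbw \<Rightarrow> ('n, 'k) pbw" where
  "op (gE i) = opE i"
| "op (gF i) = opF i"
| "op (gK i) = opK i"
| "op (gKi i) = opKi i"

lemma plinear_ops [simp, intro]: "plinear (opE i)" "plinear (opK i)" "plinear (opKi i)" "plinear (opF i)"
  by (simp_all add: opE_def opK_def opKi_def opF_def)

lemma plinear_op [simp, intro]: "plinear (op g)"
  by (cases g) auto

lemmas op_diff = plinear_ops[THEN plinear_diff]
lemmas op_scale = plinear_ops[THEN plinear_scale]
lemmas op_0 = plinear_ops[THEN plinear_0]

lemma op_single [simp]: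
  "opE i (Poly_Mapping.single (u, m, v) c) = Poly_Mapping.single (i # u, m, v) c"
  "opK i (Poly_Mapping.single (u, m, v) c)
     = Poly_Mapping.single (u, m + alpha i, v) (c * chi (alpha i) (weight u))"
  "opKi i (Poly_Mapping.single (u, m, v) c)
     = Poly_Mapping.single (u, m - alpha i, v) (c * inverse (chi (alpha i) (weight u)))"
  by (simp_all add: opE_def opK_def opKi_def)

lemma opF_single: "opF i (Poly_Mapping.single (u, m, v) 1) = basisF i u m v"
  by (simp add: opF_def)

lemma pbw_ext:
  assumes "plinear f" "plinear g"
    and "\<And>u m v. f (Poly_Mapping.single (u, m, v) 1) = g (Poly_Mapping.single (u, m, v) 1)"
  shows "f (x :: ('n, 'k) pbw) = g x"
  by (rule plinear_ext[OF assms(1,2)]) (auto simp: assms(3) split: prod.splits)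

lemmas plinear_intros = plinear_ops plinear_id plinear_zero plinear_scaleI plinear_addI plinear_diffI
  plinear_ops[THEN plinear_comp]

lemma op_KKi: "opK i (opKi i x) = x" and op_KiK: "opKi i (opK i x) = x"
  by (rule pbw_ext[where x = x]; (intro plinear_intros)?; force)+

lemma op_KK: "opK i (opK j x) = opK j (opK i x)"
  by (rule pbw_ext[where x = x]; (intro plinear_intros)?) (auto simp: algebra_simps)

lemma op_KE: "opK i (opE j x) = pscale (q chi i j) (opE j (opK i x))"
  by (rule pbw_ext[where x = x]; (intro plinear_intros)?; simp add: q_def chi_add_right)

lemma op_KKi_comm: "opK i (opKi j x) = opKi j (opK i x)"
  by (rule pbw_ext[where x = x]; (intro plinear_intros)?) (auto simp: algebra_simps)

lemma op_EF: "opE i (opF j x) - opF j (opE i x) = (if i = j then opK i x - opKi i x else 0)"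
proof (rule pbw_ext[where x = x]; (intro plinear_intros)?)
  show "plinear (\<lambda>x. if i = j then opK i x - opKi i x else 0)"
    by (intro plinear_ifI plinear_diffI plinear_ops)
qed (simp add: opF_single)

text \<open>The one relation not visible on basis vectors, because \<open>opF\<close> is recursive
  in the \<open>E\<close>-word. In the induction, contraction terms occur only for
  \<open>k = j\<close>, where the scalars \<open>q chi i k\<close> and
  \<open>inverse (q chi i j)\<close> cancel.\<close>

lemma op_KF: "opK i (opF j x) = pscale (inverse (q chi i j)) (opF j (opK i x))"
proof (rule pbw_ext[where x = x]; (intro plinear_intros)?)
  fix u m v
  show "opK i (opF j (Poly_Mapping.single (u, m, v) 1))
      = pscale (inverse (q chi i j)) (opF j (opK i (Poly_Mapping.single (u, m, v) 1)))"
  proof (induction u)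
    case Nil
    then show ?case
      by (simp add: opF_def q_def chi_add_left field_simps)
  next
    case (Cons k u)
    let ?s = "Poly_Mapping.single (u, m, v) (1::'k)"
    have e: "opF j (opE k z) = opE k (opF j z) - (if k = j then opK k z - opKi k z else 0)" for z
      by (simp only: op_EF[symmetric]) simp
    have "opK i (opF j (opE k ?s)) = pscale (q chi i k) (opE k (opK i (opF j ?s)))
       - (if k = j then opK i (opK k ?s) - opK i (opKi k ?s) else 0)"
      by (simp add: e op_diff op_0 op_KE del: op_single)
    also have "opK i (opF j ?s) = pscale (inverse (q chi i j)) (opF j (opK i ?s))" by (rule Cons)
    also have "pscale (q chi i k) (opE k (pscale (inverse (q chi i j)) (opF j (opK i ?s))))
         - (if k = j then opK i (opK k ?s) - opK i (opKi k ?s) else 0)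
       = pscale (inverse (q chi i j)) (pscale (q chi i k) (opE k (opF j (opK i ?s))
         - (if k = j then opK k (opK i ?s) - opKi k (opK i ?s) else 0)))"
      by (auto simp: op_scale op_KK[of i j] op_KKi_comm pm.scale_right_diff_distrib mult.commute q_def
          simp del: op_single)
    also have "\<dots> = pscale (inverse (q chi i j)) (opF j (pscale (q chi i k) (opE k (opK i ?s))))"
      by (simp add: e op_scale del: op_single)
    also have "\<dots> = pscale (inverse (q chi i j)) (opF j (opK i (opE k ?s)))"
      by (simp add: op_KE del: op_single)
    finally show ?case by simp
  qed
qed

lemma op_KiF: "opKi i (opF j x) = pscale (q chi i j) (opF j (opKi i x))"
proof -
  have "opF j (opKi i x) = opKi i (opK i (opF j (opKi i x)))" by (simp add: op_KiK)
  also have "\<dots> = pscale (inverse (q chi i j)) (opKi i (opF j x))"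
    by (simp add: op_KF op_KKi op_scale)
  finally show ?thesis by (simp add: q_def)
qed

abbreviation acts where "acts \<equiv> act op"

lemma acts_mult: "acts (x * y) m = acts x (acts y m)"
  by (rule act_mult) simp

lemma acts_add: "acts (x + y) m = acts x m + acts y m"
  and acts_diff: "acts (x - y) m = acts x m - acts y m"
  and acts_scale: "acts (pscale c x) m = pscale c (acts x m)"
  by (simp_all add: plinear_add[OF plinear_act_left] plinear_diff[OF plinear_act_left]
      plinear_scale[OF plinear_act_left])

lemma plinear_acts [simp, intro]: "plinear (acts x)"
  by (rule plinear_act_right) simp

lemma acts_relations: "x \<in> relations chi \<Longrightarrow> acts x m = 0"
  unfolding relations_def
  by (auto simp: acts_mult acts_diff act_const op_KKi op_KiK op_KK op_KE op_KF op_EF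
      plinear_0[OF plinear_act_left] split: if_splits)

definition embL :: "'n lat \<Rightarrow> 'n list \<Rightarrow> ('n, 'k) free_alg \<Rightarrow> ('n, 'k) pbw" where
  "embL m v = plin (\<lambda>w. Poly_Mapping.single (w, m, v) 1)"
definition embR :: "'n list \<Rightarrow> 'n lat \<Rightarrow> ('n, 'k) free_alg \<Rightarrow> ('n, 'k) pbw" where
  "embR u m = plin (\<lambda>w. Poly_Mapping.single (u, m, w) 1)"

lemma plinear_emb [simp, intro]: "plinear (embL m v)" "plinear (embR u m)"
  by (simp_all add: embL_def embR_def)

lemma emb_single [simp]:
  "embL m v (Poly_Mapping.single w c) = Poly_Mapping.single (w, m, v) c"
  "embR u m (Poly_Mapping.single w c) = Poly_Mapping.single (u, m, w) c"
  by (simp_all add: embL_def embR_def)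

text \<open>The kernel of the passage to \<open>U\<^sup>+ \<otimes> H \<otimes> U\<^sup>-\<close>.\<close>

definition NN :: "('n, 'k) pbw set" where
  "NN = pm.span ({embL m v j | m v j. j \<in> J} \<union> {embR u m j | u m j. j \<in> J})"

lemma embL_NN: "j \<in> J \<Longrightarrow> embL m v j \<in> NN" and embR_NN: "j \<in> J \<Longrightarrow> embR u m j \<in> NN"
  unfolding NN_def by (rule pm.span_base; blast)+

lemma NN_subspace: "pm.subspace NN"
  by (simp add: NN_def)

lemmas NN_closed = pm.subspace_0[OF NN_subspace] pm.subspace_add[OF NN_subspace]
  pm.subspace_diff[OF NN_subspace] pm.subspace_scale[OF NN_subspace] pm.subspace_sum[OF NN_subspace]

lemma NN_image:
  assumes "plinear f" "\<And>m v j. j \<in> J \<Longrightarrow> f (embL m v j) \<in> NN" "\<And>u m j. j \<in> J \<Longrightarrow> f (embR u m j) \<in> NN"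
    and "x \<in> NN"
  shows "f x \<in> NN"
proof -
  have "f x \<in> pm.span NN"
    by (rule plinear_image_span[OF assms(1) assms(4)[unfolded NN_def]]) (auto intro: pm.span_base assms(2,3))
  then show ?thesis using pm.span_eq_iff[THEN iffD2, OF NN_subspace] by simp
qed

lemmas lin_intros = plinear_intros plinear_emb[THEN plinear_comp] plinear_diag plinear_dplus plinear_dminus
  plinear_emb plinear_mult_right plinear_acts[THEN plinear_comp] plinear_acts

lemma opE_embL: "opE i (embL m v j) = embL m v (letter i * j)"
  by (rule plinear_ext[where p = j]; (intro lin_intros)?) (simp add: letter_def)

lemma opE_embR: "opE i (embR u m j) = embR (i # u) m j"
  by (rule plinear_ext[where p = j]; (intro lin_intros)?) simp

lemma opK_embL: "opK i (embL m v j) = embL (m + alpha i) v (diag (chi (alpha i)) j)"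
  by (rule plinear_ext[where p = j]; (intro lin_intros)?) simp

lemma opKi_embL: "opKi i (embL m v j) = embL (m - alpha i) v (diag (\<lambda>a. inverse (chi (alpha i) a)) j)"
  by (rule plinear_ext[where p = j]; (intro lin_intros)?) simp

lemma opK_embR: "opK i (embR u m j) = pscale (chi (alpha i) (weight u)) (embR u (m + alpha i) j)"
  by (rule plinear_ext[where p = j]; (intro lin_intros)?) simp

lemma opKi_embR: "opKi i (embR u m j) = pscale (inverse (chi (alpha i) (weight u))) (embR u (m - alpha i) j)"
  by (rule plinear_ext[where p = j]; (intro lin_intros)?) simp

lemma dplus_single [simp]: "dplus i (Poly_Mapping.single w 1) = dplus_word i w"
  and dminus_single [simp]: "dminus i (Poly_Mapping.single w 1) = dminus_word i w"
  by (simp_all add: dplus_def dminus_def)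

text \<open>Contracting a letter leaves \<open>K_i\<close> or its inverse in its place, and moving
  that through the letters behind it produces exactly the weights of \<open>dplus\<close> and
  \<open>dminus\<close>.\<close>

lemma opF_embL: "opF i (embL m v j) = pscale (chi m (alpha i)) (embL m (i # v) j)
    - (embL (m + alpha i) v (dplus i j) - embL (m - alpha i) v (dminus i j))"
proof (rule plinear_ext[where p = j]; (intro lin_intros)?)
  fix u
  show "opF i (embL m v (Poly_Mapping.single u 1)) = pscale (chi m (alpha i)) (embL m (i # v) (Poly_Mapping.single u 1))
    - (embL (m + alpha i) v (dplus i (Poly_Mapping.single u 1)) - embL (m - alpha i) v (dminus i (Poly_Mapping.single u 1)))"
  proof (induction u)
    case Nil
    then show ?case by (simp add: opF_single dplus_word_def dminus_word_def plinear_0[OF plinear_emb(1)])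
  next
    case (Cons k u)
    have "basisF i (k # u) m v = opE k (basisF i u m v) - (if i = k then
        opK i (Poly_Mapping.single (u, m, v) 1) - opKi i (Poly_Mapping.single (u, m, v) 1) else 0)"
      by (rule basisF.simps)
    also have "basisF i u m v = pscale (chi m (alpha i)) (Poly_Mapping.single (u, m, i # v) 1)
        - (embL (m + alpha i) v (dplus_word i u) - embL (m - alpha i) v (dminus_word i u))"
      using Cons by (simp add: opF_single)
    also have "opE k \<dots> = pscale (chi m (alpha i)) (Poly_Mapping.single (k # u, m, i # v) 1)
        - (embL (m + alpha i) v (letter k * dplus_word i u) - embL (m - alpha i) v (letter k * dminus_word i u))"
      by (simp only: op_diff op_scale opE_embL op_single)
    finally show ?case
      by (cases "i = k") (simp_all add: opF_single dplus_word_def dminus_word_def plinear_add[OF plinear_emb(1)])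
  qed
qed

lemma opE_NN: "x \<in> NN \<Longrightarrow> opE i x \<in> NN"
  by (rule NN_image[where f = "opE i"]) (auto simp: opE_embL opE_embR intro: embL_NN embR_NN J_lmult)

lemma opK_NN: "x \<in> NN \<Longrightarrow> opK i x \<in> NN"
  by (rule NN_image[where f = "opK i"])
     (auto simp: opK_embL opK_embR intro!: embL_NN embR_NN NN_closed diag_J)

lemma opKi_NN: "x \<in> NN \<Longrightarrow> opKi i x \<in> NN"
  by (rule NN_image[where f = "opKi i"])
     (auto simp: opKi_embL opKi_embR intro!: embL_NN embR_NN NN_closed diag_J)

lemma opF_opE: "opF i (opE k x) = opE k (opF i x) - (if k = i then opK k x - opKi k x else 0)"
  by (simp only: op_EF[symmetric]) simp

text \<open>With an element of \<open>J\<close> in the first place this rests on the derivations. In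
  the third place none are involved: once the \<open>E\<close>-word has been passed,
  \<open>F_i\<close> multiplies the element of \<open>J\<close> from the left.\<close>

lemma opF_NN: "x \<in> NN \<Longrightarrow> opF i x \<in> NN"
proof (rule NN_image[where f = "opF i"])
  fix u m j assume j: "j \<in> J"
  show "opF i (embR u m j) \<in> NN"
  proof (induction u)
    case Nil
    have "opF i (embR [] m j) = pscale (chi m (alpha i)) (embR [] m (letter i * j))"
      by (rule plinear_ext[where p = j]; (intro lin_intros)?) (simp add: opF_single letter_def)
    then show ?case using j by (auto intro!: embR_NN NN_closed J_lmult)
  next
    case (Cons k u)
    then show ?case
      using j by (auto simp: opE_embR[symmetric] opF_opE intro!: NN_closed opE_NN opK_NN opKi_NN embR_NN)
  qed
qed (auto simp: opF_embL intro!: NN_closed embL_NN dplus_J dminus_J)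

lemma op_NN: "x \<in> NN \<Longrightarrow> op g x \<in> NN"
  by (cases g) (auto intro: opE_NN opK_NN opKi_NN opF_NN)

lemma acts_NN: "x \<in> NN \<Longrightarrow> acts y x \<in> NN"
proof -
  assume x: "x \<in> NN"
  have "foldr op w x \<in> NN" for w
    by (induction w) (auto intro: op_NN x)
  then show "acts y x \<in> NN"
    unfolding act_def plin_def by (intro NN_closed) auto
qed

section \<open>The defining ideal acts as zero modulo \<open>NN\<close>\<close>

definition Ealg :: "('n, 'k) free_alg \<Rightarrow> ('n gen, 'k) free_alg" where
  "Ealg = alg_eval (\<lambda>i. letter (gE i))"
definition Falg :: "('n, 'k) free_alg \<Rightarrow> ('n gen, 'k) free_alg" where
  "Falg = alg_eval (\<lambda>i. letter (gF i))"

lemma plinear_EF_alg [simp, intro]: "plinear Ealg" "plinear Falg"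
  by (simp_all add: Ealg_def Falg_def)

lemma Ealg_single [simp]: "Ealg (Poly_Mapping.single w 1) = Poly_Mapping.single (map gE w) 1"
  and Falg_single [simp]: "Falg (Poly_Mapping.single w 1) = Poly_Mapping.single (map gF w) 1"
  by (simp_all add: Ealg_def Falg_def alg_eval_def prod_list_map_letter)

lemma plus_embed_eq: "plus_embed = Ealg"
  by (rule ext) (simp add: plus_embed_def Ealg_def nc_eval_type_ring)

lemma omega_Ealg: "omega (Ealg p) = Falg p"
proof -
  have *: "omega x = alg_eval (\<lambda>g. letter (omega_gen g)) x" for x :: "('n gen, 'k) free_alg"
    by (simp add: omega_def nc_eval_type_ring)
  show ?thesis
    unfolding *
    by (rule plinear_ext[where p = p])
       (rule plinear_comp[OF plinear_eval plinear_EF_alg(1)] plinear_EF_alg(2)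
         | simp add: alg_eval_word prod_list_map_letter o_def)+
qed

lemma acts_single_Cons: "acts (Poly_Mapping.single (g # w) 1) m = op g (acts (Poly_Mapping.single w 1) m)"
  by (simp add: act_def)

lemma acts_single_Nil [simp]: "acts (Poly_Mapping.single [] 1) m = m"
  by (simp add: act_def)

lemma acts_Ealg: "acts (Ealg j) (Poly_Mapping.single (u, m, v) 1) = embL m v (j * Poly_Mapping.single u 1)"
proof (rule plinear_ext[where p = j])
  fix w
  show "acts (Ealg (Poly_Mapping.single w 1)) (Poly_Mapping.single (u, m, v) 1)
      = embL m v (Poly_Mapping.single w 1 * Poly_Mapping.single u 1)"
    by (induction w) (simp_all add: acts_single_Cons)
qed (rule plinear_comp[OF plinear_act_left plinear_EF_alg(1)] plinear_comp[OF plinear_emb(1) plinear_mult_left])+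

lemma acts_Falg_Nil:
  "acts (Falg j) (Poly_Mapping.single ([], m, v) 1) = embR [] m (diag (chi m) j * Poly_Mapping.single v 1)"
proof (rule plinear_ext[where p = j])
  fix w
  show "acts (Falg (Poly_Mapping.single w 1)) (Poly_Mapping.single ([], m, v) 1)
      = embR [] m (diag (chi m) (Poly_Mapping.single w 1) * Poly_Mapping.single v 1)"
  proof (induction w)
    case (Cons i w)
    then show ?case
      using op_scale(4)[of i "chi m (weight w)" "Poly_Mapping.single ([], m, w @ v) 1"]
      by (simp add: acts_single_Cons opF_single chi_add_right mult.commute)
  qed simp
qed (rule plinear_comp[OF plinear_act_left plinear_EF_alg(2)]
      plinear_comp[OF plinear_emb(2) plinear_comp[OF plinear_mult_left plinear_diag]])+

lemma opK_Fword: "opK k (acts (Poly_Mapping.single (map gF w) 1) x)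
    = pscale (inverse (chi (alpha k) (weight w))) (acts (Poly_Mapping.single (map gF w) 1) (opK k x))"
  by (induction w) (simp_all add: acts_single_Cons op_KF op_scale q_def chi_add_right)

lemma opKi_Fword: "opKi k (acts (Poly_Mapping.single (map gF w) 1) x)
    = pscale (chi (alpha k) (weight w)) (acts (Poly_Mapping.single (map gF w) 1) (opKi k x))"
  by (induction w) (simp_all add: acts_single_Cons op_KiF op_scale q_def chi_add_right)

lemma acts_letter_mult: "acts (letter g * x) m = op g (acts x m)"
  by (simp add: acts_mult)

lemma Falg_letter_mult: "Falg (letter i * x) = letter (gF i) * Falg x"
  by (simp add: Falg_def alg_eval_mult)

text \<open>Counterpart of \<open>opF_embL\<close> for words in the \<open>F_j\<close>. The
  derivations change partners, \<open>dminus\<close> now going with \<open>K_k\<close>, since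
  \<open>K_k\<close> passes an \<open>F\<close>-word with the inverse scalars.\<close>

lemma opE_Falg: "opE k (acts (Falg j) x) - acts (Falg j) (opE k x)
    = acts (Falg (dminus k j)) (opK k x) - acts (Falg (dplus k j)) (opKi k x)"
proof (rule plinear_ext[where p = j])
  fix w
  show "opE k (acts (Falg (Poly_Mapping.single w 1)) x) - acts (Falg (Poly_Mapping.single w 1)) (opE k x)
    = acts (Falg (dminus k (Poly_Mapping.single w 1))) (opK k x)
      - acts (Falg (dplus k (Poly_Mapping.single w 1))) (opKi k x)"
  proof (induction w)
    case Nil
    then show ?case
      by (simp add: dminus_word_def dplus_word_def plinear_0[OF plinear_EF_alg(2)] plinear_0[OF plinear_act_left])
  next
    case (Cons i w)
    let ?f = "acts (Poly_Mapping.single (map gF w) 1)"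
    have sc: "acts (Falg (Poly_Mapping.single w c)) y = pscale c (?f y)" for c y
      using plinear_scale[OF plinear_EF_alg(2), of c "Poly_Mapping.single w 1"]
        acts_scale[of c "Poly_Mapping.single (map gF w) 1" y] by simp
    have "opE k (opF i (?f x)) - opF i (?f (opE k x))
        = (opE k (opF i (?f x)) - opF i (opE k (?f x))) + opF i (opE k (?f x) - ?f (opE k x))"
      by (simp add: op_diff)
    also have "opE k (?f x) - ?f (opE k x) = acts (Falg (dminus_word k w)) (opK k x)
      - acts (Falg (dplus_word k w)) (opKi k x)"
      using Cons by simp
    also have "opE k (opF i (?f x)) - opF i (opE k (?f x)) = (if k = i then
        pscale (inverse (chi (alpha k) (weight w))) (?f (opK k x))
        - pscale (chi (alpha k) (weight w)) (?f (opKi k x)) else 0)"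
      by (simp add: op_EF opK_Fword opKi_Fword)
    finally show ?case
      by (cases "k = i") (simp_all add: acts_single_Cons dminus_word_def dplus_word_def sc acts_add
          plinear_add[OF plinear_EF_alg(2)] Falg_letter_mult acts_letter_mult op_diff)
  qed
qed (intro plinear_diffI plinear_comp[OF plinear_act_left plinear_EF_alg(2)]
     plinear_ops[THEN plinear_comp] plinear_comp[OF plinear_act_left
       plinear_comp[OF plinear_EF_alg(2) plinear_dplus]]
     plinear_comp[OF plinear_act_left plinear_comp[OF plinear_EF_alg(2) plinear_dminus]])+

lemma acts_Falg_J: "j \<in> J \<Longrightarrow> acts (Falg j) x \<in> NN"
proof -
  have *: "acts (Falg j) (Poly_Mapping.single (u, m, v) 1) \<in> NN" if "j \<in> J" for u m v j
    using that
  \<comment> \<open>Moving one \<open>E_k\<close> out to the front replaces \<open>j\<close> by its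
    derivatives and shifts \<open>m\<close> by \<open>alpha k\<close> in either direction, so both
    have to vary.\<close>
  proof (induction u arbitrary: m j)
    case Nil
    then show ?case by (simp add: acts_Falg_Nil embR_NN J_rmult diag_J)
  next
    case (Cons k u)
    let ?s = "Poly_Mapping.single (u, m, v) 1 :: ('n, 'k) pbw"
    have "acts (Falg j) (opE k ?s) = opE k (acts (Falg j) ?s)
        - (acts (Falg (dminus k j)) (opK k ?s) - acts (Falg (dplus k j)) (opKi k ?s))"
      by (simp only: opE_Falg[symmetric]) simp
    moreover have "acts (Falg (dminus k j)) (opK k ?s) = pscale (chi (alpha k) (weight u))
        (acts (Falg (dminus k j)) (Poly_Mapping.single (u, m + alpha k, v) 1))"
      by (subst plinear_scale[OF plinear_acts, symmetric]) simp
    moreover have "acts (Falg (dplus k j)) (opKi k ?s) = pscale (inverse (chi (alpha k) (weight u)))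
        (acts (Falg (dplus k j)) (Poly_Mapping.single (u, m - alpha k, v) 1))"
      by (subst plinear_scale[OF plinear_acts, symmetric]) simp
    ultimately show ?case
      using Cons by (simp del: op_single(2,3)) (intro NN_closed opE_NN Cons.IH dplus_J dminus_J)
  qed
  assume "j \<in> J"
  have "acts (Falg j) x = plin (\<lambda>a. acts (Falg j) (Poly_Mapping.single a 1)) x"
    by (rule plinear_eq_plin) simp
  then show ?thesis
    using *[OF \<open>j \<in> J\<close>] unfolding plin_def by (auto intro!: NN_closed split: prod.splits)
qed

lemma acts_Ealg_J: "j \<in> J \<Longrightarrow> acts (Ealg j) x \<in> NN"
proof -
  assume "j \<in> J"
  have "acts (Ealg j) x = plin (\<lambda>a. acts (Ealg j) (Poly_Mapping.single a 1)) x"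
    by (rule plinear_eq_plin) simp
  then show ?thesis
    unfolding plin_def
    by (auto intro!: NN_closed embL_NN J_rmult \<open>j \<in> J\<close> simp: acts_Ealg split: prod.splits)
qed

text \<open>The elements that map everything into \<open>NN\<close> absorb right factors trivially
  and left factors because \<open>NN\<close> is stable, so it suffices to test the generators of the
  ideal.\<close>

lemma acts_II:
  assumes "x \<in> II"
  shows "acts x m \<in> NN"
proof -
  have "II \<subseteq> {x. \<forall>m. acts x m \<in> NN}"
  proof (rule II_minimal)
    show "pm.subspace {x. \<forall>m. acts x m \<in> NN}"
      by (rule pm.subspaceI)
         (auto simp: acts_add acts_scale plinear_0[OF plinear_act_left] intro: NN_closed)
    show "relations chi \<union> plus_embed ` J \<union> omega ` plus_embed ` J \<subseteq> {x. \<forall>m. acts x m \<in> NN}"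
      by (auto simp: acts_relations plus_embed_eq omega_Ealg acts_Ealg_J acts_Falg_J intro: NN_closed)
  qed (auto simp: acts_mult acts_NN)
  then show ?thesis using assms by auto
qed

text \<open>\<open>J\<close> is homogeneous, hence \<open>NN\<close> is graded.\<close>

lemma restr_NN:
  assumes "x \<in> NN"
  shows "restr (\<lambda>(u, m, v). R (weight u) m (weight v)) x \<in> NN"
proof (rule NN_image[where f = "restr (\<lambda>(u, m, v). R (weight u) m (weight v))"])
  fix m v j assume j: "j \<in> J"
  have "restr (\<lambda>(u, m, v). R (weight u) m (weight v)) (embL m v j)
      = embL m v (diag (\<lambda>a. if R a m (weight v) then 1 else 0) j)"
    by (rule plinear_ext[where p = j])
       (auto intro: plinear_comp[OF plinear_restr plinear_emb(1)] plinear_comp[OF plinear_emb(1) plinear_diag])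
  then show "restr (\<lambda>(u, m, v). R (weight u) m (weight v)) (embL m v j) \<in> NN"
    using embL_NN[OF diag_J[OF j]] by metis
next
  fix u m j assume j: "j \<in> J"
  have "restr (\<lambda>(u, m, v). R (weight u) m (weight v)) (embR u m j)
      = embR u m (diag (\<lambda>a. if R (weight u) m a then 1 else 0) j)"
    by (rule plinear_ext[where p = j])
       (auto intro: plinear_comp[OF plinear_restr plinear_emb(2)] plinear_comp[OF plinear_emb(2) plinear_diag])
  then show "restr (\<lambda>(u, m, v). R (weight u) m (weight v)) (embR u m j) \<in> NN"
    using embR_NN[OF diag_J[OF j]] by metis
qed (use assms in auto)

text \<open>On a generator of \<open>NN\<close> this coordinate is either zero or the coefficient of
  the empty word in an element of \<open>J\<close>.\<close>

lemma lookup_NN: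
  assumes "x \<in> NN"
  shows "Poly_Mapping.lookup x ([], m, []) = 0"
proof -
  \<comment> \<open>The coordinate is wrapped as a vector of a one-dimensional space so that the
    lemmas on linear maps apply to it.\<close>
  let ?f = "\<lambda>x. Poly_Mapping.single () (Poly_Mapping.lookup x ([], m, []))"
  have lin: "plinear ?f"
    by (rule plinearI) (simp_all add: lookup_add single_add)
  have lookup: "Poly_Mapping.lookup (plin g j) a = (\<Sum>w\<in>Poly_Mapping.keys j. Poly_Mapping.lookup j w * Poly_Mapping.lookup (g w) a)"
    for g :: "'n list \<Rightarrow> ('n, 'k) pbw" and j a
    by (simp add: plin_def lookup_sum)
  have "Poly_Mapping.lookup (embL m' v j) ([], m, []) = 0" if "j \<in> J" for m' v j
    unfolding embL_def lookup
    by (rule sum.neutral) (use lookup_J_short[OF that, of "[]"] in \<open>auto simp: lookup_single when_def\<close>)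
  moreover have "Poly_Mapping.lookup (embR u m' j) ([], m, []) = 0" if "j \<in> J" for m' u j
    unfolding embR_def lookup
    by (rule sum.neutral) (use lookup_J_short[OF that, of "[]"] in \<open>auto simp: lookup_single when_def\<close>)
  ultimately have "?f x \<in> pm.span {}"
    by (intro plinear_image_span[OF lin assms[unfolded NN_def]]) auto
  then show ?thesis by simp (metis lookup_single_eq lookup_zero)
qed

end

section \<open>Normal ordering\<close>

definition K_factor :: "'n::finite lat \<Rightarrow> 'n \<Rightarrow> ('n gen, 'k::field) free_alg" where
  "K_factor m i = (if 0 \<le> m $ i then letter (gK i) ^ nat (m $ i) else letter (gKi i) ^ nat (- (m $ i)))"

definition Kw :: "'n::{finite,linorder} lat \<Rightarrow> ('n gen, 'k::field) free_alg" where
  "Kw m = prod_list (map (K_factor m) (sorted_list_of_set UNIV))"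

context pre_nichols
begin

lemma U_K_cl: "U_K chi J m = cl (Kw m)"
  by (simp add: U_K_def Kw_def K_factor_def[abs_def])

text \<open>Equality in \<open>U\<close>, phrased for representatives so that calculations can be
  chained without passing to cosets.\<close>

definition eqv :: "('n gen, 'k) free_alg \<Rightarrow> ('n gen, 'k) free_alg \<Rightarrow> bool" (infix "\<approx>" 50) where
  "x \<approx> y \<longleftrightarrow> x - y \<in> II"

lemma eqv_cl: "x \<approx> y \<longleftrightarrow> cl x = cl y"
  by (simp add: eqv_def cl_eq_iff)

lemma eqv_refl [simp]: "x \<approx> x"
  and eqv_sym: "x \<approx> y \<Longrightarrow> y \<approx> x"
  and eqv_trans [trans]: "x \<approx> y \<Longrightarrow> y \<approx> z \<Longrightarrow> x \<approx> z"
  by (simp_all add: eqv_cl)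

lemma eqv_mult: "x \<approx> x' \<Longrightarrow> y \<approx> y' \<Longrightarrow> x * y \<approx> x' * y'"
  unfolding eqv_cl by (metis mult_cl)

lemma eqv_add: "x \<approx> x' \<Longrightarrow> y \<approx> y' \<Longrightarrow> x + y \<approx> x' + y'"
  unfolding eqv_cl by (metis add_cl)

lemma eqv_scale: "x \<approx> x' \<Longrightarrow> pscale c x \<approx> pscale c x'"
  unfolding eqv_cl by (metis sc_mult)

lemma eqv_diff: "x \<approx> x' \<Longrightarrow> y \<approx> y' \<Longrightarrow> x - y \<approx> x' - y'"
  unfolding eqv_def using II_diff[of "x - x'" "y - y'"] by (simp add: algebra_simps)

lemma eqv_rel: "x - y \<in> relations chi \<Longrightarrow> x \<approx> y"
  unfolding eqv_def by (rule II_gen) simp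

abbreviation kK where "kK i \<equiv> letter (gK i) :: ('n gen, 'k) free_alg"
abbreviation kKi where "kKi i \<equiv> letter (gKi i) :: ('n gen, 'k) free_alg"
abbreviation kE where "kE i \<equiv> letter (gE i) :: ('n gen, 'k) free_alg"
abbreviation kF where "kF i \<equiv> letter (gF i) :: ('n gen, 'k) free_alg"

lemma rel_KKi: "kK i * kKi i \<approx> 1" and rel_KiK: "kKi i * kK i \<approx> 1"
  and rel_KK: "kK i * kK j \<approx> kK j * kK i"
  by (rule eqv_rel, unfold relations_def, blast)+

lemma rel_KE: "kK i * kE j \<approx> pscale (q chi i j) (kE j * kK i)"
  and rel_KF: "kK i * kF j \<approx> pscale (inverse (q chi i j)) (kF j * kK i)"
  by (rule eqv_rel, unfold relations_def const_mult[symmetric] mult.assoc[symmetric], blast)+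

lemma rel_FE: "kF j * kE i \<approx> kE i * kF j - (if i = j then kK i - kKi i else 0)"
proof -
  have "kE i * kF j - kF j * kE i - (if i = j then kK i - kKi i else 0) \<in> II"
    by (rule II_gen) (unfold relations_def, blast)
  from II_neg[OF this] show ?thesis
    unfolding eqv_def by (simp only: minus_diff_eq diff_diff_eq2 algebra_simps)
qed

text \<open>The commutation relations with \<open>E_j\<close> and \<open>F_j\<close> are imposed for
  \<open>K_i\<close> only; multiplying by \<open>K_i^-1\<close> on both sides turns them into
  relations for the inverse.\<close>

lemma Ki_commute:
  assumes "kK i * x \<approx> pscale c (x * kK i)" "c \<noteq> 0"
  shows "kKi i * x \<approx> pscale (inverse c) (x * kKi i)"
proof -
  have "x * kKi i \<approx> (kKi i * kK i) * (x * kKi i)"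
    using eqv_mult[OF eqv_sym[OF rel_KiK] eqv_refl[of "x * kKi i"]] by simp
  also have "(kKi i * kK i) * (x * kKi i) = kKi i * (kK i * x) * kKi i" by (simp add: mult.assoc)
  also have "\<dots> \<approx> kKi i * pscale c (x * kK i) * kKi i"
    by (intro eqv_mult assms eqv_refl)
  also have "\<dots> = pscale c (kKi i * x * (kK i * kKi i))"
    by (simp add: pscale_mult_left pscale_mult_right mult.assoc)
  also have "\<dots> \<approx> pscale c (kKi i * x * 1)"
    by (intro eqv_scale eqv_mult eqv_refl rel_KKi)
  finally have "x * kKi i \<approx> pscale c (kKi i * x)" by simp
  from eqv_sym[OF eqv_scale[OF this, of "inverse c"]] show ?thesis using assms(2) by simp
qed

lemma rel_KiF: "kKi i * kF j \<approx> pscale (q chi i j) (kF j * kKi i)"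
  using Ki_commute[OF rel_KF[of i j]] by (simp add: q_def)

lemma rel_KiK_comm: "kKi i * kK j \<approx> kK j * kKi i"
  using Ki_commute[of i "kK j" 1] rel_KK[of i j] by simp

lemma K_power_comm: "kK i * x \<approx> x * kK i \<Longrightarrow> kK i * x ^ n \<approx> x ^ n * kK i"
proof (induction n)
  case (Suc n)
  have "kK i * x ^ Suc n = (kK i * x) * x ^ n" by (simp add: mult.assoc)
  also have "\<dots> \<approx> (x * kK i) * x ^ n" by (intro eqv_mult Suc.prems eqv_refl)
  also have "\<dots> = x * (kK i * x ^ n)" by (simp add: mult.assoc)
  also have "\<dots> \<approx> x * (x ^ n * kK i)" by (intro eqv_mult Suc eqv_refl)
  finally show ?case by (simp add: mult.assoc)
qed simp

lemma K_factor_comm: "kK i * K_factor m j \<approx> K_factor m j * kK i"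
  unfolding K_factor_def
  by (auto intro!: K_power_comm rel_KK eqv_sym[OF rel_KiK_comm])

lemma alpha_nth: "alpha i $ j = (if j = i then 1 else 0)"
  by (simp add: alpha_def axis_def)

lemma K_factor_add: "K_factor (m + alpha i) i \<approx> kK i * K_factor m i"
proof (cases "0 \<le> m $ i")
  case True
  then show ?thesis by (simp add: K_factor_def alpha_nth nat_add_distrib)
next
  case False
  define n where "n = nat (- (m $ i)) - 1"
  have n: "nat (- (m $ i)) = Suc n" "nat (- (m $ i) - 1) = n" "m $ i = - int n - 1"
    using False by (auto simp: n_def)
  \<comment> \<open>For \<open>n = 0\<close> the new exponent is zero and \<open>K_factor\<close>
    switches to its nonnegative branch, a zeroth power of the other letter; hence the case
    split.\<close>
  have 1: "K_factor (m + alpha i) i = kKi i ^ n"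
    by (cases n) (auto simp: K_factor_def alpha_nth n(3) nat_add_distrib)
  have 2: "K_factor m i = kKi i * kKi i ^ n"
    using False n(1) by (simp add: K_factor_def)
  have "1 * kKi i ^ n \<approx> (kK i * kKi i) * kKi i ^ n"
    by (intro eqv_mult eqv_sym[OF rel_KKi] eqv_refl)
  then show ?thesis unfolding 1 2 by (simp add: mult.assoc)
qed

text \<open>The new factor has to reach the slot of \<open>i\<close> in the ordered product,
  commuting with the factors before it. The induction runs over an arbitrary distinct list, in which
  \<open>i\<close> may be absent.\<close>

lemma Kw_add_alpha: "kK i * Kw m \<approx> Kw (m + alpha i)"
proof -
  have "prod_list (map (K_factor (m + alpha i)) xs)
      \<approx> (if i \<in> set xs then kK i else 1) * prod_list (map (K_factor m) xs)" if "distinct xs" for xs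
    using that
  proof (induction xs)
    case (Cons j xs)
    show ?case
    proof (cases "j = i")
      case True
      then have "K_factor (m + alpha i) j * prod_list (map (K_factor (m + alpha i)) xs)
          \<approx> (kK i * K_factor m i) * (1 * prod_list (map (K_factor m) xs))"
        using Cons K_factor_add[of m i] by (intro eqv_mult) auto
      then show ?thesis using True by (simp add: mult.assoc)
    next
      case False
      then have e: "K_factor (m + alpha i) j = K_factor m j" by (simp add: K_factor_def alpha_nth)
      have "K_factor (m + alpha i) j * prod_list (map (K_factor (m + alpha i)) xs)
          \<approx> K_factor m j * ((if i \<in> set xs then kK i else 1) * prod_list (map (K_factor m) xs))"
        unfolding e using Cons by (intro eqv_mult) auto
      also have "\<dots> \<approx> (if i \<in> set xs then kK i else 1) * (K_factor m j * prod_list (map (K_factor m) xs))"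
        using eqv_mult[OF eqv_sym[OF K_factor_comm[of i m j]] eqv_refl, of "prod_list (map (K_factor m) xs)"]
        by (auto simp: mult.assoc)
      finally show ?thesis using False by simp
    qed
  qed simp
  from eqv_sym[OF this, of "sorted_list_of_set UNIV"] show ?thesis
    unfolding Kw_def by simp
qed

lemma Kw_diff_alpha: "kKi i * Kw m \<approx> Kw (m - alpha i)"
proof -
  have "Kw m \<approx> kK i * Kw (m - alpha i)"
    using eqv_sym[OF Kw_add_alpha[of i "m - alpha i"]] by simp
  then have "kKi i * Kw m \<approx> (kKi i * kK i) * Kw (m - alpha i)"
    using eqv_mult[OF eqv_refl[of "kKi i"]] by (simp add: mult.assoc)
  also have "\<dots> \<approx> 1 * Kw (m - alpha i)"
    by (intro eqv_mult rel_KiK eqv_refl)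
  finally show ?thesis by simp
qed

lemma Kw_0: "Kw (0 :: 'n lat) = (1 :: ('n gen, 'k) free_alg)"
proof -
  have "prod_list (map (K_factor (0 :: 'n lat)) xs) = (1 :: ('n gen, 'k) free_alg)" for xs :: "'n list"
    by (induction xs) (auto simp: K_factor_def)
  then show ?thesis by (simp add: Kw_def)
qed

text \<open>Serves for the commutation with \<open>F_i\<close> and for the action of
  \<open>Kw m\<close>: both are multiplicative in the element and additive in its exponent, so only
  the letters need checking.\<close>

lemma Kw_induct:
  assumes one: "Q 1 0" and mult: "\<And>x y a b. Q x a \<Longrightarrow> Q y b \<Longrightarrow> Q (x * y) (a + b)"
    and K: "\<And>i. Q (kK i) (alpha i)" and Ki: "\<And>i. Q (kKi i) (- alpha i)"
  shows "Q (Kw m) m"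
proof -
  have pow: "Q (x ^ n) (of_nat n *s a)" if "Q x a" for x a n
  proof (induction n)
    case (Suc n)
    have "of_nat (Suc n) *s a = a + of_nat n *s a"
      by (simp add: vec_eq_iff algebra_simps)
    then show ?case using mult[OF that Suc] by simp
  qed (simp add: one)
  have fac: "Q (K_factor m i) ((m $ i) *s alpha i)" for i
  proof (cases "0 \<le> m $ i")
    case True
    then show ?thesis using pow[OF K[of i], of "nat (m $ i)"] by (simp add: K_factor_def)
  next
    case False
    then have "of_nat (nat (- (m $ i))) *s (- alpha i) = (m $ i) *s alpha i"
      by (simp add: vec_eq_iff)
    with pow[OF Ki[of i], of "nat (- (m $ i))"] False show ?thesis by (simp add: K_factor_def del: vector_smult_rneg)
  qed
  have "Q (prod_list (map (K_factor m) xs)) (sum_list (map (\<lambda>i. (m $ i) *s alpha i) xs))" for xs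
    by (induction xs) (auto intro: one mult fac)
  from this[of "sorted_list_of_set UNIV"]
  have "Q (Kw m) (\<Sum>i\<in>UNIV. (m $ i) *s alpha i)"
    by (simp add: Kw_def sum_list_distinct_conv_sum_set)
  moreover have "(\<Sum>i\<in>UNIV. (m $ i) *s alpha i) = m"
    by (simp add: vec_eq_iff alpha_nth sum_component if_distrib cong: if_cong)
  ultimately show ?thesis by simp
qed

lemma F_Kw: "kF i * Kw m \<approx> pscale (chi m (alpha i)) (Kw m * kF i)"
proof (rule Kw_induct[where Q = "\<lambda>x m. kF i * x \<approx> pscale (chi m (alpha i)) (x * kF i)"])
  fix x y a b
  assume x: "kF i * x \<approx> pscale (chi a (alpha i)) (x * kF i)"
    and y: "kF i * y \<approx> pscale (chi b (alpha i)) (y * kF i)"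
  have "(kF i * x) * y \<approx> pscale (chi a (alpha i)) (x * kF i) * y"
    by (intro eqv_mult x eqv_refl)
  also have "\<dots> = pscale (chi a (alpha i)) (x * (kF i * y))"
    by (simp add: pscale_mult_left mult.assoc)
  also have "\<dots> \<approx> pscale (chi a (alpha i)) (x * pscale (chi b (alpha i)) (y * kF i))"
    by (intro eqv_scale eqv_mult y eqv_refl)
  finally show "kF i * (x * y) \<approx> pscale (chi (a + b) (alpha i)) (x * y * kF i)"
    by (simp add: mult.assoc chi_add_left pscale_mult_right)
next
  fix j
  show "kF i * kK j \<approx> pscale (chi (alpha j) (alpha i)) (kK j * kF i)"
    using eqv_scale[OF eqv_sym[OF rel_KF[of j i]], of "q chi j i"] by (simp add: q_def)
  show "kF i * kKi j \<approx> pscale (chi (- alpha j) (alpha i)) (kKi j * kF i)"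
    using eqv_scale[OF eqv_sym[OF rel_KiF[of j i]], of "inverse (q chi j i)"] by (simp add: q_def chi_neg_left)
qed simp

lemma acts_Kw: "acts (Kw m) (Poly_Mapping.single (u, m', v) c)
    = Poly_Mapping.single (u, m + m', v) (c * chi m (weight u))"
proof -
  have "\<forall>m' c. acts (Kw m) (Poly_Mapping.single (u, m', v) c)
    = Poly_Mapping.single (u, m + m', v) (c * chi m (weight u))"
    by (rule Kw_induct[where Q = "\<lambda>x m. \<forall>m' c. acts x (Poly_Mapping.single (u, m', v) c)
        = Poly_Mapping.single (u, m + m', v) (c * chi m (weight u))"])
       (auto simp: acts_mult chi_add_left chi_neg_left algebra_simps)
  then show ?thesis by blast
qed

definition Ew :: "'n list \<Rightarrow> ('n gen, 'k) free_alg" where "Ew u = Poly_Mapping.single (map gE u) 1"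
definition Fw :: "'n list \<Rightarrow> ('n gen, 'k) free_alg" where "Fw u = Poly_Mapping.single (map gF u) 1"

lemma Ew_simps [simp]: "Ew [] = 1" "Ew (i # u) = kE i * Ew u"
  and Fw_simps [simp]: "Fw [] = 1" "Fw (i # u) = kF i * Fw u"
  by (simp_all add: Ew_def Fw_def letter_def one_free_alg)

lemma prod_list_kE: "prod_list (map kE u) = Ew u" and prod_list_kF: "prod_list (map kF u) = Fw u"
  by (induction u) auto

section \<open>Symbols and normal forms as inverse descriptions of the quotient\<close>

definition Psi :: "('n, 'k) pbw \<Rightarrow> ('n gen, 'k) free_alg" where
  "Psi = plin (\<lambda>(u, m, v). Ew u * Kw m * Fw v)"

lemma plinear_Psi [simp, intro]: "plinear Psi"
  by (simp add: Psi_def)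

lemma Psi_single [simp]: "Psi (Poly_Mapping.single (u, m, v) c) = pscale c (Ew u * Kw m * Fw v)"
  by (simp add: Psi_def)

lemma K_Ew: "kK i * Ew u \<approx> pscale (chi (alpha i) (weight u)) (Ew u * kK i)"
proof (induction u)
  case (Cons j u)
  have "(kK i * kE j) * Ew u \<approx> pscale (q chi i j) (kE j * kK i) * Ew u"
    by (intro eqv_mult rel_KE eqv_refl)
  also have "\<dots> = pscale (q chi i j) (kE j * (kK i * Ew u))" by (simp add: pscale_mult_left mult.assoc)
  also have "\<dots> \<approx> pscale (q chi i j) (kE j * pscale (chi (alpha i) (weight u)) (Ew u * kK i))"
    by (intro eqv_scale eqv_mult Cons eqv_refl)
  finally show ?case by (simp add: pscale_mult_right mult.assoc chi_add_right q_def)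
qed simp

lemma Psi_opE: "kE i * Psi x = Psi (opE i x)"
  by (rule pbw_ext[where x = x]; (intro plinear_comp[OF plinear_mult_right plinear_Psi]
      plinear_comp[OF plinear_Psi plinear_ops(1)])?) (simp add: mult.assoc)

lemma eqv_plinear:
  fixes f g :: "('n, 'k) pbw \<Rightarrow> _"
  assumes "plinear f" "plinear g"
    and "\<And>u m v. f (Poly_Mapping.single (u, m, v) 1) \<approx> g (Poly_Mapping.single (u, m, v) 1)"
  shows "f x \<approx> g x"
  unfolding eqv_def
  by (rule plinear_in_subspace[OF plinear_diffI[OF assms(1,2)] II_subspace])
     (use assms(3) in \<open>auto simp: eqv_def split: prod.splits\<close>)

lemma Psi_opK: "kK i * Psi x \<approx> Psi (opK i x)"
proof (rule eqv_plinear[where x = x])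
  fix u m v
  have "(kK i * Ew u) * Kw m * Fw v \<approx> pscale (chi (alpha i) (weight u)) (Ew u * kK i) * Kw m * Fw v"
    by (intro eqv_mult K_Ew eqv_refl)
  also have "\<dots> = pscale (chi (alpha i) (weight u)) (Ew u * (kK i * Kw m) * Fw v)"
    by (simp add: pscale_mult_left mult.assoc)
  also have "\<dots> \<approx> pscale (chi (alpha i) (weight u)) (Ew u * Kw (m + alpha i) * Fw v)"
    by (intro eqv_scale eqv_mult Kw_add_alpha eqv_refl)
  finally show "kK i * Psi (Poly_Mapping.single (u, m, v) 1) \<approx> Psi (opK i (Poly_Mapping.single (u, m, v) 1))"
    by (simp add: mult.assoc)
qed (rule plinear_comp[OF plinear_mult_right plinear_Psi] plinear_comp[OF plinear_Psi plinear_ops(2)])+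

lemma Psi_opKi: "kKi i * Psi x \<approx> Psi (opKi i x)"
proof (rule eqv_plinear[where x = x])
  fix u m v
  have "(kKi i * Ew u) * Kw m * Fw v
      \<approx> pscale (inverse (chi (alpha i) (weight u))) (Ew u * kKi i) * Kw m * Fw v"
    by (intro eqv_mult Ki_commute[OF K_Ew] eqv_refl) simp
  also have "\<dots> = pscale (inverse (chi (alpha i) (weight u))) (Ew u * (kKi i * Kw m) * Fw v)"
    by (simp add: pscale_mult_left mult.assoc)
  also have "\<dots> \<approx> pscale (inverse (chi (alpha i) (weight u))) (Ew u * Kw (m - alpha i) * Fw v)"
    by (intro eqv_scale eqv_mult Kw_diff_alpha eqv_refl)
  finally show "kKi i * Psi (Poly_Mapping.single (u, m, v) 1) \<approx> Psi (opKi i (Poly_Mapping.single (u, m, v) 1))"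
    by (simp add: mult.assoc)
qed (rule plinear_comp[OF plinear_mult_right plinear_Psi] plinear_comp[OF plinear_Psi plinear_ops(3)])+

lemma Psi_opF: "kF i * Psi x \<approx> Psi (opF i x)"
proof (rule eqv_plinear[where x = x])
  fix u m v
  show "kF i * Psi (Poly_Mapping.single (u, m, v) 1) \<approx> Psi (opF i (Poly_Mapping.single (u, m, v) 1))"
  proof (induction u)
    case Nil
    have "(kF i * Kw m) * Fw v \<approx> pscale (chi m (alpha i)) (Kw m * kF i) * Fw v"
      by (intro eqv_mult F_Kw eqv_refl)
    then show ?case by (simp add: opF_single mult.assoc pscale_mult_left)
  next
    case (Cons k u)
    let ?s = "Poly_Mapping.single (u, m, v) 1 :: ('n, 'k) pbw"
    have "(kF i * kE k) * Psi ?s \<approx> (kE k * kF i - (if k = i then kK k - kKi k else 0)) * Psi ?s"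
      by (intro eqv_mult rel_FE eqv_refl)
    also have "\<dots> = kE k * (kF i * Psi ?s) - (if k = i then kK k * Psi ?s - kKi k * Psi ?s else 0)"
      by (simp add: left_diff_distrib mult.assoc)
    also have "\<dots> \<approx> kE k * Psi (opF i ?s) - (if k = i then Psi (opK k ?s) - Psi (opKi k ?s) else 0)"
      using Psi_opK[of k ?s] Psi_opKi[of k ?s]
      by (intro eqv_diff eqv_mult Cons eqv_refl) (auto intro: eqv_diff simp del: Psi_single op_single)
    also have "\<dots> = Psi (opF i (opE k ?s))"
      by (simp add: opF_opE Psi_opE plinear_diff[OF plinear_Psi] plinear_0[OF plinear_Psi]
          del: Psi_single op_single)
    finally show ?case by (simp add: mult.assoc)
  qed
qed (rule plinear_comp[OF plinear_mult_right plinear_Psi] plinear_comp[OF plinear_Psi plinear_ops(4)])+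

lemma Psi_op: "letter g * Psi x \<approx> Psi (op g x)"
  by (cases g) (auto simp: Psi_opE Psi_opK Psi_opKi Psi_opF)

lemma Psi_acts: "x * Psi y \<approx> Psi (acts x y)"
proof -
  have w: "Poly_Mapping.single w 1 * Psi y \<approx> Psi (acts (Poly_Mapping.single w 1) y)" for w
  proof (induction w)
    case (Cons g w)
    have "Poly_Mapping.single (g # w) 1 * Psi y = letter g * (Poly_Mapping.single w 1 * Psi y)"
      by (simp add: letter_def mult.assoc[symmetric])
    also have "\<dots> \<approx> letter g * Psi (acts (Poly_Mapping.single w 1) y)"
      by (intro eqv_mult Cons eqv_refl)
    also have "\<dots> \<approx> Psi (op g (acts (Poly_Mapping.single w 1) y))" by (rule Psi_op)
    finally show ?case by (simp add: acts_single_Cons)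
  qed (simp add: one_free_alg[symmetric])
  have "x * Psi y - Psi (acts x y) \<in> II"
    by (rule plinear_in_subspace[where p = x and f = "\<lambda>x. x * Psi y - Psi (acts x y)", OF _ II_subspace])
       (auto intro!: plinear_diffI plinear_mult_left plinear_comp[OF plinear_Psi plinear_act_left]
         simp: w[unfolded eqv_def])
  then show ?thesis by (simp add: eqv_def)
qed

definition vac :: "('n, 'k) pbw" where "vac = Poly_Mapping.single ([], 0, []) 1"

definition nf :: "('n gen, 'k) free_alg \<Rightarrow> ('n, 'k) pbw" where "nf x = acts x vac"

lemma plinear_nf [simp, intro]: "plinear nf"
  unfolding nf_def by (rule plinear_act_left)

lemmas nf_add = plinear_add[OF plinear_nf] and nf_diff = plinear_diff[OF plinear_nf]
  and nf_scale = plinear_scale[OF plinear_nf] and nf_sum = plinear_sum[OF plinear_nf]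

lemma nf_mult: "nf (x * y) = acts x (nf y)"
  by (simp add: nf_def acts_mult)

lemma Psi_nf: "x \<approx> Psi (nf x)"
  using Psi_acts[of x vac] by (simp add: nf_def vac_def Kw_0)

lemma acts_Fw: "acts (Fw v) (Poly_Mapping.single ([], m, v') 1)
    = Poly_Mapping.single ([], m, v @ v') (chi m (weight v))"
  using acts_Falg_Nil[of "Poly_Mapping.single v 1" m v'] by (simp add: Fw_def)

lemma acts_Ew: "acts (Ew u) (Poly_Mapping.single (u', m, v) 1) = Poly_Mapping.single (u @ u', m, v) 1"
  using acts_Ealg[of "Poly_Mapping.single u 1" u' m v] by (simp add: Ew_def)

lemma nf_basis: "nf (Ew u * Kw m * Fw v) = Poly_Mapping.single (u, m, v) 1"
  by (simp add: nf_def vac_def acts_mult acts_Fw acts_Kw acts_Ew)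

lemma nf_Psi: "nf (Psi x) = x"
  by (rule pbw_ext[where x = x]; (intro plinear_comp[OF plinear_nf plinear_Psi] plinear_id)?)
     (simp add: nf_basis)

text \<open>Allows identities in \<open>U\<close> to be proved by computation: both sides are
  applied to the vacuum vector and the resulting symbols compared.\<close>

lemma nf_eq_imp: "nf x = nf y \<Longrightarrow> x \<approx> y"
  using Psi_nf[of x] Psi_nf[of y] by (metis eqv_sym eqv_trans)

lemma Psi_NN: "x \<in> NN \<Longrightarrow> Psi x \<in> II"
proof -
  assume "x \<in> NN"
  have E: "Ealg j \<in> II" and F: "Falg j \<in> II" if "j \<in> J" for j
    using that II_gen[of "Ealg j"] II_gen[of "Falg j"]
    by (auto simp: plus_embed_eq omega_Ealg[symmetric])
  have L: "Psi (embL m v j) = Ealg j * Kw m * Fw v" for m v j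
    by (rule plinear_ext[where p = j])
       ((rule plinear_comp[OF plinear_Psi plinear_emb(1)] plinear_comp[OF plinear_mult_left
          plinear_comp[OF plinear_mult_left plinear_EF_alg(1)]])+, simp add: Ew_def)
  have R: "Psi (embR u m j) = Ew u * Kw m * Falg j" for m u j
    by (rule plinear_ext[where p = j])
       ((rule plinear_comp[OF plinear_Psi plinear_emb(2)] plinear_comp[OF plinear_mult_right
          plinear_EF_alg(2)])+, simp add: Fw_def)
  have "Psi x \<in> pm.span II"
    by (rule plinear_image_span[OF plinear_Psi \<open>x \<in> NN\<close>[unfolded NN_def]])
       (auto simp: L R intro!: pm.span_base II_rmult[OF II_rmult[OF E]] II_lmult[OF F])
  then show ?thesis using pm.span_eq_iff[THEN iffD2, OF II_subspace] by simp
qed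

text \<open>The triangular decomposition in disguise: \<open>nf\<close> and \<open>Psi\<close>
  induce mutually inverse maps between the free algebra modulo \<open>II\<close> and the symbol
  space modulo \<open>NN\<close>.\<close>

lemma II_iff_nf: "x \<in> II \<longleftrightarrow> nf x \<in> NN"
proof
  show "x \<in> II \<Longrightarrow> nf x \<in> NN" by (simp add: nf_def acts_II)
  assume "nf x \<in> NN"
  then have "Psi (nf x) \<in> II" by (rule Psi_NN)
  then show "x \<in> II" using Psi_nf[of x] II_add[of "x - Psi (nf x)" "Psi (nf x)"] by (simp add: eqv_def)
qed

section \<open>The projections of \<open>U(\<chi>)\<close>\<close>

lemma span_II_eqv: "x \<approx> y \<Longrightarrow> y \<in> pm.span (II \<union> S) \<Longrightarrow> x \<in> pm.span (II \<union> S)"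
  using pm.span_add[of "x - y" "II \<union> S" y] pm.span_base[of "x - y" "II \<union> S"] by (simp add: eqv_def)

lemma cl_span_subset:
  assumes "\<And>x. x \<in> S \<Longrightarrow> x \<in> pm.span (II \<union> T)"
  shows "cl ` pm.span S \<subseteq> cl ` pm.span T"
proof (clarify)
  fix x assume "x \<in> pm.span S"
  then have "x \<in> pm.span (pm.span (II \<union> T))"
    using pm.span_mono[of S "pm.span (II \<union> T)"] assms by blast
  then show "cl x \<in> cl ` pm.span T" by (simp add: cl_in_cl_span_iff pm.span_span)
qed

text \<open>The condition sees only the weights of the two words, not the words themselves, because
  \<open>NN\<close> is graded but need not be spanned by symbols.\<close>

definition basis :: "('n lat \<Rightarrow> 'n lat \<Rightarrow> 'n lat \<Rightarrow> bool) \<Rightarrow> ('n gen, 'k) free_alg set" where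
  "basis R = {Ew u * Kw m * Fw v | u m v. R (weight u) m (weight v)}"

abbreviation wrestr :: "('n lat \<Rightarrow> 'n lat \<Rightarrow> 'n lat \<Rightarrow> bool) \<Rightarrow> ('n, 'k) pbw \<Rightarrow> ('n, 'k) pbw" where
  "wrestr R \<equiv> restr (\<lambda>(u, m, v). R (weight u) m (weight v))"

lemma Psi_restr_span: "Psi (wrestr R x) \<in> pm.span (basis R)"
  unfolding Psi_def
proof (rule plin_in_span)
  fix a assume "a \<in> Poly_Mapping.keys (wrestr R x)"
  then show "(case a of (u, m, v) \<Rightarrow> Ew u * Kw m * Fw v) \<in> pm.span (basis R)"
    by (auto simp: keys_restr basis_def intro!: pm.span_base)
qed

lemma nf_span_basis:
  assumes "x \<in> pm.span (basis R)"
  shows "wrestr R (nf x) = nf x" and "(\<And>a m b. R a m b \<Longrightarrow> \<not> R' a m b) \<Longrightarrow> wrestr R' (nf x) = 0"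
proof -
  have "nf x \<in> {p. \<forall>a\<in>Poly_Mapping.keys p. case a of (u, m, v) \<Rightarrow> R (weight u) m (weight v)}"
    (is "_ \<in> ?S")
  proof -
    have "nf x \<in> pm.span ?S"
      by (rule plinear_image_span[OF plinear_nf assms])
         (auto simp: basis_def nf_basis intro!: pm.span_base)
    then show ?thesis by (simp only: pm.span_eq_iff[THEN iffD2, OF subspace_supported])
  qed
  then have k: "R (weight u) m (weight v)" if "(u, m, v) \<in> Poly_Mapping.keys (nf x)" for u m v
    using that by auto
  show "wrestr R (nf x) = nf x"
    by (rule restr_id) (auto dest: k)
  show "wrestr R' (nf x) = 0" if "\<And>a m b. R a m b \<Longrightarrow> \<not> R' a m b"
    by (rule restr_eq_0) (auto dest: k that)
qed

text \<open>Labels that partition the symbols yield a direct sum: restriction to one label maps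
  \<open>NN\<close> into itself, so a sum of terms with distinct labels vanishes modulo
  \<open>NN\<close> only termwise.\<close>

lemma summand_proj_basis:
  assumes disj: "\<And>t t' a m b. R t a m b \<Longrightarrow> R t' a m b \<Longrightarrow> t = t'"
    and cover: "\<And>u m v. \<exists>t\<in>T. R t (weight u) m (weight v)"
    and V: "\<And>t. t \<in> T \<Longrightarrow> V t = cl ` pm.span (basis (R t))"
    and t0: "t0 \<in> T"
  shows "summand_proj UU T V t0 (cl x) = cl (Psi (wrestr (R t0) (nf x)))"
proof -
  define lab where "lab = (\<lambda>(u, m, v). SOME t. t \<in> T \<and> R t (weight u) m (weight v))"
  have lab: "lab (u, m, v) \<in> T" "R (lab (u, m, v)) (weight u) m (weight v)" for u m v
    using someI_ex[of "\<lambda>t. t \<in> T \<and> R t (weight u) m (weight v)"] cover[of u m v]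
    by (auto simp: lab_def)
  have lab_eq: "R t (weight u) m (weight v) \<longleftrightarrow> t = lab (u, m, v)" for t u m v
    using lab disj by blast
  define F where "F = lab ` Poly_Mapping.keys (nf x)"
  have finF: "finite F" and FT: "F \<subseteq> T"
    using lab(1) by (auto simp: F_def)
  have sum: "(\<Sum>t\<in>F. wrestr (R t) (nf x)) = nf x"
  proof (rule poly_mapping_eqI)
    fix a :: "'n list \<times> 'n lat \<times> 'n list"
    obtain u m v where a: "a = (u, m, v)" by (cases a)
    have "Poly_Mapping.lookup (\<Sum>t\<in>F. wrestr (R t) (nf x)) a
        = (\<Sum>t\<in>F. if t = lab a then Poly_Mapping.lookup (nf x) a else 0)"
      unfolding a by (simp add: lookup_sum lab_eq)
    also have "\<dots> = Poly_Mapping.lookup (nf x) a"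
      using finF by (auto simp: F_def in_keys_iff)
    finally show "Poly_Mapping.lookup (\<Sum>t\<in>F. wrestr (R t) (nf x)) a = Poly_Mapping.lookup (nf x) a" .
  qed
  have "summand_proj UU T V t0 (cl x) = cl (if t0 \<in> F then Psi (wrestr (R t0) (nf x)) else 0)"
  proof (rule summand_proj_cl[where L = "\<lambda>t. pm.span (basis (R t))"])
    fix F z and t
    assume F: "finite F" "F \<subseteq> T" "\<And>t. t \<in> F \<Longrightarrow> z t \<in> pm.span (basis (R t))" "sum z F \<in> II"
      and t: "t \<in> F"
    have "wrestr (R t) (nf (sum z F)) = (\<Sum>s\<in>F. wrestr (R t) (nf (z s)))"
      by (simp add: nf_sum plinear_sum[OF plinear_restr])
    also have "\<dots> = (\<Sum>s\<in>F. if s = t then nf (z t) else 0)"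
    proof (rule sum.cong)
      fix s assume "s \<in> F"
      then have "wrestr (R t) (nf (z s)) = 0" if "s \<noteq> t"
        by (rule nf_span_basis(2)[OF F(3)]) (use disj that in blast)
      then show "wrestr (R t) (nf (z s)) = (if s = t then nf (z t) else 0)"
        using nf_span_basis(1)[OF F(3)[OF t]] by auto
    qed simp
    also have "\<dots> = nf (z t)" using F(1) t by simp
    finally show "z t \<in> II"
      using restr_NN[of "nf (sum z F)" "R t"] F(4) by (simp add: II_iff_nf)
  next
    show "x - (\<Sum>t\<in>F. Psi (wrestr (R t) (nf x))) \<in> II"
      using Psi_nf[of x] by (simp add: plinear_sum[OF plinear_Psi, symmetric] sum eqv_def)
  qed (use V t0 finF FT in \<open>auto intro: Psi_restr_span\<close>)
  moreover have "wrestr (R t0) (nf x) = 0" if "t0 \<notin> F"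
    by (rule restr_eq_0) (use that in \<open>auto simp: F_def lab_eq\<close>)
  ultimately show ?thesis by (auto simp: plinear_0[OF plinear_Psi])
qed

lemma weight_nth: "(\<Sum>i\<in>UNIV. weight w $ i) = int (length w)"
  by (induction w) (simp_all add: sum.distrib alpha_nth)

lemma weight_eq_0_iff: "weight w = 0 \<longleftrightarrow> w = []"
  using weight_nth[of w] by auto

lemma weight_nonneg: "weight w \<in> nonneg"
  by (induction w) (auto simp: nonneg_def alpha_nth)

lemma subalg_cl:
  fixes f :: "'g \<Rightarrow> ('n gen, 'k) free_alg"
  shows "subalg UU sc (range (\<lambda>i. cl (f i))) = cl ` range (alg_eval f)"
proof
  show "subalg UU sc (range (\<lambda>i. cl (f i))) \<subseteq> cl ` range (alg_eval f)"
  proof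
    fix u assume "u \<in> subalg UU sc (range (\<lambda>i. cl (f i)))"
    then have "u \<in> generate_ring UU (range sc \<union> range (\<lambda>i. cl (f i)))" by (simp add: subalg_def)
    then show "u \<in> cl ` range (alg_eval f)"
    proof (induction rule: generate_ring.induct)
      case one
      then show ?case
        using plinear_eval by (auto simp: one_cl alg_eval_def one_free_alg intro!: image_eqI[of _ _ 1])
    next
      case (incl h)
      then show ?case
      proof
        assume "h \<in> range sc"
        then obtain c where "h = sc c" by auto
        moreover have "alg_eval f (const c) = const c"
          by (simp add: alg_eval_def const_def one_free_alg)
        ultimately show ?thesis unfolding sc_cl by (metis rangeI image_eqI)
      next
        assume "h \<in> range (\<lambda>i. cl (f i))"
        then obtain i where "h = cl (alg_eval f (letter i))" by auto
        then show ?thesis by blast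
      qed
    next
      case (a_inv h)
      then obtain p where "h = cl (alg_eval f p)" by auto
      then have "\<ominus>\<^bsub>UU\<^esub> h = cl (alg_eval f (- p))" by (simp add: plinear_neg[OF plinear_eval])
      then show ?case by blast
    next
      case (eng_add h1 h2)
      then obtain p r where "h1 = cl (alg_eval f p)" "h2 = cl (alg_eval f r)" by auto
      then have "h1 \<oplus>\<^bsub>UU\<^esub> h2 = cl (alg_eval f (p + r))" by (simp add: plinear_add[OF plinear_eval])
      then show ?case by blast
    next
      case (eng_mult h1 h2)
      then obtain p r where "h1 = cl (alg_eval f p)" "h2 = cl (alg_eval f r)" by auto
      then have "h1 \<otimes>\<^bsub>UU\<^esub> h2 = cl (alg_eval f (p * r))" by (simp add: alg_eval_mult)
      then show ?case by blast
    qed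
  qed
  show "cl ` range (alg_eval f) \<subseteq> subalg UU sc (range (\<lambda>i. cl (f i)))"
  proof (clarify)
    fix p
    let ?G = "generate_ring UU (range sc \<union> range (\<lambda>i. cl (f i)))"
    have w: "cl (prod_list (map f w)) \<in> ?G" for w
    proof (induction w)
      case Nil
      then show ?case using generate_ring.one[of UU] by (simp add: one_cl)
    next
      case (Cons i w)
      then show ?case
        using generate_ring.eng_mult[OF generate_ring.incl[of "cl (f i)"] Cons] by simp
    qed
    have trm: "cl (pscale c (prod_list (map f w))) \<in> ?G" for c w
      using generate_ring.eng_mult[OF generate_ring.incl[of "sc c"] w] by simp
    have "cl (sum g S) \<in> ?G" if "finite S" "\<And>a. a \<in> S \<Longrightarrow> cl (g a) \<in> ?G" for g :: "'g list \<Rightarrow> ('n gen, 'k) free_alg" and S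
      using that
    proof (induction S)
      case empty
      then show ?case using UR.zero_in_generate by (simp add: zero_cl)
    next
      case (insert a S)
      then show ?case using generate_ring.eng_add[of "cl (g a)" UU _ "cl (sum g S)"] by simp
    qed
    then show "cl (alg_eval f p) \<in> subalg UU sc (range (\<lambda>i. cl (f i)))"
      unfolding alg_eval_def plin_def subalg_def using trm by simp
  qed
qed

lemma U_plus_cl: "U_plus chi J = cl ` range Ealg"
  using subalg_cl[of kE] by (simp add: U_plus_def U_E_def[abs_def] Ealg_def)

definition Galg where "Galg = alg_eval (\<lambda>i. kF i * Kw (alpha i))"

lemma G_minus_cl: "G_minus chi J = cl ` range Galg"
proof -
  have "{U_F chi J i \<otimes>\<^bsub>UU\<^esub> U_K chi J (alpha i) | i. True} = range (\<lambda>i. cl (kF i * Kw (alpha i)))"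
    by (auto simp: U_F_def U_K_cl)
  then show ?thesis
    using subalg_cl[of "\<lambda>i. kF i * Kw (alpha i)"] by (simp add: G_minus_def Galg_def)
qed

text \<open>The summand of \<open>U(\<chi>)\<close> belonging to \<open>\<lambda>\<close> is spanned by the \<open>E\<^sub>u K\<^sub>\<mu> F\<^sub>v\<close> with
  \<open>\<mu> - wt v = \<lambda>\<close>.\<close>

definition lab :: "'n lat \<Rightarrow> 'n lat \<Rightarrow> 'n lat \<Rightarrow> 'n lat \<Rightarrow> bool" where
  "lab l a m b \<longleftrightarrow> m - b = l"

lemma acts_scaled:
  assumes "acts x (Poly_Mapping.single a 1) = y"
  shows "acts x (Poly_Mapping.single a c) = pscale c y"
  using plinear_scale[OF plinear_acts, of x c "Poly_Mapping.single a 1"] assms by simp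

text \<open>Collecting the torus parts of the \<open>F_i K_i\<close> in front gives \<open>K\<close>
  to the weight of the word. That the scalar is nonzero allows the change of spanning set in
  \<open>P_summand\<close> to be reversed.\<close>

lemma nf_Gword: "\<exists>c. c \<noteq> 0 \<and> nf (Galg (Poly_Mapping.single v 1)) = Poly_Mapping.single ([], weight v, v) c"
proof (induction v)
  case Nil
  then show ?case by (auto simp: Galg_def alg_eval_def nf_def vac_def intro!: exI[of _ 1])
next
  case (Cons i v)
  then obtain c where c: "c \<noteq> 0" "nf (Galg (Poly_Mapping.single v 1)) = Poly_Mapping.single ([], weight v, v) c"
    by blast
  have "Galg (Poly_Mapping.single (i # v) 1) = kF i * (Kw (alpha i) * Galg (Poly_Mapping.single v 1))"
    by (simp add: Galg_def alg_eval_def mult.assoc)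
  then have "nf (Galg (Poly_Mapping.single (i # v) 1)) = opF i (Poly_Mapping.single ([], weight (i # v), v) c)"
    by (simp add: nf_mult c acts_Kw)
  also have "\<dots> = Poly_Mapping.single ([], weight (i # v), i # v) (c * chi (weight (i # v)) (alpha i))"
    by (simp add: opF_def)
  finally show ?case using c(1) by (metis chi_nonzero mult_eq_0_iff)
qed

lemma basis_lab: "Ew u * Kw (l + weight v) * Fw v \<in> basis (lab l)"
  unfolding basis_def lab_def
  by (intro CollectI exI[of _ u] exI[of _ "l + weight v"] exI[of _ v]) simp

lemma G_word: "\<exists>c. c \<noteq> 0 \<and> Ealg (Poly_Mapping.single u 1) * Kw l * Galg (Poly_Mapping.single v 1)
    \<approx> pscale c (Ew u * Kw (l + weight v) * Fw v)"
proof -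
  obtain c where c: "c \<noteq> 0" "nf (Galg (Poly_Mapping.single v 1)) = Poly_Mapping.single ([], weight v, v) c"
    using nf_Gword by blast
  have "nf (Ealg (Poly_Mapping.single u 1) * Kw l * Galg (Poly_Mapping.single v 1))
      = nf (pscale c (Ew u * Kw (l + weight v) * Fw v))"
    by (simp add: nf_scale nf_basis)
       (simp add: nf_mult c acts_Kw mult.assoc acts_scaled[OF acts_Ew] flip: Ew_def)
  then show ?thesis using c(1) nf_eq_imp by blast
qed

lemma triple_linear_span:
  assumes f: "plinear f" and g: "plinear g"
    and "\<And>u v. f (Poly_Mapping.single u 1) * z * g (Poly_Mapping.single v 1) \<in> pm.span S"
  shows "f x * z * (g y :: ('n gen, 'k) free_alg) \<in> pm.span S"
proof -
  have 1: "f (Poly_Mapping.single u 1) * z * g y \<in> pm.span S" for u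
    by (rule plinear_in_subspace[OF plinear_comp[OF plinear_mult_right g] pm.subspace_span]) (rule assms(3))
  have "plinear (\<lambda>x. f x * z * g y)"
    by (rule plinear_comp[OF plinear_mult_left plinear_comp[OF plinear_mult_left f]])
  then show ?thesis
    by (rule plinear_in_subspace[OF _ pm.subspace_span]) (rule 1)
qed

lemma P_summand:
  "lin_span UU sc {x \<otimes>\<^bsub>UU\<^esub> U_K chi J l \<otimes>\<^bsub>UU\<^esub> y | x y. x \<in> U_plus chi J \<and> y \<in> G_minus chi J}
     = cl ` pm.span (basis (lab l))"
proof -
  define S where "S = {Ealg x * Kw l * Galg y | x y. True}"
  have "{x \<otimes>\<^bsub>UU\<^esub> U_K chi J l \<otimes>\<^bsub>UU\<^esub> y | x y. x \<in> U_plus chi J \<and> y \<in> G_minus chi J} = cl ` S"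
    unfolding U_plus_cl G_minus_cl U_K_cl S_def
    by (auto simp: image_iff) (metis mult_cl rangeI)+
  then have "lin_span UU sc {x \<otimes>\<^bsub>UU\<^esub> U_K chi J l \<otimes>\<^bsub>UU\<^esub> y | x y. x \<in> U_plus chi J \<and> y \<in> G_minus chi J}
      = cl ` pm.span S" by (simp add: lin_span_cl)
  also have "\<dots> = cl ` pm.span (basis (lab l))"
  proof (intro equalityI cl_span_subset)
    fix x assume "x \<in> S"
    then obtain p r where x: "x = Ealg p * Kw l * Galg r" by (auto simp: S_def)
    have pG: "plinear Galg" by (simp add: Galg_def)
    show "x \<in> pm.span (II \<union> basis (lab l))" unfolding x
    proof (rule triple_linear_span[OF plinear_EF_alg(1) pG])
      fix u v
      obtain c where "Ealg (Poly_Mapping.single u 1) * Kw l * Galg (Poly_Mapping.single v 1)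
        \<approx> pscale c (Ew u * Kw (l + weight v) * Fw v)" using G_word by blast
      then show "Ealg (Poly_Mapping.single u 1) * Kw l * Galg (Poly_Mapping.single v 1) \<in> pm.span (II \<union> basis (lab l))"
        by (rule span_II_eqv) (intro pm.span_scale pm.span_base UnI2 basis_lab)
    qed
  next
    fix x assume "x \<in> basis (lab l)"
    then obtain u m v where x: "x = Ew u * Kw m * Fw v" and "m - weight v = l"
      unfolding basis_def lab_def by blast
    then have m: "m = l + weight v" by (simp add: diff_eq_eq)
    obtain c where c: "c \<noteq> 0" and *: "Ealg (Poly_Mapping.single u 1) * Kw l * Galg (Poly_Mapping.single v 1)
        \<approx> pscale c (Ew u * Kw (l + weight v) * Fw v)"
      using G_word by blast
    have "x \<approx> pscale (inverse c) (Ealg (Poly_Mapping.single u 1) * Kw l * Galg (Poly_Mapping.single v 1))"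
      using eqv_scale[OF eqv_sym[OF *], of "inverse c"] c by (simp add: x m)
    then show "x \<in> pm.span (II \<union> S)"
      by (rule span_II_eqv) (intro pm.span_scale pm.span_base UnI2, unfold S_def, blast)
  qed
  finally show ?thesis .
qed

lemma P_cl: "P chi J l (cl x) = cl (Psi (wrestr (lab l) (nf x)))"
  unfolding P_def
  by (rule summand_proj_basis[where R = lab]) (auto simp: P_summand lab_def)

section \<open>The projection of \<open>U\<close> onto the torus\<close>

lemma U_torus_cl: "U_torus chi J h = cl (plin Kw h)"
  by (simp add: U_torus_def U_K_cl finsum_cl plin_def)

lemma nf_Kalg: "nf (plin Kw h) = plin (\<lambda>m. Poly_Mapping.single ([], m, []) 1) h"
  using nf_basis[of "[]" _ "[]"] by (simp add: plinear_plin_comp[OF plinear_nf])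

lemma lookup_plin_K:
  "Poly_Mapping.lookup (plin (\<lambda>m. Poly_Mapping.single ([] :: 'n list, m, [] :: 'n list) 1) h) ([], l, [])
    = Poly_Mapping.lookup (h :: 'n lat \<Rightarrow>\<^sub>0 'k) l"
proof -
  have "Poly_Mapping.lookup (plin (\<lambda>m. Poly_Mapping.single ([] :: 'n list, m, [] :: 'n list) 1) h) ([], l, [])
      = (\<Sum>m\<in>Poly_Mapping.keys h. if m = l then Poly_Mapping.lookup h l else 0)"
    unfolding plin_def lookup_sum by (rule sum.cong) (auto simp: lookup_single when_def)
  then show ?thesis by (cases "Poly_Mapping.lookup h l = 0") (simp_all add: in_keys_iff)
qed

text \<open>\<open>NN\<close> has no component on the symbols \<open>([], m, [])\<close>, so the
  torus embeds into \<open>U\<close>; this is the uniqueness needed to evaluate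
  \<open>pi00\<close>.\<close>

lemma U_torus_inj: "U_torus chi J h = U_torus chi J h' \<Longrightarrow> h = h'"
proof (rule poly_mapping_eqI)
  fix l
  assume "U_torus chi J h = U_torus chi J h'"
  then have "nf (plin Kw h - plin Kw h') \<in> NN"
    by (simp add: U_torus_cl cl_eq_iff II_iff_nf)
  from lookup_NN[OF this, of l]
  show "Poly_Mapping.lookup h l = Poly_Mapping.lookup h' l"
    by (simp add: nf_diff nf_Kalg lookup_minus lookup_plin_K)
qed

definition bideg :: "'n lat \<times> 'n lat \<Rightarrow> 'n lat \<Rightarrow> 'n lat \<Rightarrow> 'n lat \<Rightarrow> bool" where
  "bideg t a m b \<longleftrightarrow> t = (a, b)"

lemma U_plus_part_cl: "U_plus_part chi J a = cl ` pm.span {Ew w | w. weight w = a}"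
proof -
  have "{word_prod UU (U_E chi J) w | w. weight w = a} = cl ` {Ew w | w. weight w = a}"
    using word_prod_cl[of kE] by (auto simp: U_E_def[abs_def] prod_list_kE)
  then show ?thesis by (simp add: U_plus_part_def lin_span_cl)
qed

lemma U_minus_part_cl: "U_minus_part chi J a = cl ` pm.span {Fw w | w. weight w = a}"
proof -
  have "{word_prod UU (U_F chi J) w | w. weight w = a} = cl ` {Fw w | w. weight w = a}"
    using word_prod_cl[of kF] by (auto simp: U_F_def[abs_def] prod_list_kF)
  then show ?thesis by (simp add: U_minus_part_def lin_span_cl)
qed

lemma span_mult3:
  assumes "\<And>x y z. x \<in> S \<Longrightarrow> y \<in> T \<Longrightarrow> z \<in> R \<Longrightarrow> x * y * z \<in> pm.span Q"
    and "x \<in> pm.span S" "y \<in> pm.span T" "z \<in> pm.span R"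
  shows "x * y * (z :: ('n gen, 'k) free_alg) \<in> pm.span Q"
proof -
  have 1: "x * y * z \<in> pm.span Q" if "x \<in> S" "y \<in> T" for x y
    by (rule plinear_image_span[OF plinear_mult_right assms(4)]) (rule assms(1)[OF that])
  have 2: "x * y * z \<in> pm.span Q" if "x \<in> S" for x
    by (rule plinear_image_span[OF plinear_comp[OF plinear_mult_left plinear_mult_right] assms(3)])
       (rule 1[OF that])
  show ?thesis
    by (rule plinear_image_span[OF plinear_comp[OF plinear_mult_left plinear_mult_left] assms(2)])
       (rule 2)
qed

lemma pi_summand:
  "lin_span UU sc {x \<otimes>\<^bsub>UU\<^esub> U_torus chi J h \<otimes>\<^bsub>UU\<^esub> y | x h y.
       x \<in> U_plus_part chi J a \<and> y \<in> U_minus_part chi J b}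
     = cl ` pm.span (basis (bideg (a, b)))"
proof -
  define S where "S = {x * plin Kw h * y | x h y.
     x \<in> pm.span {Ew w | w. weight w = a} \<and> y \<in> pm.span {Fw w | w. weight w = b}}"
  have "{x \<otimes>\<^bsub>UU\<^esub> U_torus chi J h \<otimes>\<^bsub>UU\<^esub> y | x h y.
       x \<in> U_plus_part chi J a \<and> y \<in> U_minus_part chi J b} = cl ` S"
    unfolding U_plus_part_cl U_minus_part_cl U_torus_cl S_def
    by (auto simp: image_iff) (metis mult_cl)+
  then have "lin_span UU sc {x \<otimes>\<^bsub>UU\<^esub> U_torus chi J h \<otimes>\<^bsub>UU\<^esub> y | x h y.
       x \<in> U_plus_part chi J a \<and> y \<in> U_minus_part chi J b} = cl ` pm.span S" by (simp add: lin_span_cl)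
  also have "pm.span S = pm.span (basis (bideg (a, b)))"
  proof (intro equalityI pm.span_minimal pm.subspace_span subsetI)
    fix x assume "x \<in> S"
    then obtain p h r where x: "x = p * plin Kw h * r" "p \<in> pm.span {Ew w | w. weight w = a}"
      "r \<in> pm.span {Fw w | w. weight w = b}" by (auto simp: S_def)
    have K: "plin Kw h \<in> pm.span (range Kw)"
      by (rule plin_in_span) (auto intro: pm.span_base)
    show "x \<in> pm.span (basis (bideg (a, b)))"
      unfolding x(1)
      by (rule span_mult3[OF _ x(2) K x(3)]) (rule pm.span_base, unfold basis_def bideg_def, blast)
  next
    fix x assume "x \<in> basis (bideg (a, b))"
    then obtain u m v where x: "x = Ew u * Kw m * Fw v" "weight u = a" "weight v = b"
      by (auto simp: basis_def bideg_def)
    have "plin Kw (Poly_Mapping.single m 1) = (Kw m :: ('n gen, 'k) free_alg)" by simp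
    with x have "x \<in> S" unfolding S_def
      by (intro CollectI exI[of _ "Ew u"] exI[of _ "Poly_Mapping.single m 1"] exI[of _ "Fw v"])
         (auto intro!: pm.span_base)
    then show "x \<in> pm.span S" by (rule pm.span_base)
  qed
  finally show ?thesis .
qed

lemma pi00_cl:
  "pi00 chi J (cl x) = (THE h. U_torus chi J h = cl (Psi (wrestr (bideg (0, 0)) (nf x))))"
proof -
  have "summand_proj UU (nonneg \<times> nonneg)
       (\<lambda>(a, b). lin_span UU sc
          {x \<otimes>\<^bsub>UU\<^esub> U_torus chi J h' \<otimes>\<^bsub>UU\<^esub> y | x h' y.
             x \<in> U_plus_part chi J a \<and> y \<in> U_minus_part chi J b}) (0, 0) (cl x)
     = cl (Psi (wrestr (bideg (0, 0)) (nf x)))"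
  proof (rule summand_proj_basis[where R = bideg])
    show "\<exists>t\<in>nonneg \<times> nonneg. bideg t (weight u) m (weight v)" for u m v
      by (auto simp: bideg_def weight_nonneg)
    show "(0, 0) \<in> (nonneg :: 'n lat set) \<times> (nonneg :: 'n lat set)"
      by (simp add: nonneg_def)
  qed (auto simp: bideg_def pi_summand)
  then show ?thesis by (simp add: pi00_def)
qed

text \<open>Both projections restrict to labels. Weight zero forces both words to be empty, and then
  label \<open>l\<close> leaves the single symbol \<open>([], l, [])\<close>.\<close>

lemma pi00_P_cl:
  "pi00 chi J (P chi J l (cl x)) = Poly_Mapping.single l (Poly_Mapping.lookup (nf x) ([], l, []))"
proof -
  let ?c = "Poly_Mapping.lookup (nf x) ([], l, [])"
  have "wrestr (bideg (0, 0)) (wrestr (lab l) (nf x)) = Poly_Mapping.single ([], l, []) ?c"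
    by (rule poly_mapping_eqI)
       (auto simp: bideg_def lab_def weight_eq_0_iff lookup_single when_def split: prod.splits)
  then have "pi00 chi J (P chi J l (cl x)) = (THE h. U_torus chi J h = cl (pscale ?c (Kw l)))"
    by (simp add: P_cl pi00_cl nf_Psi)
  also have "\<dots> = Poly_Mapping.single l ?c"
  proof (rule the_equality)
    show *: "U_torus chi J (Poly_Mapping.single l ?c) = cl (pscale ?c (Kw l))"
      by (simp add: U_torus_cl)
    show "h = Poly_Mapping.single l ?c" if "U_torus chi J h = cl (pscale ?c (Kw l))" for h
      using that * by (intro U_torus_inj) simp
  qed
  finally show ?thesis .
qed

end

section \<open>The filtration of \<open>U(\<chi>)\<^sup>p\<^sup>o\<^sup>l\<^sup>y\<close>\<close>

locale symmetric_pair = pre_nichols chi J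
  for chi :: "'n::{finite,linorder} lat \<Rightarrow> 'n lat \<Rightarrow> 'k::field" and J +
  fixes tau :: "'n \<Rightarrow> 'n" and c :: "'n \<Rightarrow> 'k"
  assumes tau_tau [simp]: "tau (tau i) = i"
begin

definition Et :: "'n \<Rightarrow> ('n gen, 'k) free_alg" where "Et i = kE i * Kw (- alpha i)"

definition pgv :: "'n poly_gen \<Rightarrow> ('n gen, 'k) free_alg" where
  "pgv g = (case g of pF i \<Rightarrow> kF i | pE i \<Rightarrow> Et i | pKi i \<Rightarrow> Kw (- alpha i)
     | pKK i \<Rightarrow> Kw (alpha i - alpha (tau i)))"

lemma poly_gen_value_cl: "poly_gen_value chi J tau g = cl (pgv g)"
  by (cases g) (simp_all add: pgv_def Et_def U_F_def U_E_def U_K_cl)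

definition pw where "pw w = prod_list (map pgv w)"
definition pdeg :: "'n poly_gen list \<Rightarrow> nat" where "pdeg w = sum_list (map poly_gen_degree w)"

text \<open>Including \<open>II\<close> makes this the full preimage of a filtration step, so
  membership depends only on the class in \<open>U\<close>.\<close>

definition FF :: "nat \<Rightarrow> ('n gen, 'k) free_alg set" where
  "FF m = pm.span (II \<union> {pw w | w. pdeg w \<le> m})"

abbreviation fil where "fil \<equiv> poly_fil chi J tau"

lemma span_II_Un: "cl ` pm.span (II \<union> S) = cl ` pm.span S"
proof
  show "cl ` pm.span (II \<union> S) \<subseteq> cl ` pm.span S"
    by (auto simp: cl_in_cl_span_iff)
  show "cl ` pm.span S \<subseteq> cl ` pm.span (II \<union> S)"
    by (intro image_mono pm.span_mono) auto
qed

lemma fil_cl: "fil m = cl ` FF m"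
proof -
  have "{word_prod UU (poly_gen_value chi J tau) w | w. sum_list (map poly_gen_degree w) \<le> m}
      = cl ` {pw w | w. pdeg w \<le> m}"
    using word_prod_cl[of pgv] by (auto simp: poly_gen_value_cl[abs_def] pw_def pdeg_def)
  then show ?thesis by (simp add: poly_fil_def FF_def lin_span_cl span_II_Un)
qed

lemma FF_subspace [simp, intro]: "pm.subspace (FF m)"
  by (simp add: FF_def)

lemma FF_II: "x \<in> II \<Longrightarrow> x \<in> FF m"
  unfolding FF_def by (rule pm.span_base) simp

lemma FF_pw: "pdeg w \<le> m \<Longrightarrow> pw w \<in> FF m"
  unfolding FF_def by (rule pm.span_base) auto

lemma FF_eqv: "x \<approx> y \<Longrightarrow> y \<in> FF m \<Longrightarrow> x \<in> FF m"
  unfolding FF_def by (rule span_II_eqv)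

lemma FF_mono: "m \<le> m' \<Longrightarrow> x \<in> FF m \<Longrightarrow> x \<in> FF m'"
  unfolding FF_def by (erule set_mp[OF pm.span_mono, rotated]) auto

lemma span_mult2:
  assumes "\<And>x y. x \<in> S \<Longrightarrow> y \<in> T \<Longrightarrow> x * y \<in> pm.span Q"
    and "x \<in> pm.span S" "y \<in> pm.span T"
  shows "x * (y :: ('n gen, 'k) free_alg) \<in> pm.span Q"
  by (rule plinear_image_span[OF plinear_mult_left assms(2)])
     (rule plinear_image_span[OF plinear_mult_right assms(3)], rule assms(1))

lemma FF_mult:
  assumes "x \<in> FF a" "y \<in> FF b"
  shows "x * y \<in> FF (a + b)"
  unfolding FF_def
proof (rule span_mult2[OF _ assms(1)[unfolded FF_def] assms(2)[unfolded FF_def]])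
  fix x y assume x: "x \<in> II \<union> {pw w |w. pdeg w \<le> a}" and y: "y \<in> II \<union> {pw w |w. pdeg w \<le> b}"
  show "x * y \<in> pm.span (II \<union> {pw w |w. pdeg w \<le> a + b})"
  proof (cases "x \<in> II \<or> y \<in> II")
    case True
    then have "x * y \<in> II" using II_rmult II_lmult by blast
    then show ?thesis by (intro pm.span_base) simp
  next
    case False
    then obtain v w where "x = pw v" "pdeg v \<le> a" "y = pw w" "pdeg w \<le> b" using x y by auto
    then have "x * y = pw (v @ w)" "pdeg (v @ w) \<le> a + b" by (simp_all add: pw_def pdeg_def)
    then show ?thesis by (intro pm.span_base) blast
  qed
qed

lemma FF_gen: "pgv g \<in> FF (poly_gen_degree g)"
  using FF_pw[of "[g]"] by (simp add: pw_def pdeg_def)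

lemma FF_one: "1 \<in> FF m"
  using FF_pw[of "[]"] by (simp add: pw_def pdeg_def)

lemma FF_const: "const d \<in> FF m"
  using pm.subspace_scale[OF FF_subspace FF_one, of d m] by (simp add: pscale_eq_const)

lemma FF_zero [simp]: "0 \<in> FF m"
  by (rule pm.subspace_0) simp

text \<open>\<open>FP m\<close> is the preimage of the filtration step below \<open>m\<close>.\<close>

definition FP :: "nat \<Rightarrow> ('n gen, 'k) free_alg set" where
  "FP m = (case m of 0 \<Rightarrow> II | Suc l \<Rightarrow> FF l)"

lemma FP_subspace [simp, intro]: "pm.subspace (FP m)"
  by (cases m) (simp_all add: FP_def II_subspace)

lemma FP_FF: "x \<in> FP m \<Longrightarrow> x \<in> FF m"
  by (cases m) (auto simp: FP_def intro: FF_II FF_mono[OF le_SucI[OF order_refl]])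

lemma FP_II: "x \<in> II \<Longrightarrow> x \<in> FP m"
  by (cases m) (auto simp: FP_def intro: FF_II)

lemma FF_FP: "l < m \<Longrightarrow> x \<in> FF l \<Longrightarrow> x \<in> FP m"
  by (cases m) (auto simp: FP_def intro: FF_mono[of l])

lemma FP_mult_left: "x \<in> FP a \<Longrightarrow> y \<in> FF b \<Longrightarrow> x * y \<in> FP (a + b)"
  by (cases a) (auto simp: FP_def intro: FP_II[unfolded FP_def] II_rmult FF_mult)

lemma FP_mult_right: "x \<in> FF a \<Longrightarrow> y \<in> FP b \<Longrightarrow> x * y \<in> FP (a + b)"
  by (cases b) (auto simp: FP_def intro: FP_II[unfolded FP_def] II_lmult FF_mult)

lemma fil_pred_cl: "fil_pred UU fil m = cl ` FP m"
proof (cases m)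
  case 0
  have "cl ` II = {\<zero>\<^bsub>UU\<^esub>}" using cl_eq_zero_iff II_zero by force
  with 0 show ?thesis by (simp add: fil_pred_def FP_def)
qed (simp add: fil_pred_def FP_def fil_cl)

section \<open>Degrees of torus elements\<close>

definition coord_sum :: "'n lat \<Rightarrow> int" where "coord_sum m = (\<Sum>i\<in>UNIV. m $ i)"

lemma coord_sum_simps [simp]: "coord_sum (a + b) = coord_sum a + coord_sum b"
  "coord_sum (a - b) = coord_sum a - coord_sum b" "coord_sum (- a) = - coord_sum a"
  "coord_sum 0 = 0" "coord_sum (alpha i) = 1"
  by (simp_all add: coord_sum_def sum.distrib sum_subtractf sum_negf alpha_nth)

lemma coord_sum_weight: "coord_sum (weight w) = int (length w)"
  by (simp add: coord_sum_def weight_nth)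

definition kdeg :: "'n lat \<Rightarrow> nat" where "kdeg m = nat (- coord_sum m)"

lemma tau_lattice_nth: "tau_lattice tau z $ j = z $ tau j"
proof -
  have "tau_lattice tau z $ j = (\<Sum>i\<in>UNIV. if i = tau j then z $ i else 0)"
    unfolding tau_lattice_def sum_component by (rule sum.cong) (auto simp: alpha_nth)
  then show ?thesis by simp
qed

lemma theta_iff: "z \<in> lattice_theta tau \<longleftrightarrow> (\<forall>j. z $ tau j = - (z $ j))"
  by (simp add: lattice_theta_def vec_eq_iff tau_lattice_nth)

lemma coord_sum_theta: "z \<in> lattice_theta tau \<Longrightarrow> coord_sum z = 0"
proof -
  assume z: "z \<in> lattice_theta tau"
  have "coord_sum z = (\<Sum>i\<in>UNIV. z $ tau i)"
    unfolding coord_sum_def by (rule sum.reindex_bij_witness[of _ tau tau]) auto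
  also have "\<dots> = - coord_sum z"
    using z by (simp add: theta_iff coord_sum_def sum_negf)
  finally show ?thesis by simp
qed

lemma coord_sum_poly: "m \<in> lattice_poly tau \<Longrightarrow> coord_sum m \<le> 0"
proof -
  assume "m \<in> lattice_poly tau"
  then obtain b z where m: "m = - b + z" "b \<in> nonneg" "z \<in> lattice_theta tau"
    by (auto simp: lattice_poly_def)
  have "0 \<le> coord_sum b" using m(2) by (simp add: coord_sum_def nonneg_def sum_nonneg)
  then show ?thesis by (simp add: m coord_sum_theta)
qed

lemma kdeg_int: "m \<in> lattice_poly tau \<Longrightarrow> int (kdeg m) = - coord_sum m"
  using coord_sum_poly[of m] by (simp add: kdeg_def)

lemma lattice_poly_add:
  assumes "m \<in> lattice_poly tau" "m' \<in> lattice_poly tau"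
  shows "m + m' \<in> lattice_poly tau"
proof -
  obtain b z where m: "m = - b + z" "b \<in> nonneg" "z \<in> lattice_theta tau"
    using assms(1) by (auto simp: lattice_poly_def)
  obtain b' z' where m': "m' = - b' + z'" "b' \<in> nonneg" "z' \<in> lattice_theta tau"
    using assms(2) by (auto simp: lattice_poly_def)
  have "m + m' = - (b + b') + (z + z')" using m(1) m'(1) by simp
  moreover have "b + b' \<in> nonneg" using m(2) m'(2) by (simp add: nonneg_def)
  moreover have "z + z' \<in> lattice_theta tau" using m(3) m'(3) by (simp add: theta_iff)
  ultimately show ?thesis unfolding lattice_poly_def by blast
qed

lemma kdeg_add: "m \<in> lattice_poly tau \<Longrightarrow> m' \<in> lattice_poly tau \<Longrightarrow> kdeg (m + m') = kdeg m + kdeg m'"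
  using kdeg_int[of m] kdeg_int[of m'] kdeg_int[OF lattice_poly_add, of m m'] by simp

lemma nonneg_poly: "b \<in> nonneg \<Longrightarrow> - b \<in> lattice_poly tau"
  unfolding lattice_poly_def by (intro CollectI exI[of _ b] exI[of _ 0]) (simp add: theta_iff)

lemma theta_poly: "z \<in> lattice_theta tau \<Longrightarrow> z \<in> lattice_poly tau"
  unfolding lattice_poly_def by (intro CollectI exI[of _ 0] exI[of _ z]) (simp add: nonneg_def)

lemma alpha_nonneg: "alpha i \<in> nonneg"
  by (simp add: nonneg_def alpha_nth)

lemma alpha_theta: "alpha i - alpha (tau i) \<in> lattice_theta tau"
  unfolding theta_iff by (auto simp: alpha_nth) (metis tau_tau)+

lemma zero_poly: "0 \<in> lattice_poly tau"
  by (rule theta_poly) (simp add: theta_iff)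

lemma Kw_add: "Kw (m + m') \<approx> Kw m * Kw m'"
  by (rule nf_eq_imp) (simp add: nf_mult nf_def vac_def acts_mult acts_Kw)

lemma Kw_FF_mult: "Kw m \<in> FF a \<Longrightarrow> Kw m' \<in> FF b \<Longrightarrow> Kw (m + m') \<in> FF (a + b)"
  by (rule FF_eqv[OF Kw_add FF_mult])

lemma Kw_FF_power: "Kw m \<in> FF a \<Longrightarrow> Kw (int j *s m) \<in> FF (j * a)"
proof (induction j)
  case (Suc j)
  have "int (Suc j) *s m = m + int j *s m" by (simp add: vec_eq_iff algebra_simps)
  then show ?case using Kw_FF_mult[OF Suc.prems Suc.IH[OF Suc.prems]] by simp
qed (simp add: Kw_0 FF_one)

lemma Kw_FF_sum:
  assumes "finite A" "\<And>i. i \<in> A \<Longrightarrow> Kw (f i) \<in> FF (d i)"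
  shows "Kw (sum f A) \<in> FF (sum d A)"
  using assms by (induction A) (auto simp: Kw_0 FF_one intro: Kw_FF_mult)

lemma Kw_theta_FF:
  assumes z: "z \<in> lattice_theta tau"
  shows "Kw z \<in> FF 0"
proof -
  \<comment> \<open>One representative for each orbit of two elements; on a fixed point of
    \<open>tau\<close> the entry of \<open>z\<close> equals its negative and vanishes.\<close>
  let ?A = "{i. i < tau i}"
  have KK: "Kw (alpha i - alpha (tau i)) \<in> FF 0" for i
    using FF_gen[of "pKK i"] by (simp add: pgv_def)
  have "Kw ((z $ i) *s (alpha i - alpha (tau i))) \<in> FF 0" for i
  proof (cases "0 \<le> z $ i")
    case True
    then show ?thesis using Kw_FF_power[OF KK[of i], of "nat (z $ i)"] by simp
  next
    case False
    \<comment> \<open>A negative power is a positive power of the generator for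
      \<open>tau i\<close>, which is inverse to the one for \<open>i\<close>.\<close>
    then have "int (nat (- (z $ i))) *s (alpha (tau i) - alpha i) = (z $ i) *s (alpha i - alpha (tau i))"
      by (simp add: vec_eq_iff algebra_simps)
    then show ?thesis using Kw_FF_power[OF KK[of "tau i"], of "nat (- (z $ i))"] by simp
  qed
  then have "Kw (\<Sum>i\<in>?A. (z $ i) *s (alpha i - alpha (tau i))) \<in> FF (\<Sum>i\<in>?A. 0)"
    by (intro Kw_FF_sum) auto
  moreover have "(\<Sum>i\<in>?A. (z $ i) *s (alpha i - alpha (tau i))) = z"
  proof (rule vec_eq_iff[THEN iffD2], rule allI)
    fix j
    have "(\<Sum>i\<in>?A. (z $ i) *s (alpha i - alpha (tau i))) $ j
        = (\<Sum>i\<in>?A. if i = j then z $ i else 0) - (\<Sum>i\<in>?A. if i = tau j then z $ i else 0)"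
      unfolding sum_component sum_subtractf[symmetric]
      by (rule sum.cong) (auto simp: alpha_nth)
    also have "\<dots> = (if j < tau j then z $ j else 0) - (if tau j < j then z $ tau j else 0)"
      by simp
    also have "\<dots> = z $ j"
    proof (cases "tau j = j")
      case True
      then have "z $ j = - (z $ j)" using z by (metis theta_iff)
      then show ?thesis by (simp add: True)
    next
      case False
      then consider "j < tau j" | "tau j < j" by fastforce
      then show ?thesis using z by cases (auto simp: theta_iff)
    qed
    finally show "(\<Sum>i\<in>?A. (z $ i) *s (alpha i - alpha (tau i))) $ j = z $ j" .
  qed
  ultimately show ?thesis by simp
qed

lemma Kw_poly_FF:
  assumes "m \<in> lattice_poly tau"
  shows "Kw m \<in> FF (kdeg m)"
proof -
  obtain b z where m: "m = - b + z" "b \<in> nonneg" "z \<in> lattice_theta tau"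
    using assms by (auto simp: lattice_poly_def)
  have b: "0 \<le> b $ i" for i using m(2) by (simp add: nonneg_def)
  have "Kw (- alpha i) \<in> FF 1" for i
    using FF_gen[of "pKi i"] by (simp add: pgv_def)
  then have "Kw (\<Sum>i\<in>UNIV. int (nat (b $ i)) *s (- alpha i)) \<in> FF (\<Sum>i\<in>UNIV. nat (b $ i) * 1)"
    by (intro Kw_FF_sum Kw_FF_power) auto
  moreover have "(\<Sum>i\<in>UNIV. int (nat (b $ i)) *s (- alpha i)) = - b"
    by (simp add: vec_eq_iff sum_component alpha_nth b sum_negf if_distrib cong: if_cong)
  moreover have "(\<Sum>i\<in>UNIV. nat (b $ i) * 1) = kdeg m"
  proof -
    have "int (\<Sum>i\<in>UNIV. nat (b $ i) * 1) = coord_sum b" by (simp add: coord_sum_def b)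
    moreover have "kdeg m = nat (coord_sum b)" by (simp add: m(1) kdeg_def coord_sum_theta[OF m(3)])
    ultimately show ?thesis by (metis nat_int)
  qed
  ultimately have "Kw (- b) \<in> FF (kdeg m)" by simp
  from Kw_FF_mult[OF this Kw_theta_FF[OF m(3)]] show ?thesis by (simp add: m(1))
qed

definition Etw :: "'n list \<Rightarrow> ('n gen, 'k) free_alg" where "Etw u = prod_list (map Et u)"

lemma Etw_simps [simp]: "Etw [] = 1" "Etw (i # u) = Et i * Etw u"
  by (simp_all add: Etw_def)

text \<open>The scalar depends on \<open>u\<close> alone, so one \<open>e\<close> serves for all
  \<open>m\<close> and \<open>v\<close>; \<open>Kw_Etw\<close> compares two exponents through the
  same scalar.\<close>

lemma acts_Etw: "\<exists>e. e \<noteq> 0 \<and> (\<forall>m v. acts (Etw u) (Poly_Mapping.single ([], m, v) 1)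
    = Poly_Mapping.single (u, m - weight u, v) e)"
proof (induction u)
  case (Cons i u)
  then obtain e where e: "e \<noteq> 0" "\<And>m v. acts (Etw u) (Poly_Mapping.single ([], m, v) 1)
    = Poly_Mapping.single (u, m - weight u, v) e" by blast
  have "acts (Etw (i # u)) (Poly_Mapping.single ([], m, v) 1)
      = Poly_Mapping.single (i # u, m - weight (i # u), v) (e * chi (- alpha i) (weight u))" for m v
    by (simp add: acts_mult e Et_def acts_Kw algebra_simps)
  then show ?case using e(1) by (metis chi_nonzero mult_eq_0_iff)
qed (auto intro: exI[of _ 1])

lemma nf_Etw: "\<exists>e. e \<noteq> 0 \<and> (\<forall>m v. nf (Etw u * Kw m * Fw v) = Poly_Mapping.single (u, m - weight u, v) e)"
proof -
  obtain e where "e \<noteq> 0" "\<And>m v. acts (Etw u) (Poly_Mapping.single ([], m, v) 1)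
    = Poly_Mapping.single (u, m - weight u, v) e" using acts_Etw by blast
  then show ?thesis by (auto simp: nf_mult acts_mult acts_Kw acts_Fw nf_def vac_def)
qed

lemma Kw_Etw: "Kw n * (Etw u * Kw m * Fw v) \<approx> pscale (chi n (weight u)) (Etw u * Kw (n + m) * Fw v)"
proof (rule nf_eq_imp)
  obtain e where e: "\<And>m v. nf (Etw u * Kw m * Fw v) = Poly_Mapping.single (u, m - weight u, v) e"
    using nf_Etw by blast
  show "nf (Kw n * (Etw u * Kw m * Fw v)) = nf (pscale (chi n (weight u)) (Etw u * Kw (n + m) * Fw v))"
    by (simp only: nf_mult[of "Kw n"] nf_scale e acts_Kw pscale_single) (simp add: algebra_simps)
qed

text \<open>The commutator \<open>K_i - K_i^-1\<close> times \<open>K_i^-1\<close> is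
  \<open>1 - K_i^-2\<close>, with terms of degree 0 and 2, while the product on the left has degree
  2. Reordering thus never raises the degree, and only \<open>K_i^-2\<close> contributes to the
  relation in the associated graded algebra.\<close>

lemma F_Et: "kF i * Et j \<approx> pscale (inverse (q chi j i)) (Et j * kF i)
    - (if i = j then 1 - Kw (- alpha i - alpha i) else 0)"
proof -
  have "(kF i * kE j) * Kw (- alpha j) \<approx> (kE j * kF i - (if j = i then kK j - kKi j else 0)) * Kw (- alpha j)"
    by (intro eqv_mult rel_FE eqv_refl)
  also have "\<dots> = kE j * (kF i * Kw (- alpha j))
      - (if j = i then kK j * Kw (- alpha j) - kKi j * Kw (- alpha j) else 0)"
    by (simp add: algebra_simps mult.assoc)
  also have "\<dots> \<approx> kE j * pscale (chi (- alpha j) (alpha i)) (Kw (- alpha j) * kF i)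
      - (if j = i then Kw (- alpha j + alpha j) - Kw (- alpha j - alpha j) else 0)"
    using eqv_diff[OF Kw_add_alpha[of j "- alpha j"] Kw_diff_alpha[of j "- alpha j"]]
    by (intro eqv_diff eqv_mult F_Kw eqv_refl) auto
  finally show ?thesis
    by (auto simp: Et_def mult.assoc pscale_mult_right chi_neg_left q_def Kw_0)
qed

text \<open>The filtration is given by unordered words, whereas torus coefficients can be read off
  from ordered monomials; \<open>FF_SS\<close> closes this gap.\<close>

definition SS :: "nat \<Rightarrow> ('n gen, 'k) free_alg set" where
  "SS m = pm.span (II \<union> {Etw u * Kw n * Fw v | u n v.
     n \<in> lattice_poly tau \<and> length u + length v + kdeg n \<le> m})"

lemma SS_subspace: "pm.subspace (SS m)"
  by (simp add: SS_def)

lemma SS_base: "n \<in> lattice_poly tau \<Longrightarrow> length u + length v + kdeg n \<le> m \<Longrightarrow> Etw u * Kw n * Fw v \<in> SS m"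
  unfolding SS_def by (rule pm.span_base) blast

lemma SS_II: "x \<in> II \<Longrightarrow> x \<in> SS m"
  unfolding SS_def by (rule pm.span_base) blast

lemma SS_eqv: "x \<approx> y \<Longrightarrow> y \<in> SS m \<Longrightarrow> x \<in> SS m"
  unfolding SS_def by (rule span_II_eqv)

lemma SS_mono: "m \<le> m' \<Longrightarrow> x \<in> SS m \<Longrightarrow> x \<in> SS m'"
  unfolding SS_def
  by (erule set_mp[OF pm.span_mono, rotated]) (blast intro: order_trans)

lemma SS_lmult:
  assumes "\<And>u n v. n \<in> lattice_poly tau \<Longrightarrow> length u + length v + kdeg n \<le> m \<Longrightarrow>
      y * (Etw u * Kw n * Fw v) \<in> SS m'"
    and "x \<in> SS m"
  shows "y * x \<in> SS m'"
proof -
  have "y * x \<in> pm.span (SS m')"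
    by (rule plinear_image_span[OF plinear_mult_right assms(2)[unfolded SS_def]])
       (rule pm.span_base, elim UnE CollectE exE conjE, erule SS_II[OF II_lmult], simp add: assms(1))
  then show ?thesis by (simp only: pm.span_eq_iff[THEN iffD2, OF SS_subspace])
qed

lemma SS_Et: "x \<in> SS m \<Longrightarrow> Et i * x \<in> SS (Suc m)"
proof (rule SS_lmult)
  fix u v :: "'n list" and n assume "n \<in> lattice_poly tau" "length u + length v + kdeg n \<le> m"
  then have "Etw (i # u) * Kw n * Fw v \<in> SS (Suc m)" by (intro SS_base) auto
  then show "Et i * (Etw u * Kw n * Fw v) \<in> SS (Suc m)" by (simp add: mult.assoc)
qed

lemma SS_Kw:
  assumes "n \<in> lattice_poly tau" "x \<in> SS m"
  shows "Kw n * x \<in> SS (m + kdeg n)"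
proof (rule SS_lmult[OF _ assms(2)])
  fix u v :: "'n list" and n' assume "n' \<in> lattice_poly tau" "length u + length v + kdeg n' \<le> m"
  then have "pscale (chi n (weight u)) (Etw u * Kw (n + n') * Fw v) \<in> SS (m + kdeg n)"
    using assms(1)
    by (intro pm.subspace_scale[OF SS_subspace] SS_base lattice_poly_add) (auto simp: kdeg_add)
  then show "Kw n * (Etw u * Kw n' * Fw v) \<in> SS (m + kdeg n)"
    by (rule SS_eqv[OF Kw_Etw])
qed

lemma SS_F: "x \<in> SS m \<Longrightarrow> kF i * x \<in> SS (Suc m)"
proof (rule SS_lmult)
  fix u v :: "'n list" and n
  assume n: "n \<in> lattice_poly tau" and "length u + length v + kdeg n \<le> m"
  then show "kF i * (Etw u * Kw n * Fw v) \<in> SS (Suc m)"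
  proof (induction u arbitrary: m)
    case Nil
    have "(kF i * Kw n) * Fw v \<approx> pscale (chi n (alpha i)) (Kw n * kF i) * Fw v"
      by (intro eqv_mult F_Kw eqv_refl)
    also have "\<dots> = pscale (chi n (alpha i)) (Etw [] * Kw n * Fw (i # v))"
      by (simp add: pscale_mult_left mult.assoc)
    finally have "kF i * (Etw [] * Kw n * Fw v) \<approx> pscale (chi n (alpha i)) (Etw [] * Kw n * Fw (i # v))"
      by (simp add: mult.assoc)
    then show ?case
      using Nil by (rule_tac SS_eqv) (auto intro!: pm.subspace_scale[OF SS_subspace] SS_base[of n "[]" "i # v", simplified])
  next
    case (Cons j u)
    define y where "y = Etw u * Kw n * Fw v"
    \<comment> \<open>The leading \<open>j\<close> accounts for one unit of degree, so the rest
      \<open>y\<close> has bound \<open>m - 1\<close>; the contraction term \<open>K_i^-2 y\<close>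
      then has bound \<open>m + 1\<close>, as required.\<close>
    obtain m' where m: "m = Suc m'" and m': "length u + length v + kdeg n \<le> m'"
      using Cons.prems by (cases m) auto
    have Fy: "kF i * y \<in> SS (Suc m')" unfolding y_def by (rule Cons.IH[OF n m'])
    have y: "y \<in> SS m'" unfolding y_def by (rule SS_base[OF n m'])
    have 2: "- alpha i - alpha i \<in> lattice_poly tau"
      using lattice_poly_add[OF nonneg_poly[OF alpha_nonneg[of i]] nonneg_poly[OF alpha_nonneg[of i]]] by simp
    have "kdeg (- alpha i - alpha i) = 2" unfolding kdeg_def coord_sum_simps by simp
    with SS_Kw[OF 2 y] have Ky: "Kw (- alpha i - alpha i) * y \<in> SS (Suc m)" by (simp add: m)
    have "(kF i * Et j) * y \<approx> (pscale (inverse (q chi j i)) (Et j * kF i)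
        - (if i = j then 1 - Kw (- alpha i - alpha i) else 0)) * y"
      by (intro eqv_mult F_Et eqv_refl)
    also have "\<dots> = pscale (inverse (q chi j i)) (Et j * (kF i * y))
        - (if i = j then y - Kw (- alpha i - alpha i) * y else 0)"
      by (simp add: left_diff_distrib pscale_mult_left mult.assoc)
    finally have e: "kF i * (Etw (j # u) * Kw n * Fw v) \<approx> \<dots>"
      by (simp add: y_def mult.assoc)
    have "Et j * (kF i * y) \<in> SS (Suc m)" using SS_Et[OF Fy] by (simp add: m)
    moreover have "y \<in> SS (Suc m)" by (rule SS_mono[OF _ y]) (simp add: m)
    ultimately show ?case
      using Ky pm.subspace_0[OF SS_subspace, of "Suc m"]
      by (intro SS_eqv[OF e] pm.subspace_diff[OF SS_subspace] pm.subspace_scale[OF SS_subspace])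
         (auto intro: pm.subspace_diff[OF SS_subspace])
  qed
qed

lemma FF_SS: "x \<in> FF m \<Longrightarrow> x \<in> SS m"
proof -
  have one: "1 \<in> SS 0"
    using SS_base[of 0 "[]" "[]" 0] zero_poly by (simp add: Kw_0 kdeg_def)
  have gen: "pgv g * x \<in> SS (m + poly_gen_degree g)" if "x \<in> SS m" for g x m
  proof (cases g)
    case (pKi i)
    then show ?thesis
      using SS_Kw[OF nonneg_poly[OF alpha_nonneg[of i]] that] by (simp add: pgv_def kdeg_def)
  next
    case (pKK i)
    then show ?thesis
      using SS_Kw[OF theta_poly[OF alpha_theta[of i]] that] by (simp add: pgv_def kdeg_def)
  qed (use SS_Et[OF that] SS_F[OF that] in \<open>simp_all add: pgv_def\<close>)
  have pw: "pw w \<in> SS (pdeg w)" for w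
  proof (induction w)
    case (Cons g w)
    then show ?case using gen[OF Cons, of g] by (simp add: pw_def pdeg_def add.commute)
  qed (simp add: pw_def pdeg_def one)
  assume "x \<in> FF m"
  moreover have "II \<union> {pw w |w. pdeg w \<le> m} \<subseteq> SS m"
    using SS_mono[OF _ pw] SS_II by blast
  ultimately show "x \<in> SS m"
    unfolding FF_def using pm.span_minimal[OF _ SS_subspace] by blast
qed

abbreviation coef :: "'n lat \<Rightarrow> ('n gen, 'k) free_alg \<Rightarrow> 'k" where
  "coef n x \<equiv> Poly_Mapping.lookup (nf x) ([], n, [])"

lemma coef_add: "coef n (x + y) = coef n x + coef n y"
  and coef_diff: "coef n (x - y) = coef n x - coef n y"
  and coef_scale: "coef n (pscale d x) = d * coef n x"
  and coef_zero: "coef n 0 = 0"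
  and coef_sum: "coef n (sum f A) = (\<Sum>a\<in>A. coef n (f a))"
  by (simp_all add: nf_add nf_diff nf_scale nf_sum lookup_add lookup_minus lookup_sum plinear_0[OF plinear_nf])

lemma coef_II: "x \<in> II \<Longrightarrow> coef n x = 0"
  by (rule lookup_NN) (simp add: II_iff_nf)

lemma coef_Kw: "coef n (Kw m) = (if n = m then 1 else 0)"
  using nf_basis[of "[]" m "[]"] by (simp add: lookup_single when_def)

text \<open>An ordered monomial contributes to this coefficient only if both words are empty and its
  torus part is \<open>K_n\<close>; its degree is then \<open>- coord_sum n\<close>, which exceeds
  the bound.\<close>

lemma coef_FF:
  assumes "x \<in> FF m" "int m < - coord_sum n"
  shows "coef n x = 0"
proof -
  have "pm.subspace {x. coef n x = 0}"
    by (rule pm.subspaceI) (auto simp: coef_add coef_scale coef_zero)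
  moreover have "coef n (Etw u * Kw n' * Fw v) = 0"
    if n': "n' \<in> lattice_poly tau" "length u + length v + kdeg n' \<le> m" for u n' v
  proof -
    obtain e where "nf (Etw u * Kw n' * Fw v) = Poly_Mapping.single (u, n' - weight u, v) e"
      using nf_Etw by blast
    moreover have "u = [] \<Longrightarrow> n' \<noteq> n"
      using that assms(2) kdeg_int[OF n'(1)] by auto
    ultimately show ?thesis by (auto simp: lookup_single when_def)
  qed
  ultimately have "SS m \<subseteq> {x. coef n x = 0}"
    unfolding SS_def by (intro pm.span_minimal) (auto intro: coef_II)
  then show ?thesis using FF_SS[OF assms(1)] by auto
qed

text \<open>Consequently the torus coefficients of top degree are functionals on the graded piece of
  degree \<open>m\<close>. For \<open>m = 0\<close> the step below is zero in \<open>U\<close>, that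
  is, \<open>II\<close>.\<close>

lemma coef_FP: "x \<in> FP m \<Longrightarrow> int m = - coord_sum n \<Longrightarrow> coef n x = 0"
  by (cases m) (auto simp: FP_def coef_II intro: coef_FF)

section \<open>The negative Heisenberg double\<close>

abbreviation HH where "HH \<equiv> Heis chi J tau"
abbreviation hs where "hs \<equiv> H_scalar chi J tau"

definition gcos :: "nat \<Rightarrow> ('n gen, 'k) free_alg \<Rightarrow> ('n gen, 'k) free_alg set set" where
  "gcos m x = fil_pred UU fil m +>\<^bsub>UU\<^esub> cl x"

lemma gcos_eq_image: "gcos m x = {cl y | y. y - x \<in> FP m}"
proof -
  have "gcos m x = {cl (z + x) | z. z \<in> FP m}"
    by (auto simp: gcos_def fil_pred_cl a_r_coset_def')
  also have "\<dots> = {cl y | y. y - x \<in> FP m}"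
    by (metis (no_types, opaque_lifting) add_diff_cancel diff_add_cancel)
  finally show ?thesis .
qed

lemma cl_in_gcos: "cl y \<in> gcos m x \<longleftrightarrow> y - x \<in> FP m"
proof
  assume "cl y \<in> gcos m x"
  then obtain z where "y - z \<in> II" "z - x \<in> FP m" by (auto simp: gcos_eq_image cl_eq_iff)
  then have "(y - z) + (z - x) \<in> FP m" by (rule pm.subspace_add[OF FP_subspace FP_II])
  then show "y - x \<in> FP m" by simp
qed (auto simp: gcos_eq_image)

lemma gcos_eq_iff: "gcos m x = gcos m y \<longleftrightarrow> x - y \<in> FP m"
proof
  assume "gcos m x = gcos m y"
  moreover have "cl x \<in> gcos m x" by (simp add: cl_in_gcos pm.subspace_0[OF FP_subspace])
  ultimately show "x - y \<in> FP m" by (simp add: cl_in_gcos)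
next
  assume xy: "x - y \<in> FP m"
  have "z - x \<in> FP m \<longleftrightarrow> z - y \<in> FP m" for z
    using pm.subspace_add[OF FP_subspace xy, of "z - x"] pm.subspace_diff[OF FP_subspace _ xy, of "z - y"]
    by (auto simp: algebra_simps)
  then show "gcos m x = gcos m y" by (simp add: gcos_eq_image)
qed

lemma fil_pred_gcos: "fil_pred UU fil m = gcos m 0"
  by (auto simp: fil_pred_cl gcos_eq_image)

definition Gam :: "(nat \<Rightarrow> ('n gen, 'k) free_alg) \<Rightarrow> nat \<Rightarrow> ('n gen, 'k) free_alg set set" where
  "Gam y = (\<lambda>m. gcos m (y m))"

text \<open>Finiteness is required modulo the lower step only, since the representative of a zero
  coset need not be zero.\<close>

definition fam :: "(nat \<Rightarrow> ('n gen, 'k) free_alg) \<Rightarrow> bool" where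
  "fam y \<longleftrightarrow> (\<forall>m. y m \<in> FF m) \<and> finite {m. y m \<notin> FP m}"

lemma fam_FF: "fam y \<Longrightarrow> y m \<in> FF m"
  by (simp add: fam_def)

lemma Gam_eq_iff: "Gam y = Gam z \<longleftrightarrow> (\<forall>m. y m - z m \<in> FP m)"
  by (simp add: Gam_def fun_eq_iff gcos_eq_iff)

lemma carrier_HH: "carrier HH = Gam ` {y. fam y}"
proof (intro equalityI subsetI)
  fix f assume "f \<in> carrier HH"
  then have f: "\<forall>m. \<exists>u\<in>fil m. f m = fil_pred UU fil m +>\<^bsub>UU\<^esub> u" "finite {m. f m \<noteq> fil_pred UU fil m}"
    by (simp_all add: Heis_def assoc_graded_def)
  have "\<forall>m. \<exists>y. y \<in> FF m \<and> f m = gcos m y"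
    using f(1) by (auto simp: fil_cl gcos_def)
  then obtain y where y: "\<And>m. y m \<in> FF m" "\<And>m. f m = gcos m (y m)" by metis
  have "{m. y m \<notin> FP m} = {m. f m \<noteq> fil_pred UU fil m}"
    by (auto simp: y(2) fil_pred_gcos gcos_eq_iff)
  then have "fam y" using y(1) f(2) by (simp add: fam_def)
  moreover have "f = Gam y" by (simp add: Gam_def fun_eq_iff y(2))
  ultimately show "f \<in> Gam ` {y. fam y}" by blast
next
  fix f assume "f \<in> Gam ` {y. fam y}"
  then obtain y where y: "fam y" "f = Gam y" by auto
  have "{m. y m \<notin> FP m} = {m. f m \<noteq> fil_pred UU fil m}"
    by (auto simp: y(2) Gam_def fil_pred_gcos gcos_eq_iff)
  with y show "f \<in> carrier HH"
    by (auto simp: Heis_def assoc_graded_def fam_def Gam_def fil_cl gcos_def)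
qed

lemma Gam_closed: "fam y \<Longrightarrow> Gam y \<in> carrier HH"
  by (simp add: carrier_HH)

lemma add_Gam: "Gam y \<oplus>\<^bsub>HH\<^esub> Gam z = Gam (\<lambda>m. y m + z m)"
proof -
  have "gcos m x <+>\<^bsub>UU\<^esub> gcos m y = gcos m (x + y)" for m x y
  proof (intro equalityI subsetI)
    fix w assume "w \<in> gcos m x <+>\<^bsub>UU\<^esub> gcos m y"
    then obtain a b where w: "w = cl (a + b)" and ab: "a - x \<in> FP m" "b - y \<in> FP m"
      by (auto simp: set_add_def' gcos_eq_image)
    from pm.subspace_add[OF FP_subspace ab] have "a + b - (x + y) \<in> FP m"
      by (simp add: algebra_simps)
    then show "w \<in> gcos m (x + y)" by (simp add: w cl_in_gcos)
  next
    fix w assume "w \<in> gcos m (x + y)"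
    then obtain a where w: "w = cl a" and a: "a - (x + y) \<in> FP m" by (auto simp: gcos_eq_image)
    have "cl (a - y) \<in> gcos m x" "cl y \<in> gcos m y"
      using a by (simp_all add: cl_in_gcos algebra_simps pm.subspace_0[OF FP_subspace])
    moreover have "w = cl (a - y) \<oplus>\<^bsub>UU\<^esub> cl y" by (simp add: w)
    ultimately show "w \<in> gcos m x <+>\<^bsub>UU\<^esub> gcos m y" unfolding set_add_def' by blast
  qed
  then show ?thesis by (simp add: Heis_def assoc_graded_def Gam_def fun_eq_iff)
qed

definition conv :: "(nat \<Rightarrow> ('n gen, 'k) free_alg) \<Rightarrow> (nat \<Rightarrow> ('n gen, 'k) free_alg) \<Rightarrow> nat \<Rightarrow> ('n gen, 'k) free_alg" where
  "conv y z m = (\<Sum>j\<le>m. y j * z (m - j))"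

lemma mult_Gam:
  assumes y: "\<And>m. y m \<in> FF m" and z: "\<And>m. z m \<in> FF m"
  shows "Gam y \<otimes>\<^bsub>HH\<^esub> Gam z = Gam (conv y z)"
proof
  fix m
  have *: "fil_pred UU fil m +>\<^bsub>UU\<^esub> (\<Oplus>\<^bsub>UU\<^esub>j\<in>{..m}. f j \<otimes>\<^bsub>UU\<^esub> g (m - j)) = gcos m (conv y z m)"
    if f: "f \<in> Pi UNIV (Gam y)" and g: "g \<in> Pi UNIV (Gam z)" for f g
  proof -
    have "\<forall>j. \<exists>a. f j = cl a \<and> a - y j \<in> FP j" "\<forall>j. \<exists>a. g j = cl a \<and> a - z j \<in> FP j"
      using f g by (auto simp: Pi_iff Gam_def gcos_eq_image)
    then obtain f' g' where f': "\<And>j. f j = cl (f' j)" "\<And>j. f' j - y j \<in> FP j"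
      and g': "\<And>j. g j = cl (g' j)" "\<And>j. g' j - z j \<in> FP j" by metis
    have f'FF: "f' j \<in> FF j" for j
      using pm.subspace_add[OF FF_subspace FP_FF[OF f'(2)] y, of j] by simp
    have "f' j * g' (m - j) - y j * z (m - j) \<in> FP m" if "j \<le> m" for j
    proof -
      \<comment> \<open>The difference of the two products, split so that each term has one factor
        in a lower filtration step.\<close>
      have "f' j * (g' (m - j) - z (m - j)) + (f' j - y j) * z (m - j) \<in> FP (j + (m - j))"
        by (intro pm.subspace_add[OF FP_subspace] FP_mult_left FP_mult_right f'(2) g'(2) f'FF z)
      then show ?thesis using that by (simp add: algebra_simps)
    qed
    then have "(\<Sum>j\<le>m. f' j * g' (m - j)) - conv y z m \<in> FP m"
      unfolding conv_def sum_subtractf[symmetric] by (intro pm.subspace_sum[OF FP_subspace]) auto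
    moreover have "(\<Oplus>\<^bsub>UU\<^esub>j\<in>{..m}. f j \<otimes>\<^bsub>UU\<^esub> g (m - j)) = cl (\<Sum>j\<le>m. f' j * g' (m - j))"
      by (simp add: f'(1) g'(1) finsum_cl)
    ultimately show ?thesis by (simp add: gcos_def[symmetric] gcos_eq_iff)
  qed
  \<comment> \<open>At least one choice of representatives exists, so the union in the definition of
    the product is the common coset and not empty.\<close>
  have "(\<lambda>j. cl (y j)) \<in> Pi UNIV (Gam y)" "(\<lambda>j. cl (z j)) \<in> Pi UNIV (Gam z)"
    by (auto simp: Gam_def cl_in_gcos pm.subspace_0[OF FP_subspace])
  with * show "(Gam y \<otimes>\<^bsub>HH\<^esub> Gam z) m = Gam (conv y z) m"
    by (auto simp: Heis_def assoc_graded_def Gam_def)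
qed

lemma fam_zero: "fam (\<lambda>_. 0)"
  by (simp add: fam_def pm.subspace_0[OF FP_subspace])

lemma fam_add: "fam y \<Longrightarrow> fam z \<Longrightarrow> fam (\<lambda>m. y m + z m)"
proof -
  assume y: "fam y" and z: "fam z"
  have "{m. y m + z m \<notin> FP m} \<subseteq> {m. y m \<notin> FP m} \<union> {m. z m \<notin> FP m}"
    by (auto intro: pm.subspace_add[OF FP_subspace])
  then show ?thesis using y z
    by (auto simp: fam_def intro: pm.subspace_add[OF FF_subspace] finite_subset)
qed

lemma fam_scale: "fam y \<Longrightarrow> fam (\<lambda>m. pscale d (y m))"
proof -
  assume y: "fam y"
  have "{m. pscale d (y m) \<notin> FP m} \<subseteq> {m. y m \<notin> FP m}"
    by (auto intro: pm.subspace_scale[OF FP_subspace])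
  then show ?thesis using y
    by (auto simp: fam_def intro: pm.subspace_scale[OF FF_subspace] finite_subset)
qed

lemma fam_neg: "fam y \<Longrightarrow> fam (\<lambda>m. - y m)"
  using fam_scale[of y "-1"] by simp

lemma fam_conv:
  assumes "fam y" "fam z"
  shows "fam (conv y z)"
proof -
  from assms obtain a b where a: "\<And>m. y m \<notin> FP m \<Longrightarrow> m < a" and b: "\<And>m. z m \<notin> FP m \<Longrightarrow> m < b"
    using finite_nat_set_iff_bounded by (auto simp: fam_def)
  have "conv y z m \<in> FF m" for m
    unfolding conv_def
  proof (rule pm.subspace_sum[OF FF_subspace])
    fix j assume "j \<in> {..m}"
    then show "y j * z (m - j) \<in> FF m"
      using FF_mult[of "y j" j "z (m - j)" "m - j"] assms by (simp add: fam_def)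
  qed
  \<comment> \<open>Either \<open>j\<close> reaches the bound \<open>a\<close> or
    \<open>m - j\<close> reaches the bound \<open>b\<close>, so every product has a factor in the
    lower step.\<close>
  moreover have "conv y z m \<in> FP m" if m: "a + b \<le> m" for m
    unfolding conv_def
  proof (rule pm.subspace_sum[OF FP_subspace])
    fix j assume j: "j \<in> {..m}"
    have "y j \<in> FP j \<or> z (m - j) \<in> FP (m - j)"
      using a[of j] b[of "m - j"] m j by (cases "y j \<in> FP j"; cases "z (m - j) \<in> FP (m - j)") auto
    then have "y j * z (m - j) \<in> FP (j + (m - j))"
      using FP_mult_left FP_mult_right fam_FF[OF assms(1)] fam_FF[OF assms(2)] by blast
    then show "y j * z (m - j) \<in> FP m" using j by simp
  qed
  then have "{m. conv y z m \<notin> FP m} \<subseteq> {..<a + b}" by (auto simp: not_le[symmetric])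
  ultimately show ?thesis using finite_subset by (auto simp: fam_def)
qed

lemma zero_HH: "\<zero>\<^bsub>HH\<^esub> = Gam (\<lambda>_. 0)"
  by (simp add: Heis_def assoc_graded_def Gam_def fun_eq_iff fil_pred_gcos)

sublocale HA: abelian_group HH
proof (rule abelian_groupI)
  fix x assume "x \<in> carrier HH"
  then obtain y where y: "fam y" "x = Gam y" by (auto simp: carrier_HH)
  then have "Gam (\<lambda>m. - y m) \<in> carrier HH" "Gam (\<lambda>m. - y m) \<oplus>\<^bsub>HH\<^esub> x = \<zero>\<^bsub>HH\<^esub>"
    by (simp_all add: Gam_closed fam_neg add_Gam zero_HH)
  then show "\<exists>y\<in>carrier HH. y \<oplus>\<^bsub>HH\<^esub> x = \<zero>\<^bsub>HH\<^esub>" by blast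
qed (auto simp: carrier_HH add_Gam zero_HH algebra_simps fam_zero intro!: imageI fam_add)

lemma a_inv_Gam: "fam y \<Longrightarrow> \<ominus>\<^bsub>HH\<^esub> Gam y = Gam (\<lambda>m. - y m)"
  by (rule HA.minus_equality) (auto simp: add_Gam zero_HH intro!: Gam_closed fam_neg)

lemma minus_Gam: "fam y \<Longrightarrow> fam z \<Longrightarrow> Gam y \<ominus>\<^bsub>HH\<^esub> Gam z = Gam (\<lambda>m. y m - z m)"
  by (simp add: a_minus_def a_inv_Gam add_Gam)

definition conc :: "nat \<Rightarrow> ('n gen, 'k) free_alg \<Rightarrow> nat \<Rightarrow> ('n gen, 'k) free_alg" where
  "conc d x = (\<lambda>m. if m = d then x else 0)"

lemma fam_conc: "x \<in> FF d \<Longrightarrow> fam (conc d x)"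
proof -
  assume x: "x \<in> FF d"
  have "{m. conc d x m \<notin> FP m} \<subseteq> {d}" by (auto simp: conc_def pm.subspace_0[OF FP_subspace])
  from finite_subset[OF this] show ?thesis using x by (auto simp: fam_def) (auto simp: conc_def)
qed

lemma H_class_eq: "H_class chi J tau d (cl x) = Gam (conc d x)"
  by (simp add: H_class_def gr_class_def Gam_def fun_eq_iff conc_def gcos_def[symmetric] fil_pred_gcos[symmetric])

lemma conc_add: "(\<lambda>m. conc d x m + conc d y m) = conc d (x + y)"
  by (auto simp: conc_def)

lemma conv_conc: "conv (conc d x) (conc e y) = conc (d + e) (x * y)"
proof
  fix m
  have "conv (conc d x) (conc e y) m = (\<Sum>j\<le>m. if j = d then (if m - d = e then x * y else 0) else 0)"
    unfolding conv_def by (rule sum.cong) (auto simp: conc_def)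
  then show "conv (conc d x) (conc e y) m = conc (d + e) (x * y) m"
    by (auto simp: conc_def)
qed

lemma conv_const: "conv (conc 0 (const d)) y = (\<lambda>m. pscale d (y m))"
proof
  fix m
  have "conv (conc 0 (const d)) y m = (\<Sum>j\<le>m. if j = 0 then const d * y m else 0)"
    unfolding conv_def by (rule sum.cong) (auto simp: conc_def)
  then show "conv (conc 0 (const d)) y m = pscale d (y m)"
    by (simp add: const_mult)
qed

lemma mult_conc: "x \<in> FF d \<Longrightarrow> y \<in> FF e \<Longrightarrow> Gam (conc d x) \<otimes>\<^bsub>HH\<^esub> Gam (conc e y) = Gam (conc (d + e) (x * y))"
  using mult_Gam[of "conc d x" "conc e y"] fam_FF[OF fam_conc] by (simp add: conv_conc)

lemma hs_eq: "hs d = Gam (conc 0 (const d))"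
  by (simp add: H_scalar_def sc_cl H_class_eq)

lemma hs_mult: "(\<And>m. y m \<in> FF m) \<Longrightarrow> hs d \<otimes>\<^bsub>HH\<^esub> Gam y = Gam (\<lambda>m. pscale d (y m))"
  unfolding hs_eq using mult_Gam[of "conc 0 (const d)" y] fam_FF[OF fam_conc[OF FF_const]]
  by (simp add: conv_const)

lemma scale_conc: "(\<lambda>m. pscale d (conc e x m)) = conc e (pscale d x)"
  by (auto simp: conc_def)

lemma one_HH: "\<one>\<^bsub>HH\<^esub> = Gam (conc 0 1)"
  using H_class_eq[of 0 1] by (simp add: Heis_def assoc_graded_def H_class_def one_cl)

lemma word_prod_conc:
  assumes "\<And>i. f i \<in> FF 1"
  shows "prod_list (map f w) \<in> FF (length w)"
    and "word_prod HH (\<lambda>i. Gam (conc 1 (f i))) w = Gam (conc (length w) (prod_list (map f w)))"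
proof (induction w)
  case Nil
  show "prod_list (map f []) \<in> FF (length [])" by (simp add: FF_one)
  show "word_prod HH (\<lambda>i. Gam (conc 1 (f i))) [] = Gam (conc (length []) (prod_list (map f [])))"
    by (simp add: word_prod_def one_HH)
next
  case (Cons i w)
  show "prod_list (map f (i # w)) \<in> FF (length (i # w))"
    using FF_mult[OF assms[of i] Cons(1)] by simp
  show "word_prod HH (\<lambda>i. Gam (conc 1 (f i))) (i # w) = Gam (conc (length (i # w)) (prod_list (map f (i # w))))"
    using mult_conc[OF assms[of i] Cons(1)] Cons(2) by (simp add: word_prod_def)
qed

lemma finsum_Gam:
  assumes "finite S" "\<And>a. a \<in> S \<Longrightarrow> fam (y a)"
  shows "finsum HH (\<lambda>a. Gam (y a)) S = Gam (\<lambda>m. \<Sum>a\<in>S. y a m)" and "fam (\<lambda>m. \<Sum>a\<in>S. y a m)"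
  using assms
proof (induction S)
  case (insert a S)
  case 1
  with insert show ?case by (auto simp: add_Gam intro!: HA.finsum_insert[THEN trans] Gam_closed)
next
  case (insert a S)
  case 2
  with insert show ?case by (auto intro: fam_add)
qed (auto simp: zero_HH fam_zero)

text \<open>All words of \<open>p\<close> have the same length, so the value is concentrated in one
  degree and represented by the evaluation in the free algebra.\<close>

lemma nc_eval_conc:
  assumes f: "\<And>i. f i \<in> FF 1" and p: "\<And>w. w \<in> Poly_Mapping.keys p \<Longrightarrow> length w = d"
  shows "nc_eval HH hs (\<lambda>i. Gam (conc 1 (f i))) p = Gam (conc d (alg_eval f p))"
    and "alg_eval f p \<in> FF d"
proof -
  let ?t = "\<lambda>w. pscale (Poly_Mapping.lookup p w) (prod_list (map f w))"
  have w: "prod_list (map f w) \<in> FF d" if "w \<in> Poly_Mapping.keys p" for w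
    using word_prod_conc(1)[OF f, where w = w] p[OF that] by simp
  have t: "?t w \<in> FF d" if "w \<in> Poly_Mapping.keys p" for w
    by (intro pm.subspace_scale[OF FF_subspace] w that)
  have trm: "hs (Poly_Mapping.lookup p w) \<otimes>\<^bsub>HH\<^esub> word_prod HH (\<lambda>i. Gam (conc 1 (f i))) w = Gam (conc d (?t w))"
    if "w \<in> Poly_Mapping.keys p" for w
    using hs_mult[OF fam_FF[OF fam_conc[OF w[OF that]]]] word_prod_conc(2)[OF f, where w = w] p[OF that]
    by (simp add: scale_conc)
  have "nc_eval HH hs (\<lambda>i. Gam (conc 1 (f i))) p = finsum HH (\<lambda>w. Gam (conc d (?t w))) (Poly_Mapping.keys p)"
    unfolding nc_eval_def by (rule HA.finsum_cong') (auto simp: trm simp del: One_nat_def intro!: Gam_closed fam_conc t)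
  also have "\<dots> = Gam (\<lambda>m. \<Sum>w\<in>Poly_Mapping.keys p. conc d (?t w) m)"
    by (rule finsum_Gam) (auto intro: fam_conc t)
  also have "(\<lambda>m. \<Sum>w\<in>Poly_Mapping.keys p. conc d (?t w) m) = conc d (alg_eval f p)"
    by (auto simp: conc_def alg_eval_def plin_def)
  finally show "nc_eval HH hs (\<lambda>i. Gam (conc 1 (f i))) p = Gam (conc d (alg_eval f p))" .
  show "alg_eval f p \<in> FF d"
    unfolding alg_eval_def by (rule plin_in_subspace[OF FF_subspace w])
qed

text \<open>One representing family inside \<open>A\<close> suffices; vanishing of coefficients
  cannot be demanded of all representatives, because their lower terms are arbitrary.\<close>

definition ZZ :: "('n gen, 'k) free_alg set \<Rightarrow> (nat \<Rightarrow> ('n gen, 'k) free_alg set set) set" where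
  "ZZ A = {Gam y | y. fam y \<and> (\<forall>m. y m \<in> A)}"

lemma ZZ_carrier: "ZZ A \<subseteq> carrier HH"
  by (auto simp: ZZ_def Gam_closed)

lemma lin_span_carrier: "S \<subseteq> carrier HH \<Longrightarrow> lin_span HH hs S \<subseteq> carrier HH"
proof -
  assume S: "S \<subseteq> carrier HH"
  have "{hs d \<otimes>\<^bsub>HH\<^esub> x | d x. x \<in> S} \<subseteq> carrier HH"
  proof (clarify)
    fix d x assume "x \<in> S"
    then obtain y where "fam y" "x = Gam y" using S by (auto simp: carrier_HH)
    then show "hs d \<otimes>\<^bsub>HH\<^esub> x \<in> carrier HH" by (simp add: hs_mult fam_FF Gam_closed fam_scale)
  qed
  then show ?thesis
    unfolding lin_span_def using group.generate_incl[OF HA.a_group] by simp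
qed

lemma lin_span_zero: "\<zero>\<^bsub>HH\<^esub> \<in> lin_span HH hs S"
  unfolding lin_span_def using generate.one[of "add_monoid HH"] by simp

lemma lin_span_add: "x \<in> lin_span HH hs S \<Longrightarrow> y \<in> lin_span HH hs S \<Longrightarrow> x \<oplus>\<^bsub>HH\<^esub> y \<in> lin_span HH hs S"
  unfolding lin_span_def using generate.eng[of x "add_monoid HH" _ y] by simp

lemma lin_span_base: "x \<in> S \<Longrightarrow> hs d \<otimes>\<^bsub>HH\<^esub> x \<in> lin_span HH hs S"
  unfolding lin_span_def by (rule generate.incl) blast

lemma lin_span_ZZ:
  assumes A: "pm.subspace A" and S: "S \<subseteq> ZZ A"
  shows "lin_span HH hs S \<subseteq> ZZ A"
proof
  have sc: "hs d \<otimes>\<^bsub>HH\<^esub> x \<in> ZZ A" if x: "x \<in> S" for d x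
  proof -
    obtain y where "fam y" "\<And>m. y m \<in> A" "x = Gam y" using x S unfolding ZZ_def by blast
    then show ?thesis
      by (auto simp: hs_mult fam_FF ZZ_def intro!: exI[of _ "\<lambda>m. pscale d (y m)"] fam_scale pm.subspace_scale[OF A])
  qed
  fix u assume "u \<in> lin_span HH hs S"
  then have "u \<in> generate (add_monoid HH) {hs d \<otimes>\<^bsub>HH\<^esub> x | d x. x \<in> S}" by (simp add: lin_span_def)
  then show "u \<in> ZZ A"
  proof (induction rule: generate.induct)
    case one
    then show ?case using fam_zero pm.subspace_0[OF A] by (auto simp: ZZ_def zero_HH)
  next
    case (incl h)
    then show ?case using sc by auto
  next
    case (inv h)
    then have "h \<in> ZZ A" using sc by auto
    then obtain y where y: "fam y" "\<And>m. y m \<in> A" "h = Gam y" by (auto simp: ZZ_def)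
    then have "inv\<^bsub>add_monoid HH\<^esub> h = Gam (\<lambda>m. - y m)"
      using a_inv_Gam[of y] by (simp add: a_inv_def)
    then show ?case using y by (auto simp: ZZ_def intro!: exI[of _ "\<lambda>m. - y m"] fam_neg pm.subspace_neg[OF A])
  next
    case (eng h1 h2)
    then obtain y z where "fam y" "\<And>m. y m \<in> A" "h1 = Gam y" "fam z" "\<And>m. z m \<in> A" "h2 = Gam z"
      by (auto simp: ZZ_def)
    then show ?case
      by (auto simp: ZZ_def add_Gam intro!: exI[of _ "\<lambda>m. y m + z m"] fam_add pm.subspace_add[OF A])
  qed
qed

lemma conc_ZZ: "x \<in> FF d \<Longrightarrow> x \<in> A \<Longrightarrow> pm.subspace A \<Longrightarrow> Gam (conc d x) \<in> ZZ A"
  unfolding ZZ_def using pm.subspace_0[of A]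
  by (intro CollectI exI[of _ "conc d x"] conjI refl fam_conc allI) (auto simp: conc_def)

text \<open>\<open>AE\<close> and \<open>AF\<close> quantify over a second factor because the kernel
  is built from products with an augmentation ideal on one side; such products land in
  \<open>A0\<close>.\<close>

definition A0 where "A0 = {x. \<forall>n. coef n x = 0}"
definition AE where "AE = {x. \<forall>y n. coef n (x * y) = 0}"
definition AF where "AF = {x. \<forall>y n. coef n (y * x) = 0}"

lemma A_subspaces: "pm.subspace A0" "pm.subspace AE" "pm.subspace AF"
  by (rule pm.subspaceI;
      simp add: A0_def AE_def AF_def coef_add coef_scale coef_zero distrib_left distrib_right
        pscale_mult_left pscale_mult_right)+

text \<open>A leading \<open>E_i\<close> acts last and only prepends a letter to the first word, so
  that word is never empty in the result.\<close>

lemma Etw_AE: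
  assumes "u \<noteq> []"
  shows "Etw u \<in> AE"
proof -
  obtain i w where u: "u = i # w" using assms by (cases u) auto
  have "coef n (kE i * x) = 0" for x n
  proof -
    have "Poly_Mapping.lookup (opE i z) ([], n, []) = 0" for z
    proof -
      have "opE i z \<in> {p. \<forall>a\<in>Poly_Mapping.keys p. fst a \<noteq> []}"
        by (rule plinear_in_subspace[OF plinear_ops(1) subspace_supported]) (auto split: prod.splits)
      then show ?thesis by (force simp: in_keys_iff)
    qed
    then show ?thesis by (simp add: nf_mult)
  qed
  then show ?thesis by (simp add: AE_def u Et_def mult.assoc)
qed

text \<open>No operator shortens the third word: \<open>E_i\<close> and the torus leave it alone,
  while \<open>F_i\<close> either lengthens it or contracts within the first word.\<close>

lemma Fw_AF:
  assumes "v \<noteq> []"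
  shows "Fw v \<in> AF"
proof -
  let ?S = "{p :: ('n, 'k) pbw. \<forall>a\<in>Poly_Mapping.keys p. snd (snd a) \<noteq> []}"
  have S: "pm.subspace ?S" by (rule subspace_supported)
  have basisF: "basisF i u m v \<in> ?S" if "v \<noteq> []" for i u m v
    using that
  proof (induction u)
    case (Cons j u)
    have E: "opE j x \<in> ?S" if "x \<in> ?S" for x
      unfolding opE_def by (rule plin_in_subspace[OF S]) (use that in \<open>auto split: prod.splits\<close>)
    show ?case
      using Cons by (simp del: mem_Collect_eq) (intro conjI impI pm.subspace_diff[OF S] E; simp)
  qed simp
  have gen: "plin f x \<in> ?S" if "x \<in> ?S" "\<And>u m v. v \<noteq> [] \<Longrightarrow> f (u, m, v) \<in> ?S" for f x
  proof (rule plin_in_subspace[OF S])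
    fix a assume a: "a \<in> Poly_Mapping.keys x"
    obtain u m v where a_eq: "a = (u, m, v)" by (cases a)
    then have "v \<noteq> []" using that(1) a by auto
    from that(2)[OF this] show "f a \<in> ?S" by (simp only: a_eq)
  qed
  have op: "op g x \<in> ?S" if "x \<in> ?S" for g x
    by (cases g; simp only: op.simps opE_def opF_def opK_def opKi_def; rule gen[OF that])
       (use basisF in auto)
  have foldr: "foldr op w x \<in> ?S" if "x \<in> ?S" for w x
    by (induction w) (use that op in \<open>simp_all del: mem_Collect_eq\<close>)
  have "nf (y * Fw v) \<in> ?S" for y
  proof -
    have "nf (y * Fw v) = acts y (Poly_Mapping.single ([], 0, v) 1)"
      by (simp add: nf_def vac_def acts_mult acts_Fw)
    also have "\<dots> \<in> ?S"
      unfolding act_def by (rule plin_in_subspace[OF S], rule foldr) (use assms in simp)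
    finally show ?thesis .
  qed
  then show ?thesis by (force simp: AF_def in_keys_iff)
qed

lemma H_E_eq: "H_E chi J tau = (\<lambda>i. Gam (conc 1 (Et i)))"
  and H_F_eq: "H_F chi J tau = (\<lambda>i. Gam (conc 1 (kF i)))"
  and H_K_eq: "H_K chi J tau m = Gam (conc (kdeg m) (Kw m))"
  by (simp_all add: fun_eq_iff H_E_def H_F_def H_K_def poly_gen_value_cl pgv_def H_class_eq U_K_cl
      kdeg_def coord_sum_def del: poly_gen_value.simps)

lemma Et_FF: "Et i \<in> FF 1" and kF_FF: "kF i \<in> FF 1"
  using FF_gen[of "pE i"] FF_gen[of "pF i"] by (simp_all add: pgv_def)

lemma word_prod_E: "word_prod HH (H_E chi J tau) u = Gam (conc (length u) (Etw u))"
  and Etw_FF: "Etw u \<in> FF (length u)"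
  using word_prod_conc[of Et, OF Et_FF] by (simp_all add: H_E_eq Etw_def)

lemma word_prod_F: "word_prod HH (H_F chi J tau) v = Gam (conc (length v) (Fw v))"
  and Fw_FF: "Fw v \<in> FF (length v)"
  using word_prod_conc[of kF, OF kF_FF] by (simp_all add: H_F_eq prod_list_kF)

definition KerE where "KerE = {g \<otimes>\<^bsub>HH\<^esub> x | g x. g \<in> G_plus_aug chi J tau \<and> x \<in> carrier HH}"
definition KerF where "KerF = {x \<otimes>\<^bsub>HH\<^esub> y | x y. x \<in> carrier HH \<and> y \<in> U_minus_aug chi J tau}"

lemma Heis_kernel_eq:
  "Heis_kernel chi J tau = lin_span HH hs KerE <+>\<^bsub>HH\<^esub> lin_span HH hs KerF"
  by (simp add: Heis_kernel_def KerE_def KerF_def)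

lemma G_plus_aug_ZZ: "G_plus_aug chi J tau \<subseteq> ZZ AE"
  unfolding G_plus_aug_def
  by (rule lin_span_ZZ) (auto simp: A_subspaces word_prod_E intro!: conc_ZZ Etw_FF Etw_AE)

lemma U_minus_aug_ZZ: "U_minus_aug chi J tau \<subseteq> ZZ AF"
  unfolding U_minus_aug_def
  by (rule lin_span_ZZ) (auto simp: A_subspaces word_prod_F intro!: conc_ZZ Fw_FF Fw_AF)

lemma KerE_ZZ: "KerE \<subseteq> ZZ A0"
proof
  fix w assume "w \<in> KerE"
  then obtain g x where w: "w = g \<otimes>\<^bsub>HH\<^esub> x" "g \<in> ZZ AE" "x \<in> carrier HH"
    using G_plus_aug_ZZ by (auto simp: KerE_def)
  then obtain y z where "fam y" "\<And>m. y m \<in> AE" "g = Gam y" "fam z" "x = Gam z"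
    by (auto simp: ZZ_def carrier_HH)
  then show "w \<in> ZZ A0"
    unfolding ZZ_def w(1)
    by (intro CollectI exI[of _ "conv y z"])
       (auto simp: mult_Gam fam_FF fam_conv conv_def A0_def AE_def coef_sum)
qed

lemma KerF_ZZ: "KerF \<subseteq> ZZ A0"
proof
  fix w assume "w \<in> KerF"
  then obtain g x where w: "w = g \<otimes>\<^bsub>HH\<^esub> x" "x \<in> ZZ AF" "g \<in> carrier HH"
    using U_minus_aug_ZZ by (auto simp: KerF_def)
  then obtain y z where "fam y" "\<And>m. z m \<in> AF" "g = Gam y" "fam z" "x = Gam z"
    by (auto simp: ZZ_def carrier_HH)
  then show "w \<in> ZZ A0"
    unfolding ZZ_def w(1)
    by (intro CollectI exI[of _ "conv y z"])
       (auto simp: mult_Gam fam_FF fam_conv conv_def A0_def AF_def coef_sum)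
qed

lemma Heis_kernel_ZZ: "Heis_kernel chi J tau \<subseteq> ZZ A0"
proof
  fix w assume "w \<in> Heis_kernel chi J tau"
  then obtain a b where w: "w = a \<oplus>\<^bsub>HH\<^esub> b" and ab: "a \<in> lin_span HH hs KerE" "b \<in> lin_span HH hs KerF"
    by (auto simp: Heis_kernel_eq set_add_def')
  have "a \<in> ZZ A0" "b \<in> ZZ A0"
    using ab lin_span_ZZ[OF A_subspaces(1) KerE_ZZ] lin_span_ZZ[OF A_subspaces(1) KerF_ZZ] by auto
  then obtain y z where "fam y" "\<And>m. y m \<in> A0" "a = Gam y" "fam z" "\<And>m. z m \<in> A0" "b = Gam z"
    by (auto simp: ZZ_def)
  then show "w \<in> ZZ A0"
    by (auto simp: w ZZ_def add_Gam intro!: exI[of _ "\<lambda>m. y m + z m"] fam_add pm.subspace_add[OF A_subspaces(1)])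
qed

section \<open>The projection of the Heisenberg double on homogeneous classes\<close>

definition tor :: "('n lat \<Rightarrow>\<^sub>0 'k) \<Rightarrow> nat \<Rightarrow> ('n gen, 'k) free_alg" where
  "tor h m = plin (\<lambda>n. conc (kdeg n) (Kw n) m) h"

lemma H_torus_eq:
  assumes "Poly_Mapping.keys h \<subseteq> lattice_poly tau"
  shows "H_torus chi J tau h = Gam (tor h)" and "fam (tor h)"
proof -
  let ?y = "\<lambda>n m. pscale (Poly_Mapping.lookup h n) (conc (kdeg n) (Kw n) m)"
  have K: "fam (conc (kdeg n) (Kw n))" if "n \<in> Poly_Mapping.keys h" for n
    using that assms by (intro fam_conc Kw_poly_FF) auto
  have "H_torus chi J tau h = finsum HH (\<lambda>n. Gam (?y n)) (Poly_Mapping.keys h)"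
    unfolding H_torus_def
    by (rule HA.finsum_cong') (auto simp: H_K_eq hs_mult fam_FF K intro!: Gam_closed fam_scale)
  also have "\<dots> = Gam (\<lambda>m. \<Sum>n\<in>Poly_Mapping.keys h. ?y n m)"
    by (rule finsum_Gam) (auto intro: fam_scale K)
  finally show "H_torus chi J tau h = Gam (tor h)" by (simp add: tor_def[abs_def] plin_def)
  have "fam (\<lambda>m. \<Sum>n\<in>Poly_Mapping.keys h. ?y n m)"
    by (rule finsum_Gam) (auto intro: fam_scale K)
  then show "fam (tor h)" by (simp add: tor_def[abs_def] plin_def)
qed

lemma coef_tor: "coef n (tor h (kdeg n)) = Poly_Mapping.lookup h n"
proof -
  have "coef n (tor h (kdeg n)) = (\<Sum>a\<in>Poly_Mapping.keys h. if a = n then Poly_Mapping.lookup h n else 0)"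
    unfolding tor_def plin_def coef_sum
    by (rule sum.cong) (auto simp: coef_scale conc_def coef_Kw coef_zero)
  then show ?thesis by (cases "Poly_Mapping.lookup h n = 0") (simp_all add: in_keys_iff)
qed

text \<open>Uniqueness half. Kernel elements have representatives without torus coefficients, and in
  degree \<open>kdeg n\<close> the coefficient of \<open>K_n\<close> does not see the lower step; so
  \<open>h\<close> must reproduce the coefficient of the given class.\<close>

lemma kernel_coef:
  assumes x: "x \<in> FF d" and h: "Poly_Mapping.keys h \<subseteq> lattice_poly tau"
    and ker: "Gam (conc d x) \<ominus>\<^bsub>HH\<^esub> H_torus chi J tau h \<in> Heis_kernel chi J tau"
    and n: "n \<in> lattice_poly tau"
  shows "Poly_Mapping.lookup h n = (if kdeg n = d then coef n x else 0)"
proof -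
  have "Gam (\<lambda>m. conc d x m - tor h m) \<in> ZZ A0"
    using ker Heis_kernel_ZZ minus_Gam[OF fam_conc[OF x] H_torus_eq(2)[OF h]] H_torus_eq(1)[OF h] by auto
  then obtain y where y: "\<And>m. y m \<in> A0" "\<And>m. conc d x m - tor h m - y m \<in> FP m"
    by (auto simp: ZZ_def Gam_eq_iff)
  have "coef n (conc d x (kdeg n) - tor h (kdeg n) - y (kdeg n)) = 0"
    by (rule coef_FP[OF y(2) kdeg_int[OF n]])
  moreover have "coef n (y (kdeg n)) = 0" using y(1) by (simp add: A0_def)
  ultimately show ?thesis
    by (auto simp: coef_diff coef_tor conc_def coef_zero)
qed

text \<open>Existence half, in a form closed under addition, so that it can be checked on the
  ordered monomials spanning \<open>SS d\<close>.\<close>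

definition good :: "nat \<Rightarrow> ('n gen, 'k) free_alg \<Rightarrow> bool" where
  "good d x \<longleftrightarrow> x \<in> FF d \<and> (\<exists>h. Poly_Mapping.keys h \<subseteq> lattice_poly tau \<and>
     Gam (conc d x) \<ominus>\<^bsub>HH\<^esub> H_torus chi J tau h \<in> Heis_kernel chi J tau)"

lemma kernel_zero: "\<zero>\<^bsub>HH\<^esub> \<in> Heis_kernel chi J tau"
proof -
  have "\<zero>\<^bsub>HH\<^esub> = \<zero>\<^bsub>HH\<^esub> \<oplus>\<^bsub>HH\<^esub> \<zero>\<^bsub>HH\<^esub>" by simp
  then show ?thesis
    unfolding Heis_kernel_eq set_add_def' using lin_span_zero by blast
qed

lemma KerE_carrier: "lin_span HH hs KerE \<subseteq> carrier HH" and KerF_carrier: "lin_span HH hs KerF \<subseteq> carrier HH"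
  using lin_span_carrier KerE_ZZ KerF_ZZ ZZ_carrier by blast+

lemma kernel_add:
  assumes "x \<in> Heis_kernel chi J tau" "y \<in> Heis_kernel chi J tau"
  shows "x \<oplus>\<^bsub>HH\<^esub> y \<in> Heis_kernel chi J tau"
proof -
  obtain a b where x: "x = a \<oplus>\<^bsub>HH\<^esub> b" and ab: "a \<in> lin_span HH hs KerE" "b \<in> lin_span HH hs KerF"
    using assms(1) by (auto simp: Heis_kernel_eq set_add_def')
  obtain a' b' where y: "y = a' \<oplus>\<^bsub>HH\<^esub> b'" and ab': "a' \<in> lin_span HH hs KerE" "b' \<in> lin_span HH hs KerF"
    using assms(2) by (auto simp: Heis_kernel_eq set_add_def')
  have c: "a \<in> carrier HH" "b \<in> carrier HH" "a' \<in> carrier HH" "b' \<in> carrier HH"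
    using ab ab' KerE_carrier KerF_carrier by auto
  then have "x \<oplus>\<^bsub>HH\<^esub> y = (a \<oplus>\<^bsub>HH\<^esub> a') \<oplus>\<^bsub>HH\<^esub> (b \<oplus>\<^bsub>HH\<^esub> b')"
    by (simp add: x y HA.a_ac)
  then show ?thesis
    unfolding Heis_kernel_eq set_add_def' using ab ab' lin_span_add by blast
qed

lemma kernel_E:
  assumes "u \<noteq> []" "x \<in> FF d"
  shows "Gam (conc (length u + d) (pscale e (Etw u * x))) \<in> Heis_kernel chi J tau"
proof -
  have 1: "hs 1 \<otimes>\<^bsub>HH\<^esub> word_prod HH (H_E chi J tau) u \<in> G_plus_aug chi J tau"
    unfolding G_plus_aug_def by (rule lin_span_base) (use assms(1) in blast)
  have "Gam (conc (length u) (Etw u)) \<otimes>\<^bsub>HH\<^esub> Gam (conc d x) \<in> KerE"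
    unfolding KerE_def
    using 1 fam_FF[OF fam_conc[OF Etw_FF[of u]]] Gam_closed[OF fam_conc[OF assms(2)]]
    by (auto simp: word_prod_E hs_mult)
  then have "hs e \<otimes>\<^bsub>HH\<^esub> Gam (conc (length u + d) (Etw u * x)) \<in> lin_span HH hs KerE"
    by (simp add: mult_conc Etw_FF assms(2) lin_span_base)
  then have 2: "Gam (conc (length u + d) (pscale e (Etw u * x))) \<in> lin_span HH hs KerE"
    using fam_FF[OF fam_conc[OF FF_mult[OF Etw_FF[of u] assms(2)]]] by (simp add: hs_mult scale_conc)
  then have "Gam (conc (length u + d) (pscale e (Etw u * x)))
      = Gam (conc (length u + d) (pscale e (Etw u * x))) \<oplus>\<^bsub>HH\<^esub> \<zero>\<^bsub>HH\<^esub>"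
    using KerE_carrier by auto
  then show ?thesis
    unfolding Heis_kernel_eq set_add_def' using 2 lin_span_zero by blast
qed

lemma kernel_F:
  assumes "v \<noteq> []" "x \<in> FF d"
  shows "Gam (conc (d + length v) (pscale e (x * Fw v))) \<in> Heis_kernel chi J tau"
proof -
  have 1: "hs 1 \<otimes>\<^bsub>HH\<^esub> word_prod HH (H_F chi J tau) v \<in> U_minus_aug chi J tau"
    unfolding U_minus_aug_def by (rule lin_span_base) (use assms(1) in blast)
  have "Gam (conc d x) \<otimes>\<^bsub>HH\<^esub> Gam (conc (length v) (Fw v)) \<in> KerF"
    unfolding KerF_def
    using 1 fam_FF[OF fam_conc[OF Fw_FF[of v]]] Gam_closed[OF fam_conc[OF assms(2)]]
    by (auto simp: word_prod_F hs_mult)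
  then have "hs e \<otimes>\<^bsub>HH\<^esub> Gam (conc (d + length v) (x * Fw v)) \<in> lin_span HH hs KerF"
    by (simp add: mult_conc Fw_FF assms(2) lin_span_base)
  then have 2: "Gam (conc (d + length v) (pscale e (x * Fw v))) \<in> lin_span HH hs KerF"
    using fam_FF[OF fam_conc[OF FF_mult[OF assms(2) Fw_FF[of v]]]] by (simp add: hs_mult scale_conc)
  then have "Gam (conc (d + length v) (pscale e (x * Fw v)))
      = \<zero>\<^bsub>HH\<^esub> \<oplus>\<^bsub>HH\<^esub> Gam (conc (d + length v) (pscale e (x * Fw v)))"
    using KerF_carrier by auto
  then show ?thesis
    unfolding Heis_kernel_eq set_add_def' using 2 lin_span_zero by blast
qed

lemma tor_add: "tor (h + h') m = tor h m + tor h' m"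
  by (simp add: tor_def plin_add)

lemma good_add:
  assumes "good d x" "good d y"
  shows "good d (x + y)"
proof -
  obtain h where h: "x \<in> FF d" "Poly_Mapping.keys h \<subseteq> lattice_poly tau"
     "Gam (conc d x) \<ominus>\<^bsub>HH\<^esub> H_torus chi J tau h \<in> Heis_kernel chi J tau"
    using assms(1) by (auto simp: good_def)
  obtain h' where h': "y \<in> FF d" "Poly_Mapping.keys h' \<subseteq> lattice_poly tau"
     "Gam (conc d y) \<ominus>\<^bsub>HH\<^esub> H_torus chi J tau h' \<in> Heis_kernel chi J tau"
    using assms(2) by (auto simp: good_def)
  have k: "Poly_Mapping.keys (h + h') \<subseteq> lattice_poly tau"
    using h(2) h'(2) Poly_Mapping.keys_add[of h h'] by blast
  have xy: "x + y \<in> FF d" by (rule pm.subspace_add[OF FF_subspace h(1) h'(1)])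
  have "Gam (conc d (x + y)) \<ominus>\<^bsub>HH\<^esub> H_torus chi J tau (h + h')
      = Gam (\<lambda>m. conc d (x + y) m - tor (h + h') m)"
    using H_torus_eq[OF k] minus_Gam fam_conc[OF xy] by simp
  also have "(\<lambda>m. conc d (x + y) m - tor (h + h') m)
      = (\<lambda>m. (conc d x m - tor h m) + (conc d y m - tor h' m))"
    by (simp add: tor_add conc_add[symmetric] fun_eq_iff)
  also have "Gam \<dots> = (Gam (conc d x) \<ominus>\<^bsub>HH\<^esub> H_torus chi J tau h)
      \<oplus>\<^bsub>HH\<^esub> (Gam (conc d y) \<ominus>\<^bsub>HH\<^esub> H_torus chi J tau h')"
    using H_torus_eq[OF h(2)] H_torus_eq[OF h'(2)] minus_Gam fam_conc[OF h(1)] fam_conc[OF h'(1)]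
    by (simp add: add_Gam)
  finally show ?thesis
    using kernel_add[OF h(3) h'(3)] xy k by (auto simp: good_def)
qed

lemma good_kernel:
  assumes "x \<in> FF d" "Gam (conc d x) \<in> Heis_kernel chi J tau"
  shows "good d x"
proof -
  have "H_torus chi J tau 0 = \<zero>\<^bsub>HH\<^esub>" by (simp add: H_torus_def)
  then have "Gam (conc d x) \<ominus>\<^bsub>HH\<^esub> H_torus chi J tau 0 = Gam (conc d x)"
    using Gam_closed[OF fam_conc[OF assms(1)]] by (simp add: a_minus_def)
  then show ?thesis using assms by (auto simp: good_def intro!: exI[of _ 0])
qed

lemma good_FP: "x \<in> FP d \<Longrightarrow> good d x"
proof (rule good_kernel)
  assume x: "x \<in> FP d"
  then show "x \<in> FF d" by (rule FP_FF)
  have "Gam (conc d x) = \<zero>\<^bsub>HH\<^esub>"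
    unfolding zero_HH Gam_eq_iff using x by (auto simp: conc_def pm.subspace_0[OF FP_subspace])
  then show "Gam (conc d x) \<in> Heis_kernel chi J tau" by (simp add: kernel_zero)
qed

text \<open>Below the bound the class is zero. At the bound a nonempty \<open>u\<close> or
  \<open>v\<close> puts the monomial into the kernel, and otherwise it is itself a torus
  element.\<close>

lemma good_base:
  assumes n: "n \<in> lattice_poly tau" and le: "length u + length v + kdeg n \<le> d"
  shows "good d (pscale e (Etw u * Kw n * Fw v))"
proof -
  have KF: "Kw n * Fw v \<in> FF (kdeg n + length v)"
    by (rule FF_mult[OF Kw_poly_FF[OF n] Fw_FF])
  have FF: "pscale e (Etw u * Kw n * Fw v) \<in> FF (length u + length v + kdeg n)"
    using pm.subspace_scale[OF FF_subspace FF_mult[OF Etw_FF[of u] KF], of e]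
    by (simp add: mult.assoc algebra_simps)
  consider "length u + length v + kdeg n < d" | "d = length u + (kdeg n + length v)" "u \<noteq> []"
    | "u = []" "d = kdeg n + length v" "v \<noteq> []" | "u = []" "v = []" "d = kdeg n"
    using le by fastforce
  then show ?thesis
  proof cases
    case 1
    then show ?thesis by (intro good_FP FF_FP[OF _ FF])
  next
    case 2
    show ?thesis
      using kernel_E[OF 2(2) KF, of e] FF by (intro good_kernel) (simp_all add: 2 mult.assoc ac_simps)
  next
    case 3
    show ?thesis
      using kernel_F[OF 3(3) Kw_poly_FF[OF n], of e] FF by (intro good_kernel) (simp_all add: 3 ac_simps)
  next
    case 4
    have k: "Poly_Mapping.keys (Poly_Mapping.single n e) \<subseteq> lattice_poly tau" using n by simp
    have "tor (Poly_Mapping.single n e) = conc d (pscale e (Kw n))"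
      by (simp add: tor_def fun_eq_iff conc_def 4)
    then have "Gam (conc d (pscale e (Kw n))) \<ominus>\<^bsub>HH\<^esub> H_torus chi J tau (Poly_Mapping.single n e) = \<zero>\<^bsub>HH\<^esub>"
      using H_torus_eq[OF k] minus_Gam[of "conc d (pscale e (Kw n))" "conc d (pscale e (Kw n))"]
      by (simp add: zero_HH)
    then show ?thesis
      using FF k kernel_zero by (auto simp: good_def 4 intro!: exI[of _ "Poly_Mapping.single n e"])
  qed
qed

lemma good_FF:
  assumes "x \<in> FF d"
  shows "good d x"
proof -
  have "x \<in> pm.span (II \<union> {Etw u * Kw n * Fw v | u n v.
     n \<in> lattice_poly tau \<and> length u + length v + kdeg n \<le> d})"
    using FF_SS[OF assms] by (simp add: SS_def)
  then show ?thesis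
  proof (induction rule: pm.span_induct_alt)
    case base
    then show ?case by (rule good_FP) (rule pm.subspace_0[OF FP_subspace])
  next
    case (step e s y)
    have "good d (pscale e s)"
      using step(1) good_base II_scale good_FP FP_II by blast
    then show ?case by (rule good_add) (rule step(2))
  qed
qed

text \<open>\<open>good_FF\<close> provides a witness for the definite description and
  \<open>kernel_coef\<close> determines its coefficients, hence also its uniqueness.\<close>

lemma pi00_vee_conc:
  assumes x: "x \<in> FF d"
  shows "Poly_Mapping.keys (pi00_vee chi J tau (Gam (conc d x))) \<subseteq> lattice_poly tau"
    and "n \<in> lattice_poly tau \<Longrightarrow>
      Poly_Mapping.lookup (pi00_vee chi J tau (Gam (conc d x))) n = (if kdeg n = d then coef n x else 0)"
proof -
  obtain h where h: "Poly_Mapping.keys h \<subseteq> lattice_poly tau"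
     "Gam (conc d x) \<ominus>\<^bsub>HH\<^esub> H_torus chi J tau h \<in> Heis_kernel chi J tau"
    using good_FF[OF x] by (auto simp: good_def)
  have "pi00_vee chi J tau (Gam (conc d x)) = h" (is "?h = _")
    unfolding pi00_vee_def
  proof (rule the_equality)
    fix h' assume h': "Poly_Mapping.keys h' \<subseteq> lattice_poly tau \<and>
      Gam (conc d x) \<ominus>\<^bsub>HH\<^esub> H_torus chi J tau h' \<in> Heis_kernel chi J tau"
    show "h' = h"
    proof (rule poly_mapping_eqI)
      fix n
      show "Poly_Mapping.lookup h' n = Poly_Mapping.lookup h n"
      proof (cases "n \<in> lattice_poly tau")
        case True
        then show ?thesis using kernel_coef[OF x] h h' by simp
      next
        case False
        then have "n \<notin> Poly_Mapping.keys h" "n \<notin> Poly_Mapping.keys h'" using h h' by auto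
        then show ?thesis by (simp add: in_keys_iff)
      qed
    qed
  qed (use h in auto)
  with h kernel_coef[OF x h] show "Poly_Mapping.keys ?h \<subseteq> lattice_poly tau"
    and "n \<in> lattice_poly tau \<Longrightarrow> Poly_Mapping.lookup ?h n = (if kdeg n = d then coef n x else 0)"
    by simp_all
qed

section \<open>Comparison of the two projections\<close>

definition Bw :: "'n \<Rightarrow> ('n gen, 'k) free_alg" where
  "Bw i = kF i + pscale (c i) (kE (tau i) * Kw (- alpha i))"

lemma B_cl: "B chi J tau c = (\<lambda>i. cl (Bw i))"
  by (simp add: fun_eq_iff B_def U_F_def U_E_def U_K_cl Bw_def pscale_mult_left)

lemma kE_eqv: "kE (tau i) * Kw (- alpha i) \<approx> Et (tau i) * Kw (alpha (tau i) - alpha i)"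
  by (rule nf_eq_imp) (simp add: Et_def nf_def vac_def acts_mult acts_Kw)

text \<open>Writing \<open>E_tau(i) K_i^-1\<close> as \<open>Et (tau i)\<close> times a torus
  element of degree zero shows that \<open>B_i\<close> has filtration degree one and
  \<open>B_vee\<close> is its class there; \<open>p\<close> is then evaluated on the same
  representatives on both sides.\<close>

lemma Bw_FF: "Bw i \<in> FF 1"
  and B_vee_eq: "B_vee chi J tau c i = Gam (conc 1 (Bw i))"
proof -
  let ?K = "Kw (alpha (tau i) - alpha i) :: ('n gen, 'k) free_alg"
  have K: "?K \<in> FF 0" using Kw_theta_FF[OF alpha_theta[of "tau i"]] by simp
  have EK: "Et (tau i) * ?K \<in> FF 1" using FF_mult[OF Et_FF K] by simp
  have cEK: "pscale (c i) (Et (tau i) * ?K) \<in> FF 1"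
    by (rule pm.subspace_scale[OF FF_subspace EK])
  have eqv: "Bw i \<approx> kF i + pscale (c i) (Et (tau i) * ?K)"
    unfolding Bw_def by (intro eqv_add eqv_scale kE_eqv eqv_refl)
  show "Bw i \<in> FF 1"
    by (rule FF_eqv[OF eqv]) (intro pm.subspace_add[OF FF_subspace] kF_FF cEK)
  have "B_vee chi J tau c i = Gam (conc 1 (kF i)) \<oplus>\<^bsub>HH\<^esub>
      hs (c i) \<otimes>\<^bsub>HH\<^esub> (Gam (conc 1 (Et (tau i))) \<otimes>\<^bsub>HH\<^esub> Gam (conc 0 ?K))"
    by (simp add: B_vee_def H_F_eq H_E_eq H_K_eq kdeg_def)
  also have "\<dots> = Gam (conc 1 (kF i + pscale (c i) (Et (tau i) * ?K)))"
    using mult_conc[OF Et_FF K, of "tau i"] hs_mult[OF fam_FF[OF fam_conc[OF EK]], of "c i"]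
    by (simp add: scale_conc add_Gam conc_add)
  also have "\<dots> = Gam (conc 1 (Bw i))"
    unfolding Gam_eq_iff
  proof
    fix m
    have "kF i + pscale (c i) (Et (tau i) * ?K) - Bw i \<in> II"
      using eqv_sym[OF eqv] by (simp add: eqv_def)
    then show "conc 1 (kF i + pscale (c i) (Et (tau i) * ?K)) m - conc 1 (Bw i) m \<in> FP m"
      by (auto simp: conc_def intro: FP_II pm.subspace_0[OF FP_subspace])
  qed
  finally show "B_vee chi J tau c i = Gam (conc 1 (Bw i))" .
qed

text \<open>Each contraction of \<open>F\<^sub>i\<close> with \<open>E\<^sub>i\<close> yields \<open>K\<^sub>i\<close>, which raises the label by
  \<open>2 \<alpha>\<^sub>i\<close>, or \<open>K\<^sub>i\<^sup>-\<^sup>1\<close>, which preserves it.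
  Hence the label of a term of \<open>B\<^sub>w\<close> is \<open>- wt w\<close> or has larger coordinate sum.\<close>

definition lowlab :: "'n lat \<Rightarrow> 'n list \<times> 'n lat \<times> 'n list \<Rightarrow> bool" where
  "lowlab l a \<longleftrightarrow> (case a of (u, m, v) \<Rightarrow> m - weight v = - l \<or> - coord_sum l < coord_sum (m - weight v))"

lemma basisF_label:
  "(u', m', v') \<in> Poly_Mapping.keys (basisF i u m v) \<Longrightarrow>
     m' - weight v' = m - weight v - alpha i \<or> m' - weight v' = m - weight v + alpha i"
proof -
  let ?S = "{p :: ('n, 'k) pbw. \<forall>a\<in>Poly_Mapping.keys p. case a of (u', m', v') \<Rightarrow>
     m' - weight v' = m - weight v - alpha i \<or> m' - weight v' = m - weight v + alpha i}"
  have S: "pm.subspace ?S" by (rule subspace_supported)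
  have "basisF i u m v \<in> ?S"
  proof (induction u)
    case (Cons j u)
    have E: "opE j x \<in> ?S" if "x \<in> ?S" for x
      unfolding opE_def by (rule plin_in_subspace[OF S]) (use that in \<open>force split: prod.splits\<close>)
    let ?s = "Poly_Mapping.single (u, m, v) 1 :: ('n, 'k) pbw"
    have K: "opK i ?s \<in> ?S" "opKi i ?s \<in> ?S" by (auto simp: algebra_simps)
    have "(if i = j then opK i ?s - opKi i ?s else 0) \<in> ?S"
      using pm.subspace_diff[OF S K] pm.subspace_0[OF S] by (cases "i = j") (simp_all only: if_True if_False simp_thms)
    then show ?case
      unfolding basisF.simps by (intro pm.subspace_diff[OF S] E Cons)
  qed (simp add: algebra_simps)
  then show "(u', m', v') \<in> Poly_Mapping.keys (basisF i u m v) \<Longrightarrow>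
     m' - weight v' = m - weight v - alpha i \<or> m' - weight v' = m - weight v + alpha i" by auto
qed

text \<open>A shift by \<open>- alpha i\<close> preserves either alternative. A shift by
  \<open>alpha i\<close> raises the coordinate sum by one while the bound drops by one, so the
  strict inequality holds afterwards whichever alternative held before.\<close>

lemma lowlab_step:
  assumes "lowlab (weight w) (u, m, v)"
    and "m' - weight v' = m - weight v - alpha i \<or> m' - weight v' = m - weight v + alpha i"
  shows "lowlab (weight (i # w)) (u', m', v')"
proof -
  have "L' = - (alpha i + W) \<or> - coord_sum (alpha i + W) < coord_sum L'"
    if "L = - W \<or> - coord_sum W < coord_sum L" "L' = L - alpha i \<or> L' = L + alpha i" for L L' W
    using that by auto
  from this[OF assms(1)[unfolded lowlab_def prod.case] assms(2)] show ?thesis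
    unfolding lowlab_def prod.case weight_Cons .
qed

lemma nf_Bword: "nf (prod_list (map Bw w)) \<in> {p. \<forall>a\<in>Poly_Mapping.keys p. lowlab (weight w) a}"
proof (induction w)
  case Nil
  then show ?case by (simp add: nf_def vac_def lowlab_def)
next
  case (Cons i w)
  let ?S = "{p :: ('n, 'k) pbw. \<forall>a\<in>Poly_Mapping.keys p. lowlab (weight (i # w)) a}"
  have S: "pm.subspace ?S" by (rule subspace_supported)
  let ?x = "nf (prod_list (map Bw w))"
  have F: "opF i ?x \<in> ?S"
    unfolding opF_def
  proof (rule plin_in_subspace[OF S])
    fix a assume a: "a \<in> Poly_Mapping.keys ?x"
    obtain u m v where a_eq: "a = (u, m, v)" by (cases a)
    have "lowlab (weight w) (u, m, v)" using Cons a a_eq by auto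
    then have "lowlab (weight (i # w)) (u', m', v')"
      if "(u', m', v') \<in> Poly_Mapping.keys (basisF i u m v)" for u' m' v'
      using basisF_label[OF that] by (rule lowlab_step)
    then show "(case a of (u, m, v) \<Rightarrow> basisF i u m v) \<in> ?S" by (auto simp: a_eq)
  qed
  have E: "opE (tau i) (acts (Kw (- alpha i)) ?x) \<in> ?S"
  proof -
    have "plinear (\<lambda>x. opE (tau i) (acts (Kw (- alpha i)) x))"
      by (rule plinear_comp[OF plinear_ops(1) plinear_acts])
    then have "opE (tau i) (acts (Kw (- alpha i)) ?x)
        = plin (\<lambda>a. opE (tau i) (acts (Kw (- alpha i)) (Poly_Mapping.single a 1))) ?x"
      by (rule plinear_eq_plin)
    also have "\<dots> \<in> ?S"
    proof (rule plin_in_subspace[OF S])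
      fix a assume a: "a \<in> Poly_Mapping.keys ?x"
      obtain u m v where a_eq: "a = (u, m, v)" by (cases a)
      have "lowlab (weight w) (u, m, v)" using Cons a a_eq by auto
      \<comment> \<open>\<open>E_tau(i)\<close> does not affect the label, so this part of
        \<open>B_i\<close> only shifts it by \<open>- alpha i\<close>.\<close>
      then have "lowlab (weight (i # w)) (tau i # u, - alpha i + m, v)"
        by (rule lowlab_step) simp
      then show "opE (tau i) (acts (Kw (- alpha i)) (Poly_Mapping.single a 1)) \<in> ?S"
        by (simp add: a_eq acts_Kw del: weight_Cons)
    qed
    finally show ?thesis .
  qed
  have "nf (prod_list (map Bw (i # w))) = opF i ?x + pscale (c i) (opE (tau i) (acts (Kw (- alpha i)) ?x))"
    by (simp add: Bw_def distrib_right pscale_mult_left nf_add nf_scale nf_mult mult.assoc)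
  then show ?case
    by (simp only:) (rule pm.subspace_add[OF S F pm.subspace_scale[OF S E]])
qed

text \<open>The symbol \<open>([], n, [])\<close> has label \<open>n\<close>, and equality of
  coordinate sums rules out the strict alternative in \<open>lowlab\<close>.\<close>

lemma coef_B:
  assumes p: "homogeneous l p" and n: "coord_sum n = - coord_sum l" "n \<noteq> - l"
  shows "coef n (alg_eval Bw p) = 0"
proof -
  have "coef n (prod_list (map Bw w)) = 0" if "w \<in> Poly_Mapping.keys p" for w
  proof -
    have "weight w = l" using p that by (simp add: homogeneous_def)
    then have "\<not> lowlab (weight w) ([], n, [])" using n by (simp add: lowlab_def)
    then show ?thesis using nf_Bword[of w] by (auto simp: in_keys_iff)
  qed
  then show ?thesis
    by (simp add: alg_eval_def plin_def coef_sum coef_scale)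
qed

lemma projections_agree:
  assumes lam: "lam \<in> nonneg" and p: "homogeneous lam p"
  shows "pi00 chi J (P chi J (- lam) (nc_eval UU sc (B chi J tau c) p))
       = pi00_vee chi J tau (nc_eval HH hs (B_vee chi J tau c) p)"
proof -
  let ?x = "alg_eval Bw p" and ?d = "kdeg (- lam)"
  have len: "length w = ?d" if "w \<in> Poly_Mapping.keys p" for w
    using p that coord_sum_weight[of w] by (simp add: homogeneous_def kdeg_def)
  have x: "?x \<in> FF ?d" by (rule nc_eval_conc(2)[OF Bw_FF len])
  have "nc_eval HH hs (B_vee chi J tau c) p = Gam (conc ?d ?x)"
    using nc_eval_conc(1)[of Bw p ?d, OF Bw_FF len] by (simp add: B_vee_eq[abs_def])
  moreover have "pi00_vee chi J tau (Gam (conc ?d ?x)) = Poly_Mapping.single (- lam) (coef (- lam) ?x)"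
  proof (rule poly_mapping_eqI)
    fix n
    have l: "- lam \<in> lattice_poly tau" by (rule nonneg_poly[OF lam])
    show "Poly_Mapping.lookup (pi00_vee chi J tau (Gam (conc ?d ?x))) n = Poly_Mapping.lookup (Poly_Mapping.single (- lam) (coef (- lam) ?x)) n"
    proof (cases "n \<in> lattice_poly tau")
      case True
      \<comment> \<open>On \<open>lattice_poly\<close> equal \<open>kdeg\<close> means equal
        coordinate sum, so all other torus terms of top degree are excluded.\<close>
      have "coef n ?x = 0" if "n \<noteq> - lam" "kdeg n = ?d"
        by (rule coef_B[OF p _ that(1)]) (use that(2) kdeg_int[OF True] kdeg_int[OF l] in simp)
      then show ?thesis using pi00_vee_conc(2)[OF x True] by (auto simp: lookup_single when_def)
    next
      case False
      then have "n \<notin> Poly_Mapping.keys (pi00_vee chi J tau (Gam (conc ?d ?x)))"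
        using pi00_vee_conc(1)[OF x] by blast
      then show ?thesis using False l by (auto simp: in_keys_iff lookup_single when_def)
    qed
  qed
  moreover have "nc_eval UU sc (B chi J tau c) p = cl ?x"
    unfolding B_cl by (rule nc_eval_cl)
  ultimately show ?thesis by (simp add: pi00_P_cl)
qed

end

theorem theoremC:
  fixes chi :: "'n::{finite,linorder} lat \<Rightarrow> 'n lat \<Rightarrow> 'k::field"
    and J :: "('n, 'k) free_alg set"
    and tau :: "'n \<Rightarrow> 'n"
    and c :: "'n \<Rightarrow> 'k"
    and lam :: "'n lat"
    and p :: "('n, 'k) free_alg"
  assumes "bicharacter chi"
    and "\<And>i j. q chi i j = q chi j i"
    and "graded_biideal chi J"
    and "J \<subseteq> degree_ge_two"
    and "bij tau"
    and "\<And>i. tau (tau i) = i"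
    and "\<And>i j. q chi (tau i) (tau j) = q chi i j"
    and "nc_eval ring_of_type_algebra const (\<lambda>i. letter (tau i)) ` J = J"
    and "lam \<in> nonneg"
    and "homogeneous lam p"
  shows "pi00 chi J (P chi J (- lam) (nc_eval (U chi J) (U_scalar chi J) (B chi J tau c) p))
       = pi00_vee chi J tau
           (nc_eval (Heis chi J tau) (H_scalar chi J tau) (B_vee chi J tau c) p)"
proof -
  interpret symmetric_pair chi J tau c
    by unfold_locales (fact assms)+
  show ?thesis
    by (rule projections_agree[OF assms(9,10)])
qed

end
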